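(* (i) Let $X,Y$ be smooth vector fields on the orbit $\mathbb{B}$. For any $\beta\in\mathbb{B}$, let $U_0^\beta=[\![\overline{X_\beta}(b_0),\overline{Y_\beta}(b_0)]\!]\in\mathfrak{g}$ (see context). Then the sectional curvature of $(\mathbb{B},g^{\mathbb{B}})$ is $$K^{\mathbb{B}}_\beta(X,Y)=\left\|(U_0^\beta)_{\mathfrak{k}}\right\|^2+\frac14\left\|(U_0^\beta)_{\mathfrak{m}}\right\|^2.$$ (ii) If $[\![\mathfrak{m},\mathfrak{m}]\!]\subset\mathfrak{k}$, then $U_0^\beta\in\mathfrak{k}$, so that $K^{\mathbb{B}}_\beta(X,Y)=\|U_0^\beta\|^2$.
   Context: Setting. $\mathbb{G}$ is a compact connected Lie group with neutral element $e$, Lie algebra $\mathfrak{g}=T_e\mathbb{G}$ with bracket $[\![\cdot,\cdot]\!]$ (defined through left-invariant vector fields), and a bi-invariant Riemannian metric $g^{\mathbb{G}}$; $\langle\cdot,\cdot\rangle=g^{\mathbb{G}}_e$ and $\|\cdot\|$ is its norm. $\mathbb{G}$ acts smoothly (on the left) on a smooth manifold $\mathbb{M}$. Fix $b_0\in\mathbb{M}$, let $\mathbb{B}=\mathbb{G}\cdot b_0$ be its orbit (an embedded submanifold), $\mathbb{K}$ the isotropy group of $b_0$, and $\pi_0:\mathbb{G}\to\mathbb{B}$, $\pi_0(Q)=Q\cdot b_0$. $\mathbb{B}$ carries the metric $g^{\mathbb{B}}$ for which the induced diffeomorphism $\mathbb{G}/\mathbb{K}\to\mathbb{B}$ is an isometry,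 $\mathbb{G}/\mathbb{K}$ having the quotient metric of $g^{\mathbb{G}}$. $\mathfrak{k}=\ker(d_e\pi_0)$ is the Lie algebra of $\mathbb{K}$, $\mathfrak{m}=\mathfrak{k}^\perp$; $u_{\mathfrak{k}},u_{\mathfrak{m}}$ are the components of $u\in\mathfrak{g}=\mathfrak{k}\oplus\mathfrak{m}$. For $\beta\in\mathbb{B}$, $Q_\beta\in\mathbb{G}$ is a chosen element with $Q_\beta\cdot b_0=\beta$. For $\Delta\in T_b\mathbb{B}$, $Q\cdot[\Delta]\in T_{Q\cdot b}\mathbb{B}$ is its image under the differential of $b'\mapsto Q\cdot b'$. For $b$ near $b_0$: $X_\beta(b)=Q_\beta^{-1}\cdot[X(Q_\beta\cdot b)]$ and similarly $Y_\beta$. For a vector field $Z$ near $b_0$, $\overline{Z}(b_0)=((d_e\pi_0)|_{\mathfrak{m}})^{-1}(Z(b_0))\in\mathfrak{m}$. Convention: $K_\beta(X,Y)=g_\beta(R(X,Y)Y,X)$ with $R(X,Y)Z=\nabla_X\nabla_YZ-\nabla_Y\nabla_XZ-\nabla_{[X,Y]}Z$, i.e. not divided by the squared area of the parallelogram spanned by $X(\beta),Y(\beta)$ (it is the usual sectional curvature when these are orthonormal). *)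

theory Defs
  imports "HOL-Analysis.Analysis" "HOL-Algebra.Group_Action" "HOL-Algebra.Left_Coset"
begin

section \<open>Smooth functions between subsets of normed spaces\<close>

primrec Ck_on :: "nat \<Rightarrow> ('a::real_normed_vector \<Rightarrow> 'b::real_normed_vector) \<Rightarrow> 'a set \<Rightarrow> bool" where
  "Ck_on 0 f S \<longleftrightarrow> continuous_on S f"
| "Ck_on (Suc n) f S \<longleftrightarrow>
     (\<forall>x\<in>S. f differentiable (at x)) \<and> (\<forall>v. Ck_on n (\<lambda>x. frechet_derivative f (at x) v) S)"

text \<open>The set \<open>S\<close> need not be open: \<open>f\<close> has to extend locally to a smooth function on an open set.\<close>

definition smooth_on :: "'a::real_normed_vector set \<Rightarrow> ('a \<Rightarrow> 'b::real_normed_vector) \<Rightarrow> bool" where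
  "smooth_on S f \<longleftrightarrow>
     (\<forall>x\<in>S. \<exists>U h. open U \<and> x \<in> U \<and> (\<forall>n. Ck_on n h U) \<and> (\<forall>y\<in>S \<inter> U. h y = f y))"


section \<open>Smooth manifolds and smooth maps\<close>

record ('a, 'e) charted =
  mtop :: "'a topology"
  atlas :: "('a set \<times> ('a \<Rightarrow> 'e)) set"

text \<open>The charts take values in a linear subspace \<open>V\<close> of the Euclidean space \<open>'e\<close>; the dimension of
  the manifold is \<open>dim V\<close>. This only serves to include dimension 0, as \<open>DIM('e)\<close> is positive.\<close>

definition smooth_manifold :: "('a, 'e::euclidean_space) charted \<Rightarrow> bool" where
  "smooth_manifold M \<longleftrightarrow>
     Hausdorff_space (mtop M) \<and> second_countable (mtop M) \<and>
     (\<Union>(U, \<phi>)\<in>atlas M. U) = topspace (mtop M) \<and>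
     (\<exists>V. subspace V \<and>
       (\<forall>(U, \<phi>)\<in>atlas M. openin (mtop M) U \<and> openin (top_of_set V) (\<phi> ` U) \<and>
          homeomorphic_map (subtopology (mtop M) U) (top_of_set (\<phi> ` U)) \<phi>)) \<and>
     (\<forall>(U, \<phi>)\<in>atlas M. \<forall>(U', \<psi>)\<in>atlas M.
        smooth_on (\<phi> ` (U \<inter> U')) (\<psi> \<circ> inv_into U \<phi>))"

definition smooth_map ::
    "('a, 'e::euclidean_space) charted \<Rightarrow> ('b, 'f::euclidean_space) charted \<Rightarrow> ('a \<Rightarrow> 'b) \<Rightarrow> bool" where
  "smooth_map M N F \<longleftrightarrow>
     continuous_map (mtop M) (mtop N) F \<and>
     (\<forall>(U, \<phi>)\<in>atlas M. \<forall>(U', \<psi>)\<in>atlas N.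
        smooth_on (\<phi> ` {x\<in>U. F x \<in> U'}) (\<psi> \<circ> F \<circ> inv_into U \<phi>))"

definition prod_charted ::
    "('a, 'e) charted \<Rightarrow> ('b, 'f) charted \<Rightarrow> ('a \<times> 'b, 'e \<times> 'f) charted" where
  "prod_charted M N =
     \<lparr> mtop = prod_topology (mtop M) (mtop N),
       atlas = {(U \<times> U', map_prod \<phi> \<psi>) | U \<phi> U' \<psi>. (U, \<phi>) \<in> atlas M \<and> (U', \<psi>) \<in> atlas N} \<rparr>"


section \<open>Tangent vectors, vector fields and Riemannian geometry\<close>

text \<open>
  A smooth structure is recorded by its underlying set and its algebra of smooth real functions.
  This treats a manifold given by an atlas, an embedded submanifold (whose smooth functions are the
  local restrictions) and a homogeneous space (whose smooth functions are those with smooth pullback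
  to the group) in the same way. A function belongs or does not belong to \<open>fns\<close> according to its
  values on \<open>pts\<close> only; its values elsewhere are arbitrary.
\<close>

record 'a smooth_space =
  pts :: "'a set"
  fns :: "('a \<Rightarrow> real) set"

definition manifold_space :: "('a, 'e::euclidean_space) charted \<Rightarrow> 'a smooth_space" where
  "manifold_space M =
     \<lparr> pts = topspace (mtop M),
       fns = {f. \<forall>(U, \<phi>)\<in>atlas M. smooth_on (\<phi> ` U) (f \<circ> inv_into U \<phi>)} \<rparr>"

definition submanifold_space ::
    "('a, 'e::euclidean_space) charted \<Rightarrow> 'a set \<Rightarrow> 'a smooth_space" where
  "submanifold_space M B =
     \<lparr> pts = B,
       fns = {f. \<forall>b\<in>B. \<exists>U F. openin (mtop M) U \<and> b \<in> U \<and> F \<in> fns (manifold_space M) \<and>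
                           (\<forall>x\<in>U \<inter> B. f x = F x)} \<rparr>"

definition smooth_space_map :: "'a smooth_space \<Rightarrow> 'b smooth_space \<Rightarrow> ('a \<Rightarrow> 'b) \<Rightarrow> bool" where
  "smooth_space_map N N' F \<longleftrightarrow> F \<in> pts N \<rightarrow> pts N' \<and> (\<forall>f\<in>fns N'. f \<circ> F \<in> fns N)"

type_synonym 'a tvec = "('a \<Rightarrow> real) \<Rightarrow> real"
type_synonym 'a vfield = "'a \<Rightarrow> 'a tvec"
type_synonym 'a metric_tensor = "'a \<Rightarrow> 'a tvec \<Rightarrow> 'a tvec \<Rightarrow> real"

text \<open>Tangent vectors at \<open>p\<close> are the derivations at \<open>p\<close> of the algebra of smooth functions. Being 0
  outside that algebra makes them extensional, so that equality of tangent vectors is equality in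
  HOL. By the Leibniz rule they do not depend on values of functions outside \<open>pts\<close>: the indicator of
  the complement of \<open>pts\<close> is in \<open>fns\<close>.\<close>

definition tangent_space :: "'a smooth_space \<Rightarrow> 'a \<Rightarrow> 'a tvec set" where
  "tangent_space N p =
     {v. (\<forall>f\<in>fns N. \<forall>h\<in>fns N. \<forall>a b. v (\<lambda>x. a * f x + b * h x) = a * v f + b * v h) \<and>
         (\<forall>f\<in>fns N. \<forall>h\<in>fns N. v (\<lambda>x. f x * h x) = f p * v h + h p * v f) \<and>
         (\<forall>f. f \<notin> fns N \<longrightarrow> v f = 0)}"

text \<open>The differential of \<open>F\<close>, as a map into the tangent spaces of \<open>N\<close>.\<close>

definition differential :: "'b smooth_space \<Rightarrow> ('a \<Rightarrow> 'b) \<Rightarrow> 'a tvec \<Rightarrow> 'b tvec" where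
  "differential N F v = (\<lambda>f. if f \<in> fns N then v (f \<circ> F) else 0)"

definition vector_fields :: "'a smooth_space \<Rightarrow> 'a vfield set" where
  "vector_fields N =
     {X. (\<forall>p\<in>pts N. X p \<in> tangent_space N p) \<and> (\<forall>f\<in>fns N. (\<lambda>p. X p f) \<in> fns N)}"

definition vf_bracket :: "'a smooth_space \<Rightarrow> 'a vfield \<Rightarrow> 'a vfield \<Rightarrow> 'a vfield" where
  "vf_bracket N X Y =
     (\<lambda>p f. if f \<in> fns N then X p (\<lambda>q. Y q f) - Y p (\<lambda>q. X q f) else 0)"

definition riemannian_metric :: "'a smooth_space \<Rightarrow> 'a metric_tensor \<Rightarrow> bool" where
  "riemannian_metric N g \<longleftrightarrow>
     (\<forall>p\<in>pts N. \<forall>u\<in>tangent_space N p. \<forall>v\<in>tangent_space N p. \<forall>w\<in>tangent_space N p. \<forall>a b.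
        g p (\<lambda>f. a * u f + b * v f) w = a * g p u w + b * g p v w \<and> g p u v = g p v u) \<and>
     (\<forall>p\<in>pts N. \<forall>u\<in>tangent_space N p. u \<noteq> (\<lambda>f. 0) \<longrightarrow> g p u u > 0) \<and>
     (\<forall>X\<in>vector_fields N. \<forall>Y\<in>vector_fields N. (\<lambda>p. g p (X p) (Y p)) \<in> fns N)"

definition affine_connection ::
    "'a smooth_space \<Rightarrow> ('a vfield \<Rightarrow> 'a vfield \<Rightarrow> 'a vfield) \<Rightarrow> bool" where
  "affine_connection N D \<longleftrightarrow>
     (\<forall>X\<in>vector_fields N. \<forall>Y\<in>vector_fields N. D X Y \<in> vector_fields N) \<and>
     (\<forall>X\<in>vector_fields N. \<forall>X'\<in>vector_fields N. \<forall>Y\<in>vector_fields N. \<forall>h\<in>fns N. \<forall>h'\<in>fns N. \<forall>p\<in>pts N.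
        D (\<lambda>q f. h q * X q f + h' q * X' q f) Y p = (\<lambda>f. h p * D X Y p f + h' p * D X' Y p f)) \<and>
     (\<forall>X\<in>vector_fields N. \<forall>Y\<in>vector_fields N. \<forall>Y'\<in>vector_fields N. \<forall>p\<in>pts N.
        D X (\<lambda>q f. Y q f + Y' q f) p = (\<lambda>f. D X Y p f + D X Y' p f)) \<and>
     (\<forall>X\<in>vector_fields N. \<forall>Y\<in>vector_fields N. \<forall>h\<in>fns N. \<forall>p\<in>pts N.
        D X (\<lambda>q f. h q * Y q f) p = (\<lambda>f. X p h * Y p f + h p * D X Y p f))"

definition levi_civita ::
    "'a smooth_space \<Rightarrow> 'a metric_tensor \<Rightarrow> ('a vfield \<Rightarrow> 'a vfield \<Rightarrow> 'a vfield) \<Rightarrow> bool" where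
  "levi_civita N g D \<longleftrightarrow>
     affine_connection N D \<and>
     (\<forall>X\<in>vector_fields N. \<forall>Y\<in>vector_fields N. \<forall>p\<in>pts N.
        (\<lambda>f. D X Y p f - D Y X p f) = vf_bracket N X Y p) \<and>
     (\<forall>X\<in>vector_fields N. \<forall>Y\<in>vector_fields N. \<forall>Z\<in>vector_fields N. \<forall>p\<in>pts N.
        X p (\<lambda>q. g q (Y q) (Z q)) = g p (D X Y p) (Z p) + g p (Y p) (D X Z p))"

definition curvature ::
    "'a smooth_space \<Rightarrow> ('a vfield \<Rightarrow> 'a vfield \<Rightarrow> 'a vfield) \<Rightarrow>
     'a vfield \<Rightarrow> 'a vfield \<Rightarrow> 'a vfield \<Rightarrow> 'a vfield" where
  "curvature N D X Y Z =
     (\<lambda>p f. D X (D Y Z) p f - D Y (D X Z) p f - D (vf_bracket N X Y) Z p f)"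

text \<open>Not divided by the squared area of the parallelogram spanned by \<open>X p\<close> and \<open>Y p\<close>.\<close>

definition sectional_curvature ::
    "'a smooth_space \<Rightarrow> 'a metric_tensor \<Rightarrow> ('a vfield \<Rightarrow> 'a vfield \<Rightarrow> 'a vfield) \<Rightarrow>
     'a \<Rightarrow> 'a vfield \<Rightarrow> 'a vfield \<Rightarrow> real" where
  "sectional_curvature N g D p X Y = g p (curvature N D X Y Y p) (X p)"

definition tangent_kernel ::
    "'a smooth_space \<Rightarrow> 'b smooth_space \<Rightarrow> ('a \<Rightarrow> 'b) \<Rightarrow> 'a \<Rightarrow> 'a tvec set" where
  "tangent_kernel N N' F p = {v \<in> tangent_space N p. differential N' F v = (\<lambda>f. 0)}"

definition orthogonal_complement ::
    "'a smooth_space \<Rightarrow> 'a metric_tensor \<Rightarrow> 'a \<Rightarrow> 'a tvec set \<Rightarrow> 'a tvec set" where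
  "orthogonal_complement N g p W = {v \<in> tangent_space N p. \<forall>w\<in>W. g p v w = 0}"

definition riemannian_submersion ::
    "'a smooth_space \<Rightarrow> 'a metric_tensor \<Rightarrow> 'b smooth_space \<Rightarrow> 'b metric_tensor \<Rightarrow> ('a \<Rightarrow> 'b) \<Rightarrow> bool" where
  "riemannian_submersion N g N' g' F \<longleftrightarrow>
     smooth_space_map N N' F \<and>
     (\<forall>p\<in>pts N. differential N' F ` tangent_space N p = tangent_space N' (F p)) \<and>
     (\<forall>p\<in>pts N. \<forall>u\<in>orthogonal_complement N g p (tangent_kernel N N' F p).
        \<forall>v\<in>orthogonal_complement N g p (tangent_kernel N N' F p).
          g' (F p) (differential N' F u) (differential N' F v) = g p u v)"

definition riemannian_isometry ::
    "'a smooth_space \<Rightarrow> 'a metric_tensor \<Rightarrow> 'b smooth_space \<Rightarrow> 'b metric_tensor \<Rightarrow> ('a \<Rightarrow> 'b) \<Rightarrow> bool" where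
  "riemannian_isometry N g N' g' F \<longleftrightarrow>
     bij_betw F (pts N) (pts N') \<and>
     smooth_space_map N N' F \<and> smooth_space_map N' N (inv_into (pts N) F) \<and>
     (\<forall>p\<in>pts N. \<forall>u\<in>tangent_space N p. \<forall>v\<in>tangent_space N p.
        g' (F p) (differential N' F u) (differential N' F v) = g p u v)"

text \<open>The component in \<open>W\<close> of a tangent vector, along the direct sum of \<open>W\<close> and \<open>W'\<close>.\<close>

definition component :: "'a tvec set \<Rightarrow> 'a tvec set \<Rightarrow> 'a tvec \<Rightarrow> 'a tvec" where
  "component W W' u = (THE w. w \<in> W \<and> (\<lambda>f. u f - w f) \<in> W')"

definition tangent_norm :: "'a metric_tensor \<Rightarrow> 'a \<Rightarrow> 'a tvec \<Rightarrow> real" where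
  "tangent_norm g p u = sqrt (g p u u)"


section \<open>Lie groups, homogeneous spaces and orbits\<close>

definition lie_group :: "'g monoid \<Rightarrow> ('g, 'e::euclidean_space) charted \<Rightarrow> bool" where
  "lie_group G MG \<longleftrightarrow>
     group G \<and> smooth_manifold MG \<and> topspace (mtop MG) = carrier G \<and>
     smooth_map (prod_charted MG MG) MG (\<lambda>(P, Q). P \<otimes>\<^bsub>G\<^esub> Q) \<and>
     smooth_map MG MG (\<lambda>Q. inv\<^bsub>G\<^esub> Q)"

definition smooth_action ::
    "'g monoid \<Rightarrow> ('g, 'e::euclidean_space) charted \<Rightarrow> ('m, 'f::euclidean_space) charted \<Rightarrow>
     ('g \<Rightarrow> 'm \<Rightarrow> 'm) \<Rightarrow> bool" where
  "smooth_action G MG M act \<longleftrightarrow>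
     group_action G (topspace (mtop M)) act \<and>
     smooth_map (prod_charted MG M) M (\<lambda>(Q, b). act Q b)"

definition bi_invariant :: "'g monoid \<Rightarrow> 'g smooth_space \<Rightarrow> 'g metric_tensor \<Rightarrow> bool" where
  "bi_invariant G N g \<longleftrightarrow>
     (\<forall>Q\<in>carrier G. \<forall>P\<in>carrier G. \<forall>u\<in>tangent_space N P. \<forall>v\<in>tangent_space N P.
        g (Q \<otimes>\<^bsub>G\<^esub> P) (differential N (\<lambda>R. Q \<otimes>\<^bsub>G\<^esub> R) u) (differential N (\<lambda>R. Q \<otimes>\<^bsub>G\<^esub> R) v) = g P u v \<and>
        g (P \<otimes>\<^bsub>G\<^esub> Q) (differential N (\<lambda>R. R \<otimes>\<^bsub>G\<^esub> Q) u) (differential N (\<lambda>R. R \<otimes>\<^bsub>G\<^esub> Q) v) = g P u v)"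

definition left_invariant_field :: "'g monoid \<Rightarrow> 'g smooth_space \<Rightarrow> 'g tvec \<Rightarrow> 'g vfield" where
  "left_invariant_field G N u = (\<lambda>Q. differential N (\<lambda>P. Q \<otimes>\<^bsub>G\<^esub> P) u)"

definition lie_bracket :: "'g monoid \<Rightarrow> 'g smooth_space \<Rightarrow> 'g tvec \<Rightarrow> 'g tvec \<Rightarrow> 'g tvec" where
  "lie_bracket G N u v =
     vf_bracket N (left_invariant_field G N u) (left_invariant_field G N v) \<one>\<^bsub>G\<^esub>"

definition homogeneous_space ::
    "'g monoid \<Rightarrow> ('g, 'e::euclidean_space) charted \<Rightarrow> 'g set \<Rightarrow> 'g set smooth_space" where
  "homogeneous_space G MG K =
     \<lparr> pts = lcosets\<^bsub>G\<^esub> K,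
       fns = {f. (\<lambda>Q. f (Q <#\<^bsub>G\<^esub> K)) \<in> fns (manifold_space MG)} \<rparr>"

text \<open>The map \<open>Q K \<mapsto> Q b\<^sub>0\<close> induced on left cosets of the isotropy group \<open>K\<close> of \<open>b\<^sub>0\<close>.\<close>

definition coset_to_orbit :: "('g \<Rightarrow> 'm \<Rightarrow> 'm) \<Rightarrow> 'm \<Rightarrow> 'g set \<Rightarrow> 'm" where
  "coset_to_orbit act b0 c = the_elem ((\<lambda>Q. act Q b0) ` c)"

text \<open>The vector field \<open>b \<mapsto> Q\<^sup>-\<^sup>1 \<cdot> [X (Q \<cdot> b)]\<close> on the orbit.\<close>

definition pull_field ::
    "'g monoid \<Rightarrow> 'm smooth_space \<Rightarrow> ('g \<Rightarrow> 'm \<Rightarrow> 'm) \<Rightarrow> 'g \<Rightarrow> 'm vfield \<Rightarrow> 'm vfield" where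
  "pull_field G N act Q X = (\<lambda>b. differential N (act (inv\<^bsub>G\<^esub> Q)) (X (act Q b)))"

end

theory Submission
  imports Defs
begin

text \<open>
  The proof is carried out upstairs on the group. A vector field \<open>X\<close> on the orbit has a horizontal
  lift, which in a left-invariant orthonormal frame is a function \<open>x\<close> from \<open>G\<close> to \<open>\<mm>\<close>. In terms of
  lifts, the Lie bracket is \<open>X y - Y x + [x, y]\<^sub>\<mm>\<close> and, as \<open>ad\<close> is skew by bi-invariance, the
  Levi-Civita connection is \<open>X y + [x, y]\<^sub>\<mm> / 2\<close>. Lifts are equivariant under the isotropy group, so
  an element \<open>w\<close> of \<open>\<kk>\<close> differentiates them by \<open>- ad w\<close>; this turns the vertical part of \<open>[X, Y]\<close>
  into the \<open>\<kk>\<close>-component of the curvature, and the remaining terms add up to a quarter of the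
  \<open>\<mm>\<close>-component.

  Tangent vectors are abstract derivations. Hadamard's formula \<open>F = F(e) + \<Sum>\<^sub>i x\<^sub>i H\<^sub>i\<close>, globalised by
  a bump function and with the other variable of the group as a parameter, shows that there are
  finitely many independent ones, that the invariant fields are smooth, and that left- and
  right-invariant fields commute. The lifts are smooth because
  \<open>X = \<Sum>\<^sub>u \<langle>X, u\<^sup>*\<rangle> u\<^sup>*\<close>, where \<open>u\<close> runs through an orthonormal basis of the Lie algebra and \<open>u\<^sup>*\<close>
  is the fundamental vector field of \<open>u\<close>.
\<close>

section \<open>Calculus of smooth functions\<close>

text \<open>The orbit need not carry a global frame: the projections of left-invariant fields depend
  on the group element, while right-invariant fields do descend, namely to the fundamental fields.
  These are too many for a basis, but as \<open>Ad\<close> is orthogonal they form a tight frame: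
  the squared inner products with them add up to the squared norm. So they replace local frames
  wherever fields on the orbit are needed, for the smoothness of lifts as well as for testing the
  connection. The connection is only given as some operator \<open>D\<close> with
  \<open>levi_civita\<close>; its formula on lifts comes from the uniqueness argument of Koszul. In
  the curvature all derivatives of lifts cancel except for the vertical part of the commutator. With
  \<open>U = [x, y]\<close>, the connection along the bracket field contributes -1/2 of
  \<open>[U, y]\<close> and iterating the connection gives back 1/4; skewness of \<open>ad\<close>
  turns the remaining -1/4 into the positive quarter of the theorem. The orbit is an embedded
  submanifold, the coset space is described by pullbacks. The assumed isometry identifies their
  smooth functions; afterwards only the projection from the group is used.\<close>

lemma Ck_on_cong:
  assumes "open S" and "\<And>x. x \<in> S \<Longrightarrow> f x = g x" and "Ck_on n f S"
  shows "Ck_on n g S"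
  using assms(2,3)
proof (induction n arbitrary: f g)
  case 0
  then show ?case by (simp cong: continuous_on_cong)
next
  case (Suc n)
  have der: "(g has_derivative frechet_derivative f (at x)) (at x)" if "x \<in> S" for x
  proof -
    have "(f has_derivative frechet_derivative f (at x)) (at x)"
      using Suc.prems(2) that by (simp add: frechet_derivative_works)
    then show ?thesis
      by (rule has_derivative_transform_within_open[OF _ assms(1) that]) (simp add: Suc.prems(1))
  qed
  have "Ck_on n (\<lambda>x. frechet_derivative g (at x) v) S" for v
  proof (rule Suc.IH)
    show "frechet_derivative f (at x) v = frechet_derivative g (at x) v" if "x \<in> S" for x
      using frechet_derivative_at[OF der[OF that]] by simp
    show "Ck_on n (\<lambda>x. frechet_derivative f (at x) v) S"
      using Suc.prems(2) by simp
  qed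
  moreover have "\<forall>x\<in>S. g differentiable (at x)"
    using der differentiableI by blast
  ultimately show ?case by simp
qed

text \<open>Closure properties are proved by exhibiting an explicit derivative \<open>f'\<close>;
  this rule transfers its regularity to the function chosen by
  \<open>frechet_derivative\<close>.\<close>

lemma Ck_on_SucI:
  assumes der: "\<And>x. x \<in> S \<Longrightarrow> (f has_derivative f' x) (at x)"
    and "open S" and "\<And>v. Ck_on n (\<lambda>x. f' x v) S"
  shows "Ck_on (Suc n) f S"
proof -
  have "Ck_on n (\<lambda>x. frechet_derivative f (at x) v) S" for v
    by (rule Ck_on_cong[OF assms(2) _ assms(3)[of v]])
      (simp add: frechet_derivative_at[OF der, symmetric])
  moreover have "\<forall>x\<in>S. f differentiable (at x)"
    using der differentiableI by blast
  ultimately show ?thesis by simp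
qed

lemma Ck_on_SucD:
  assumes "Ck_on (Suc n) f S" and "x \<in> S"
  shows "(f has_derivative frechet_derivative f (at x)) (at x)"
  using assms by (simp add: frechet_derivative_works)

lemma Ck_on_subset: "Ck_on n f S \<Longrightarrow> T \<subseteq> S \<Longrightarrow> Ck_on n f T"
  by (induction n arbitrary: f) (auto intro: continuous_on_subset)

lemma Ck_on_Suc_imp: "Ck_on (Suc n) f S \<Longrightarrow> Ck_on n f S"
proof (induction n arbitrary: f)
  case 0
  then show ?case
    by (auto intro!: continuous_at_imp_continuous_on differentiable_imp_continuous_within)
qed auto

lemma Ck_on_local:
  assumes "open S" and "\<And>x. x \<in> S \<Longrightarrow> \<exists>U. open U \<and> x \<in> U \<and> Ck_on n f (U \<inter> S)"
  shows "Ck_on n f S"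
  using assms(2)
proof (induction n arbitrary: f)
  case 0
  have "continuous (at x) f" if x: "x \<in> S" for x
  proof -
    obtain U where "open U" "x \<in> U" "continuous_on (U \<inter> S) f"
      using 0[OF x] by auto
    then show ?thesis
      using continuous_on_eq_continuous_at[of "U \<inter> S" f] assms(1) x by auto
  qed
  then show ?case by (simp add: continuous_at_imp_continuous_on)
next
  case (Suc n)
  have "f differentiable (at x)" if "x \<in> S" for x
    using Suc.prems[OF that] that by auto
  moreover have "Ck_on n (\<lambda>x. frechet_derivative f (at x) v) S" for v
  proof (rule Suc.IH)
    fix x assume "x \<in> S"
    then obtain U where "open U" "x \<in> U" "Ck_on (Suc n) f (U \<inter> S)"
      using Suc.prems by blast
    then show "\<exists>U. open U \<and> x \<in> U \<and> Ck_on n (\<lambda>x. frechet_derivative f (at x) v) (U \<inter> S)"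
      by auto
  qed
  ultimately show ?case by simp
qed

lemma Ck_on_const [simp]: "Ck_on n (\<lambda>x. c) S"
  by (induction n arbitrary: c) auto

lemma Ck_on_bounded_linear:
  assumes "bounded_linear f"
  shows "Ck_on n f S"
proof (cases n)
  case 0
  then show ?thesis
    using assms by (simp add: linear_continuous_on)
next
  case (Suc m)
  have "frechet_derivative f (at x) = f" for x
    using bounded_linear_imp_has_derivative[OF assms] frechet_derivative_at by metis
  then show ?thesis
    using Suc assms by (auto simp: bounded_linear_imp_differentiable)
qed

lemma Ck_on_add:
  assumes "open S" and "Ck_on n f S" and "Ck_on n g S"
  shows "Ck_on n (\<lambda>x. f x + g x) S"
  using assms(2,3)
proof (induction n arbitrary: f g)
  case 0
  then show ?case by (auto intro: continuous_intros)
next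
  case (Suc n)
  show ?case
    by (rule Ck_on_SucI[OF has_derivative_add[OF Ck_on_SucD[OF Suc.prems(1)] Ck_on_SucD[OF Suc.prems(2)]]])
      (use Suc assms(1) in auto)
qed

lemma Ck_on_sum:
  assumes "open S" and "\<And>i. i \<in> I \<Longrightarrow> Ck_on n (f i) S"
  shows "Ck_on n (\<lambda>x. \<Sum>i\<in>I. f i x) S"
  using assms(2) by (induction I rule: infinite_finite_induct) (auto intro: Ck_on_add[OF assms(1)])

lemma Ck_on_bilinear:
  assumes "bounded_bilinear m" and "open S" and "Ck_on n f S" and "Ck_on n g S"
  shows "Ck_on n (\<lambda>x. m (f x) (g x)) S"
  using assms(3,4)
proof (induction n arbitrary: f g)
  case 0
  then show ?case
    using bounded_bilinear.continuous_on[OF assms(1)] by auto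
next
  case (Suc n)
  have "Ck_on n f S" "Ck_on n g S"
    and "Ck_on n (\<lambda>x. frechet_derivative f (at x) v) S"
      "Ck_on n (\<lambda>x. frechet_derivative g (at x) v) S" for v
    using Suc.prems Ck_on_Suc_imp by (blast, blast, simp_all)
  then have D: "Ck_on n (\<lambda>x. m (f x) (frechet_derivative g (at x) v)
      + m (frechet_derivative f (at x) v) (g x)) S" for v
    by (intro Ck_on_add[OF assms(2)] Suc.IH)
  show ?case
    by (rule Ck_on_SucI[OF bounded_bilinear.FDERIV[OF assms(1)
            Ck_on_SucD[OF Suc.prems(1)] Ck_on_SucD[OF Suc.prems(2)]] assms(2) D])
qed

text \<open>\<open>Ck_on\<close> differentiates along fixed vectors, but the chain rule evaluates
  the derivative of \<open>g\<close> at a vector that moves with \<open>x\<close>. Expanding this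
  vector in \<open>Basis\<close> leaves fixed directions, hence the Euclidean type
  \<open>'b\<close>.\<close>

lemma Ck_on_compose:
  fixes f :: "'a::real_normed_vector \<Rightarrow> 'b::euclidean_space" and g :: "'b \<Rightarrow> 'c::real_normed_vector"
  assumes "open S" and "open T" and "f ` S \<subseteq> T" and "Ck_on n f S" and "Ck_on n g T"
  shows "Ck_on n (\<lambda>x. g (f x)) S"
  using assms(4,5)
proof (induction n arbitrary: g)
  case 0
  then show ?case
    using continuous_on_compose2[OF _ _ assms(3)] by simp
next
  case (Suc n)
  have fT: "f x \<in> T" if "x \<in> S" for x using assms(3) that by auto
  have der: "((\<lambda>x. g (f x)) has_derivative
      (\<lambda>v. \<Sum>b\<in>Basis. (frechet_derivative f (at x) v \<bullet> b) *\<^sub>R frechet_derivative g (at (f x)) b)) (at x)"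
    if "x \<in> S" for x
  proof -
    have g: "(g has_derivative frechet_derivative g (at (f x))) (at (f x))"
      using Ck_on_SucD[OF Suc.prems(2)] fT that by auto
    then have lin: "linear (frechet_derivative g (at (f x)))"
      by (rule has_derivative_linear)
    have eq: "frechet_derivative g (at (f x)) w = (\<Sum>b\<in>Basis. (w \<bullet> b) *\<^sub>R frechet_derivative g (at (f x)) b)" for w
    proof -
      have "frechet_derivative g (at (f x)) w
          = frechet_derivative g (at (f x)) (\<Sum>b\<in>Basis. (w \<bullet> b) *\<^sub>R b)"
        by (simp only: euclidean_representation)
      then show ?thesis
        by (simp only: linear_sum[OF lin] linear_cmul[OF lin])
    qed
    show ?thesis
      by (rule has_derivative_eq_rhs[OF has_derivative_compose[OF Ck_on_SucD[OF Suc.prems(1) that] g]])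
        (rule ext, rule eq)
  qed
  have C: "Ck_on n (\<lambda>x. frechet_derivative g (at (f x)) b) S" for b
    using Suc.prems(2) by (intro Suc.IH[OF Ck_on_Suc_imp[OF Suc.prems(1)]]) simp
  have C2: "Ck_on n (\<lambda>x. frechet_derivative f (at x) v \<bullet> b) S" for v b
    using Suc.prems by (intro Ck_on_bilinear[OF bounded_bilinear_inner assms(1)]) simp_all
  have D: "Ck_on n (\<lambda>x. \<Sum>b\<in>Basis.
      (frechet_derivative f (at x) v \<bullet> b) *\<^sub>R frechet_derivative g (at (f x)) b) S" for v
    by (intro Ck_on_sum[OF assms(1)] Ck_on_bilinear[OF bounded_bilinear_scaleR assms(1)] C C2)
  show ?case
    by (rule Ck_on_SucI[OF der assms(1) D])
qed

lemma Ck_on_Pair: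
  fixes f :: "'a::real_normed_vector \<Rightarrow> 'b::real_normed_vector" and g :: "'a \<Rightarrow> 'c::real_normed_vector"
  assumes "open S" and "Ck_on n f S" and "Ck_on n g S"
  shows "Ck_on n (\<lambda>x. (f x, g x)) S"
  using assms(2,3)
proof (induction n arbitrary: f g)
  case 0
  then show ?case by (auto intro: continuous_intros)
next
  case (Suc n)
  show ?case
    by (rule Ck_on_SucI[OF has_derivative_Pair[OF Ck_on_SucD[OF Suc.prems(1)] Ck_on_SucD[OF Suc.prems(2)]]])
      (use Suc assms(1) in auto)
qed

section \<open>Smooth functions on arbitrary subsets\<close>

lemma smooth_onI_open:
  assumes "open S" and "\<And>n. Ck_on n f S"
  shows "smooth_on S f"
  using assms unfolding smooth_on_def by blast

lemma smooth_onE: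
  assumes "smooth_on S f" and "x \<in> S"
  obtains U h where "open U" "x \<in> U" "\<And>n. Ck_on n h U" "\<And>y. y \<in> S \<Longrightarrow> y \<in> U \<Longrightarrow> h y = f y"
proof -
  obtain U h where "open U \<and> x \<in> U \<and> (\<forall>n. Ck_on n h U) \<and> (\<forall>y\<in>S \<inter> U. h y = f y)"
    using assms unfolding smooth_on_def by meson
  then show thesis by (intro that[of U h]) auto
qed

text \<open>On an open set a local extension agrees with \<open>f\<close> near each point, so it has
  the same derivatives there and can be discarded.\<close>

lemma smooth_on_open_iff:
  assumes "open S"
  shows "smooth_on S f \<longleftrightarrow> (\<forall>n. Ck_on n f S)"
proof
  assume sm: "smooth_on S f"
  show "\<forall>n. Ck_on n f S"
  proof (intro allI Ck_on_local[OF assms])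
    fix n x assume "x \<in> S"
    then obtain U h where U: "open U" "x \<in> U" "\<And>n. Ck_on n h U" "\<And>y. y \<in> S \<Longrightarrow> y \<in> U \<Longrightarrow> h y = f y"
      using smooth_onE[OF sm] by metis
    have "Ck_on n f (U \<inter> S)"
      by (rule Ck_on_cong[OF _ _ Ck_on_subset[OF U(3)]]) (use U assms in auto)
    then show "\<exists>U. open U \<and> x \<in> U \<and> Ck_on n f (U \<inter> S)"
      using U(1,2) by blast
  qed
qed (use assms in \<open>auto intro: smooth_onI_open\<close>)

lemma smooth_on_cong_subset:
  assumes "smooth_on S f" and "T \<subseteq> S" and "\<And>x. x \<in> T \<Longrightarrow> f x = g x"
  shows "smooth_on T g"
  unfolding smooth_on_def
proof
  fix x assume "x \<in> T"
  then have "x \<in> S" using assms(2) by auto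
  obtain U h where U: "open U" "x \<in> U" "\<And>n. Ck_on n h U" "\<And>y. y \<in> S \<Longrightarrow> y \<in> U \<Longrightarrow> h y = f y"
    using smooth_onE[OF assms(1) \<open>x \<in> S\<close>] by metis
  show "\<exists>U h. open U \<and> x \<in> U \<and> (\<forall>n. Ck_on n h U) \<and> (\<forall>y\<in>T \<inter> U. h y = g y)"
    using U assms(2,3) by (intro exI[of _ U] exI[of _ h]) auto
qed

lemma smooth_on_subset: "smooth_on S f \<Longrightarrow> T \<subseteq> S \<Longrightarrow> smooth_on T f"
  by (erule smooth_on_cong_subset) auto

lemma smooth_on_cong: "smooth_on S f \<Longrightarrow> (\<And>x. x \<in> S \<Longrightarrow> f x = g x) \<Longrightarrow> smooth_on S g"
  by (erule smooth_on_cong_subset) auto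

lemma smooth_on_local:
  assumes "\<And>x. x \<in> S \<Longrightarrow> \<exists>T. openin (top_of_set S) T \<and> x \<in> T \<and> smooth_on T f"
  shows "smooth_on S f"
  unfolding smooth_on_def
proof
  fix x assume "x \<in> S"
  then obtain T where T: "openin (top_of_set S) T" "x \<in> T" "smooth_on T f"
    using assms by blast
  obtain W where W: "open W" "T = S \<inter> W"
    using T(1) openin_open by metis
  obtain U h where U: "open U" "x \<in> U" "\<And>n. Ck_on n h U" "\<And>y. y \<in> T \<Longrightarrow> y \<in> U \<Longrightarrow> h y = f y"
    using smooth_onE[OF T(3,2)] by metis
  show "\<exists>U h. open U \<and> x \<in> U \<and> (\<forall>n. Ck_on n h U) \<and> (\<forall>y\<in>S \<inter> U. h y = f y)"
    using U W T(2) by (intro exI[of _ "U \<inter> W"] exI[of _ h]) (auto intro: Ck_on_subset)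
qed

lemma smooth_on_const [simp]: "smooth_on S (\<lambda>x. c)"
  by (rule smooth_on_subset[OF smooth_onI_open[OF open_UNIV]]) auto

lemma smooth_on_bounded_linear: "bounded_linear f \<Longrightarrow> smooth_on S f"
  by (rule smooth_on_subset[OF smooth_onI_open[OF open_UNIV]]) (auto intro: Ck_on_bounded_linear)

lemma smooth_on_binary:
  fixes S :: "'a::real_normed_vector set"
  assumes "smooth_on S f" and "smooth_on S g"
    and "\<And>(U :: 'a set) n f g. open U \<Longrightarrow> Ck_on n f U \<Longrightarrow> Ck_on n g U \<Longrightarrow> Ck_on n (\<lambda>x. m (f x) (g x)) U"
  shows "smooth_on S (\<lambda>x. m (f x) (g x))"
  unfolding smooth_on_def
proof
  fix x assume "x \<in> S"
  obtain U h where U: "open U" "x \<in> U" "\<And>n. Ck_on n h U" "\<And>y. y \<in> S \<Longrightarrow> y \<in> U \<Longrightarrow> h y = f y"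
    using smooth_onE[OF assms(1) \<open>x \<in> S\<close>] by metis
  obtain V k where V: "open V" "x \<in> V" "\<And>n. Ck_on n k V" "\<And>y. y \<in> S \<Longrightarrow> y \<in> V \<Longrightarrow> k y = g y"
    using smooth_onE[OF assms(2) \<open>x \<in> S\<close>] by metis
  have "Ck_on n (\<lambda>x. m (h x) (k x)) (U \<inter> V)" for n
    by (rule assms(3)[OF open_Int[OF U(1) V(1)] Ck_on_subset[OF U(3)] Ck_on_subset[OF V(3)]]) auto
  then show "\<exists>U h. open U \<and> x \<in> U \<and> (\<forall>n. Ck_on n h U) \<and> (\<forall>y\<in>S \<inter> U. h y = m (f y) (g y))"
    using U V by (intro exI[of _ "U \<inter> V"] exI[of _ "\<lambda>x. m (h x) (k x)"]) auto
qed

lemma smooth_on_add: "smooth_on S f \<Longrightarrow> smooth_on S g \<Longrightarrow> smooth_on S (\<lambda>x. f x + g x)"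
  by (rule smooth_on_binary) (auto intro: Ck_on_add)

lemma smooth_on_bilinear:
  assumes "bounded_bilinear m" and "smooth_on S f" and "smooth_on S g"
  shows "smooth_on S (\<lambda>x. m (f x) (g x))"
  by (rule smooth_on_binary[OF assms(2,3)]) (rule Ck_on_bilinear[OF assms(1)])

lemmas smooth_on_mult = smooth_on_bilinear[OF bounded_bilinear_mult]
lemmas smooth_on_inner = smooth_on_bilinear[OF bounded_bilinear_inner]

lemma smooth_on_Pair: "smooth_on S f \<Longrightarrow> smooth_on S g \<Longrightarrow> smooth_on S (\<lambda>x. (f x, g x))"
  by (rule smooth_on_binary) (auto intro: Ck_on_Pair)

lemma smooth_on_compose:
  fixes f :: "'a::real_normed_vector \<Rightarrow> 'b::euclidean_space" and g :: "'b \<Rightarrow> 'c::real_normed_vector"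
  assumes "smooth_on S f" and "smooth_on T g" and "f ` S \<subseteq> T"
  shows "smooth_on S (\<lambda>x. g (f x))"
  unfolding smooth_on_def
proof
  fix x assume "x \<in> S"
  obtain U h where U: "open U" "x \<in> U" "\<And>n. Ck_on n h U" "\<And>y. y \<in> S \<Longrightarrow> y \<in> U \<Longrightarrow> h y = f y"
    using smooth_onE[OF assms(1) \<open>x \<in> S\<close>] by metis
  obtain V k where V: "open V" "f x \<in> V" "\<And>n. Ck_on n k V" "\<And>y. y \<in> T \<Longrightarrow> y \<in> V \<Longrightarrow> k y = g y"
    using smooth_onE[OF assms(2), of "f x"] \<open>x \<in> S\<close> assms(3) by (metis image_subset_iff)
  \<comment> \<open>Off \<open>S\<close> the extension \<open>h\<close> may leave \<open>V\<close>,
    where nothing is known about \<open>k\<close>; hence the restriction to the preimage of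
    \<open>V\<close>.\<close>
  have "continuous_on U h" using U(3)[of 0] by simp
  then have op: "open (U \<inter> h -` V)"
    using U(1) V(1) continuous_open_preimage by blast
  show "\<exists>U h. open U \<and> x \<in> U \<and> (\<forall>n. Ck_on n h U) \<and> (\<forall>y\<in>S \<inter> U. h y = g (f y))"
  proof (intro exI[of _ "U \<inter> h -` V"] exI[of _ "\<lambda>x. k (h x)"] conjI allI ballI)
    show "x \<in> U \<inter> h -` V" using U(2) V(2) U(4)[of x] \<open>x \<in> S\<close> by simp
    show "Ck_on n (\<lambda>x. k (h x)) (U \<inter> h -` V)" for n
      by (rule Ck_on_compose[OF op V(1) _ Ck_on_subset[OF U(3)] V(3)]) auto
    fix y assume y: "y \<in> S \<inter> (U \<inter> h -` V)"
    then have "h y = f y" using U(4) by auto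
    with y show "k (h y) = g (f y)" using V(4) assms(3) by auto
  qed (fact op)
qed

section \<open>Differentiation under the integral sign and Hadamard's formula\<close>

lemma Ck_on_imp_continuous_on: "Ck_on n f S \<Longrightarrow> continuous_on S f"
proof (induction n)
  case (Suc n)
  show ?case by (rule Suc.IH[OF Ck_on_Suc_imp[OF Suc.prems]])
qed simp

text \<open>By the Leibniz rule the derivative of the integral along \<open>v\<close> is the
  integral of a partial derivative of \<open>g\<close>: an integral of the same form with one order
  less, so induction on \<open>n\<close> applies.\<close>

lemma Ck_on_integral:
  fixes g :: "real \<times> 'a::euclidean_space \<Rightarrow> real"
  assumes "open T" and "open W" and TW: "{0..1} \<times> W \<subseteq> T" and "Ck_on n g T"
  shows "Ck_on n (\<lambda>x. integral {0..1} (\<lambda>t. g (t, x))) W"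
  using assms(4)
proof (induction n arbitrary: g)
  case 0
  have "continuous_on (W \<times> cbox 0 1) (\<lambda>(x, t). g (t, x))"
    unfolding split_beta
    by (rule continuous_on_compose2[of T g]) (use 0 TW in \<open>auto intro!: continuous_intros\<close>)
  then show ?case
    using integral_continuous_on_param[of W 0 1 "\<lambda>x t. g (t, x)"] by simp
next
  case (Suc n)
  define g' where "g' x t v = frechet_derivative g (at (t, x)) (0, v)" for x :: 'a and t v
  \<comment> \<open>\<open>leibniz_rule\<close> expects the derivative as a continuous family of
    bounded operators; in finite dimension continuity can be checked on each vector
    separately.\<close>
  define G' where "G' x t = Blinfun (g' x t)" for x t
  have der: "((\<lambda>x. g (t, x)) has_derivative g' x t) (at x within U)" if "x \<in> W" "t \<in> {0..1}" for x t U
  proof -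
    have "(g has_derivative frechet_derivative g (at (t, x))) (at (t, x))"
      using Ck_on_SucD[OF Suc.prems] that TW by blast
    then have "((\<lambda>x. g (t, x)) has_derivative (\<lambda>v. frechet_derivative g (at (t, x)) (0, v))) (at x)"
      by (rule has_derivative_compose[rotated]) (auto intro!: derivative_eq_intros)
    then show ?thesis
      unfolding g'_def by (rule has_derivative_at_withinI)
  qed
  have G': "blinfun_apply (G' x t) = g' x t" if "x \<in> W" "t \<in> {0..1}" for x t
    unfolding G'_def using der[OF that, of UNIV] has_derivative_bounded_linear bounded_linear_Blinfun_apply by blast
  have cont: "continuous_on (W \<times> {0..1}) (\<lambda>p. frechet_derivative g (at (snd p, fst p)) (0, v))" for v
  proof -
    have "continuous_on T (\<lambda>q. frechet_derivative g (at q) (0, v))"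
      by (rule Ck_on_imp_continuous_on[of n]) (use Suc.prems in simp)
    then show ?thesis
      by (rule continuous_on_compose2) (use TW in \<open>auto intro!: continuous_intros\<close>)
  qed
  have cont': "continuous_on (W \<times> {0..1}) (\<lambda>(x, t). G' x t)"
  proof (rule continuous_on_blinfun_componentwise)
    fix v :: 'a
    show "continuous_on (W \<times> {0..1}) (\<lambda>p. blinfun_apply (case p of (x, t) \<Rightarrow> G' x t) v)"
      by (rule continuous_on_eq[OF cont[of v]]) (auto simp: G' g'_def)
  qed
  have int: "(\<lambda>t. g (t, x)) integrable_on {0..1}" if "x \<in> W" for x
  proof (rule integrable_continuous_real)
    have "continuous_on T g"
      by (rule Ck_on_imp_continuous_on[OF Suc.prems])
    then show "continuous_on {0..1} (\<lambda>t. g (t, x))"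
      by (rule continuous_on_compose2) (use TW that in \<open>auto intro!: continuous_intros\<close>)
  qed
  have D: "((\<lambda>x. integral {0..1} (\<lambda>t. g (t, x))) has_derivative
      (\<lambda>v. integral {0..1} (\<lambda>t. frechet_derivative g (at (t, x)) (0, v)))) (at x)" if "x \<in> W" for x
  proof -
    \<comment> \<open>\<open>leibniz_rule\<close> is about convex sets and \<open>W\<close> may fail
      to be convex; a ball around \<open>x\<close> gives the same derivative at
      \<open>x\<close>.\<close>
    obtain e where e: "e > 0" "ball x e \<subseteq> W"
      using assms(2) \<open>x \<in> W\<close> openE by blast
    have L: "((\<lambda>x. integral (cbox 0 1) (\<lambda>t. g (t, x))) has_derivative
        blinfun_apply (integral (cbox 0 1) (G' x))) (at x within ball x e)"
    proof (rule leibniz_rule)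
      show "((\<lambda>x. g (t, x)) has_derivative blinfun_apply (G' y t)) (at y within ball x e)"
        if "y \<in> ball x e" "t \<in> cbox 0 1" for y t
        using der[of y t] G'[of y t] that e by auto
      show "continuous_on (ball x e \<times> cbox 0 1) (\<lambda>(x, t). G' x t)"
        by (rule continuous_on_subset[OF cont']) (use e in auto)
    qed (use int e in auto)
    have A: "at x within ball x e = at x"
      by (rule at_within_open) (use e in auto)
    have "blinfun_apply (integral (cbox 0 1) (G' x)) v
        = integral {0..1} (\<lambda>t. frechet_derivative g (at (t, x)) (0, v))" for v
    proof -
      have "continuous_on {0..1} (G' x)"
        using continuous_on_compose2[OF cont', of "{0..1}" "\<lambda>t. (x, t)"] that
        by (simp add: image_subset_iff continuous_on_Pair)
      then have "G' x integrable_on {0..1}" by (rule integrable_continuous_real)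
      then have "blinfun_apply (integral (cbox 0 1) (G' x)) v = integral {0..1} (\<lambda>t. blinfun_apply (G' x t) v)"
        by (simp add: blinfun_apply_integral)
      also have "\<dots> = integral {0..1} (\<lambda>t. frechet_derivative g (at (t, x)) (0, v))"
        by (rule integral_cong) (simp add: G' that g'_def)
      finally show ?thesis .
    qed
    then show ?thesis
      using has_derivative_eq_rhs[OF L[unfolded A cbox_interval] ext] by simp
  qed
  have C: "Ck_on n (\<lambda>x. integral {0..1} (\<lambda>t. frechet_derivative g (at (t, x)) (0, v))) W" for v
    using Suc.prems by (intro Suc.IH) simp
  show ?case
    by (rule Ck_on_SucI[OF D assms(2) C])
qed

text \<open>The weight of \<open>b\<close> in Hadamard's formula for \<open>k x - k x\<^sub>0\<close>.\<close>

definition hadamard_coeff :: "('a::euclidean_space \<Rightarrow> real) \<Rightarrow> 'a \<Rightarrow> 'a \<Rightarrow> 'a \<Rightarrow> real" where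
  "hadamard_coeff k x0 b x = integral {0..1} (\<lambda>t. frechet_derivative k (at (x0 + t *\<^sub>R (x - x0))) b)"

text \<open>The fundamental theorem of calculus along the segment from \<open>x0\<close> to
  \<open>x\<close>, which convexity keeps in \<open>C\<close>; linearity of the derivative then
  splits off the factors \<open>(x - x0) \<bullet> b\<close>.\<close>

lemma hadamard_formula:
  assumes "open C" and "convex C" and "x0 \<in> C" and "x \<in> C" and "Ck_on 1 k C"
  shows "k x - k x0 = (\<Sum>b\<in>Basis. ((x - x0) \<bullet> b) * hadamard_coeff k x0 b x)"
proof -
  define c where "c t = x0 + t *\<^sub>R (x - x0)" for t
  have c: "c t \<in> C" if "t \<in> {0..1}" for t
  proof -
    have "c t = (1 - t) *\<^sub>R x0 + t *\<^sub>R x" by (simp add: c_def algebra_simps)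
    then show ?thesis
      using that convexD_alt[OF assms(2,3,4), of t] by simp
  qed
  have der: "(k has_derivative frechet_derivative k (at y)) (at y)" if "y \<in> C" for y
    using Ck_on_SucD[of 0 k C y] assms(5) that by simp
  have lin: "frechet_derivative k (at y) v = (\<Sum>b\<in>Basis. (v \<bullet> b) * frechet_derivative k (at y) b)"
    if "y \<in> C" for y v
  proof -
    have l: "linear (frechet_derivative k (at y))"
      using der[OF that] has_derivative_linear by blast
    have "frechet_derivative k (at y) v = frechet_derivative k (at y) (\<Sum>b\<in>Basis. (v \<bullet> b) *\<^sub>R b)"
      by (simp only: euclidean_representation)
    then show ?thesis
      by (simp only: linear_sum[OF l] linear_cmul[OF l] real_scaleR_def)
  qed
  have int: "(\<lambda>t. frechet_derivative k (at (c t)) b) integrable_on {0..1}" for b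
  proof (rule integrable_continuous_real)
    have "continuous_on C (\<lambda>y. frechet_derivative k (at y) b)" using assms(5) by simp
    then show "continuous_on {0..1} (\<lambda>t. frechet_derivative k (at (c t)) b)"
      by (rule continuous_on_compose2) (use c in \<open>auto simp: c_def intro!: continuous_intros\<close>)
  qed
  have "((\<lambda>t. frechet_derivative k (at (c t)) (x - x0)) has_integral (k (c 1) - k (c 0))) {0..1}"
  proof (rule fundamental_theorem_of_calculus)
    fix t :: real assume t: "t \<in> {0..1}"
    have "(c has_derivative (\<lambda>s. s *\<^sub>R (x - x0))) (at t)"
      unfolding c_def by (auto intro!: derivative_eq_intros)
    then have "((\<lambda>t. k (c t)) has_derivative (\<lambda>s. frechet_derivative k (at (c t)) (s *\<^sub>R (x - x0)))) (at t)"
      using der[OF c[OF t]] by (rule has_derivative_compose)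
    moreover have "linear (frechet_derivative k (at (c t)))"
      using der[OF c[OF t]] has_derivative_linear by blast
    ultimately have "((\<lambda>t. k (c t)) has_vector_derivative frechet_derivative k (at (c t)) (x - x0)) (at t)"
      by (simp add: has_vector_derivative_def linear_cmul)
    then show "((\<lambda>t. k (c t)) has_vector_derivative frechet_derivative k (at (c t)) (x - x0)) (at t within {0..1})"
      by (rule has_vector_derivative_at_within)
  qed simp
  then have "k x - k x0 = integral {0..1} (\<lambda>t. frechet_derivative k (at (c t)) (x - x0))"
    by (simp add: c_def integral_unique)
  also have "\<dots> = integral {0..1} (\<lambda>t. \<Sum>b\<in>Basis. ((x - x0) \<bullet> b) * frechet_derivative k (at (c t)) b)"
    using lin c by (intro integral_cong) blast
  also have "\<dots> = (\<Sum>b\<in>Basis. ((x - x0) \<bullet> b) * integral {0..1} (\<lambda>t. frechet_derivative k (at (c t)) b))"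
    using int by (subst integral_sum) (auto intro: integrable_on_mult_right)
  finally show ?thesis by (simp add: hadamard_coeff_def c_def)
qed

text \<open>The second variable is a parameter, frozen while the coefficient is formed; the point is
  joint regularity in both variables. One order is lost, which costs nothing for smooth
  functions.\<close>

lemma Ck_on_hadamard_coeff:
  fixes f :: "'a::euclidean_space \<times> 'b::euclidean_space \<Rightarrow> real"
  assumes "open C" and "convex C" and "x0 \<in> C" and "open W" and f: "Ck_on (Suc n) f (C \<times> W)"
  shows "Ck_on n (\<lambda>p. hadamard_coeff (\<lambda>x. f (x, snd p)) x0 b (fst p)) (C \<times> W)"
proof -
  define q :: "real \<times> 'a \<times> 'b \<Rightarrow> 'a \<times> 'b" where
    "q s = (x0 + fst s *\<^sub>R (fst (snd s) - x0), snd (snd s))" for s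
  \<comment> \<open>\<open>Ck_on_integral\<close> needs an open domain, and the closed interval
    times \<open>C \<times> W\<close> is none; the preimage under \<open>q\<close> is an open
    enlargement.\<close>
  define T where "T = q -` (C \<times> W)"
  have cq: "continuous_on UNIV q"
    unfolding q_def by (intro continuous_intros)
  have T: "open T"
    unfolding T_def by (intro open_vimage open_Times assms(1,4) cq)
  have ec: "x0 + t *\<^sub>R (x - x0) \<in> C" if "t \<in> {0..1}" "x \<in> C" for t x
  proof -
    have "x0 + t *\<^sub>R (x - x0) = (1 - t) *\<^sub>R x0 + t *\<^sub>R x" by (simp add: algebra_simps)
    then show ?thesis
      using that convexD_alt[OF assms(2,3) that(2), of t] by simp
  qed
  have TW: "{0..1} \<times> (C \<times> W) \<subseteq> T"
    using ec by (auto simp: T_def q_def)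
  have Cq: "Ck_on n q T"
  proof -
    have "Ck_on n (\<lambda>s. fst s *\<^sub>R (fst (snd s) - x0)) T"
    proof (rule Ck_on_bilinear[OF bounded_bilinear_scaleR T])
      show "Ck_on n (\<lambda>s. fst (snd s) - x0) T"
        using Ck_on_add[OF T Ck_on_bounded_linear[of "\<lambda>s. fst (snd s)"] Ck_on_const[of n "- x0"]]
        by (simp add: bounded_linear_intros)
    qed (rule Ck_on_bounded_linear[OF bounded_linear_fst])
    moreover have "Ck_on n (\<lambda>s. snd (snd s)) T"
      by (intro Ck_on_bounded_linear bounded_linear_intros)
    ultimately show ?thesis
      unfolding q_def by (intro Ck_on_Pair Ck_on_add T Ck_on_const)
  qed
  have "Ck_on n (\<lambda>y. frechet_derivative f (at y) (b, 0)) (C \<times> W)"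
    using f by simp
  then have "Ck_on n (\<lambda>s. frechet_derivative f (at (q s)) (b, 0)) T"
    by (intro Ck_on_compose[OF T _ _ Cq]) (auto simp: T_def assms open_Times)
  then have "Ck_on n (\<lambda>p. integral {0..1} (\<lambda>t. frechet_derivative f (at (q (t, p))) (b, 0))) (C \<times> W)"
    by (rule Ck_on_integral[OF T open_Times[OF assms(1,4)] TW])
  moreover have "integral {0..1} (\<lambda>t. frechet_derivative f (at (q (t, p))) (b, 0))
      = hadamard_coeff (\<lambda>x. f (x, snd p)) x0 b (fst p)" if p: "p \<in> C \<times> W" for p
    unfolding hadamard_coeff_def
  proof (rule integral_cong)
    fix t :: real assume t: "t \<in> {0..1}"
    let ?y = "x0 + t *\<^sub>R (fst p - x0)"
    have "(f has_derivative frechet_derivative f (at (?y, snd p))) (at (?y, snd p))"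
      using Ck_on_SucD[OF f] ec[OF t] p by auto
    then have "((\<lambda>x. f (x, snd p)) has_derivative (\<lambda>v. frechet_derivative f (at (?y, snd p)) (v, 0))) (at ?y)"
      by (rule has_derivative_compose[rotated]) (auto intro!: derivative_eq_intros)
    then show "frechet_derivative f (at (q (t, p))) (b, 0) = frechet_derivative (\<lambda>x. f (x, snd p)) (at ?y) b"
      using frechet_derivative_at by (metis fst_conv q_def snd_conv)
  qed
  ultimately show ?thesis
    by (rule Ck_on_cong[OF open_Times[OF assms(1,4)], rotated])
qed

section \<open>A smooth bump function\<close>

definition flat :: "nat \<Rightarrow> real \<Rightarrow> real" where
  "flat k t = (if t > 0 then inverse t ^ k * exp (- inverse t) else 0)"

text \<open>With \<open>s = inverse t\<close> tending to infinity from the right of 0, the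
  exponential beats the power \<open>s ^ k\<close>.\<close>

lemma flat_tendsto_0: "(flat k \<longlongrightarrow> 0) (at 0)"
proof -
  have "((\<lambda>t. inverse t ^ k / exp (inverse t)) \<longlongrightarrow> 0) (at_right (0::real))"
    by (rule filterlim_compose[OF tendsto_power_div_exp_0 filterlim_inverse_at_top_right])
  moreover have "\<forall>\<^sub>F t in at_right 0. inverse t ^ k / exp (inverse t) = flat k t"
    by (rule eventually_at_rightI[of 0 1]) (auto simp: flat_def exp_minus field_simps)
  ultimately have "(flat k \<longlongrightarrow> 0) (at_right 0)"
    by (rule Lim_transform_eventually)
  moreover have "(flat k \<longlongrightarrow> 0) (at_left 0)"
    by (rule Lim_transform_eventually[OF tendsto_const])
      (auto intro!: eventually_at_leftI[of "-1"] simp: flat_def)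
  ultimately show ?thesis by (simp add: filterlim_split_at)
qed

text \<open>The exponent \<open>k\<close> exists for the sake of this formula: derivatives of
  members of the family are combinations of members, so smoothness follows by induction for all
  \<open>k\<close> at once.\<close>

lemma flat_has_derivative:
  "(flat k has_real_derivative (flat (k + 2) t - real k * flat (k + 1) t)) (at t)"
proof -
  consider "t > 0" | "t = 0" | "t < 0" by linarith
  then show ?thesis
  proof cases
    case 1
    have "((\<lambda>t. inverse t ^ k * exp (- inverse t)) has_real_derivative
        (flat (k + 2) t - real k * flat (k + 1) t)) (at t)"
      using 1 by (auto intro!: derivative_eq_intros simp: flat_def power2_eq_square algebra_simps)
        (cases k; simp add: algebra_simps)
    then show ?thesis
      by (rule has_field_derivative_transform_within_open[of _ _ _ "{0<..}"]) (use 1 in \<open>auto simp: flat_def\<close>)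
  next
    case 2
    \<comment> \<open>Away from \<open>h = 0\<close> the difference quotient of
      \<open>flat k\<close> at 0 is \<open>flat (Suc k)\<close>, which tends to 0.\<close>
    have "((\<lambda>h. (flat k (0 + h) - flat k 0) / h) \<longlongrightarrow> 0) (at 0)"
      using flat_tendsto_0[of "Suc k"]
      by (rule Lim_transform_eventually)
        (auto simp: flat_def field_simps eventually_at_filter)
    then show ?thesis
      using 2 by (simp add: DERIV_def flat_def)
  next
    case 3
    have "((\<lambda>t. 0) has_real_derivative 0) (at t)" by simp
    then have "(flat k has_real_derivative 0) (at t)"
      by (rule has_field_derivative_transform_within_open[of _ _ _ "{..<0}"]) (use 3 in \<open>auto simp: flat_def\<close>)
    then show ?thesis using 3 by (simp add: flat_def)
  qed
qed

lemma Ck_on_flat: "Ck_on n (flat k) UNIV"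
proof (induction n arbitrary: k)
  case 0
  show ?case
    using DERIV_isCont[OF flat_has_derivative] by (simp add: continuous_at_imp_continuous_on)
next
  case (Suc n)
  have D: "(flat k has_derivative (\<lambda>v. v * (flat (k + 2) t - real k * flat (k + 1) t))) (at t)" for t
    using flat_has_derivative[of k t] by (simp add: has_field_derivative_def mult.commute[of _ "_ - _"])
  have "Ck_on n (\<lambda>t. v * (flat (k + 2) t + (- real k) * flat (k + 1) t)) UNIV" for v
    by (intro Ck_on_bilinear[OF bounded_bilinear_mult] Ck_on_add Ck_on_const Suc.IH open_UNIV)
  then show ?case
    by (intro Ck_on_SucI[OF D]) auto
qed

text \<open>Normalised to be 1 at the centre, without a plateau around it. The defect away from the
  centre is absorbed later by an extra coordinate of the Hadamard formula.\<close>

definition bump :: "'a::euclidean_space \<Rightarrow> real \<Rightarrow> 'a \<Rightarrow> real" where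
  "bump x0 r x = flat 0 (r\<^sup>2 - (x - x0) \<bullet> (x - x0)) / flat 0 (r\<^sup>2)"

lemma smooth_on_bump: "smooth_on S (bump x0 r)"
proof -
  have "smooth_on UNIV (\<lambda>x. r\<^sup>2 + (-1) * ((x + - x0) \<bullet> (x + - x0)))"
    by (intro smooth_on_add smooth_on_mult smooth_on_inner smooth_on_const smooth_on_bounded_linear bounded_linear_ident)
  then have "smooth_on UNIV (\<lambda>x. flat 0 (r\<^sup>2 + (-1) * ((x + - x0) \<bullet> (x + - x0))))"
    by (rule smooth_on_compose[OF _ smooth_onI_open[OF open_UNIV Ck_on_flat]]) auto
  then have "smooth_on UNIV (\<lambda>x. flat 0 (r\<^sup>2 + (-1) * ((x + - x0) \<bullet> (x + - x0))) * inverse (flat 0 (r\<^sup>2)))"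
    by (intro smooth_on_mult smooth_on_const)
  then show ?thesis
    by (rule smooth_on_cong_subset) (auto simp: bump_def divide_inverse)
qed

lemma bump_center: "r > 0 \<Longrightarrow> bump x0 r x0 = 1"
  by (simp add: bump_def flat_def)

lemma bump_eq_0:
  assumes "r > 0" and "dist x0 x \<ge> r"
  shows "bump x0 r x = 0"
proof -
  have "r\<^sup>2 \<le> (norm (x - x0))\<^sup>2"
    using assms by (intro power_mono) (auto simp: dist_norm norm_minus_commute)
  then show ?thesis
    by (simp add: bump_def flat_def power2_norm_eq_inner)
qed

section \<open>Smooth functions on manifolds and their products\<close>

text \<open>The properties of an atlas that pass directly to \<open>prod_charted\<close>; smooth
  functions on products are handled through them, without the full notion of
  \<open>smooth_manifold\<close>.\<close>

definition open_charts :: "('a, 'e::euclidean_space) charted \<Rightarrow> bool" where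
  "open_charts M \<longleftrightarrow> (\<forall>(U, \<phi>)\<in>atlas M. U \<subseteq> topspace (mtop M) \<and> inj_on \<phi> U \<and>
     (\<forall>A. openin (mtop M) A \<longrightarrow> openin (top_of_set (\<phi> ` U)) (\<phi> ` (U \<inter> A))))"

lemma open_chartsD:
  assumes "open_charts M" and "(U, \<phi>) \<in> atlas M"
  shows "U \<subseteq> topspace (mtop M)" and "inj_on \<phi> U"
    and "openin (mtop M) A \<Longrightarrow> openin (top_of_set (\<phi> ` U)) (\<phi> ` (U \<inter> A))"
  using bspec[OF assms(1)[unfolded open_charts_def] assms(2)] by auto

lemma manifold_chart:
  assumes "smooth_manifold M" and "(U, \<phi>) \<in> atlas M"
  shows "openin (mtop M) U"
    and "homeomorphic_map (subtopology (mtop M) U) (top_of_set (\<phi> ` U)) \<phi>"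
    and "\<exists>V. subspace V \<and> openin (top_of_set V) (\<phi> ` U)"
proof -
  obtain V where "subspace V" and "\<forall>(U, \<phi>)\<in>atlas M. openin (mtop M) U \<and> openin (top_of_set V) (\<phi> ` U) \<and>
      homeomorphic_map (subtopology (mtop M) U) (top_of_set (\<phi> ` U)) \<phi>"
    using assms(1) unfolding smooth_manifold_def by auto
  with bspec[OF this(2) assms(2)]
  show "openin (mtop M) U" "homeomorphic_map (subtopology (mtop M) U) (top_of_set (\<phi> ` U)) \<phi>"
    "\<exists>V. subspace V \<and> openin (top_of_set V) (\<phi> ` U)"
    by auto
qed

lemma manifold_transition:
  assumes "smooth_manifold M" and "(U, \<phi>) \<in> atlas M" and "(U', \<psi>) \<in> atlas M"
  shows "smooth_on (\<phi> ` (U \<inter> U')) (\<lambda>x. \<psi> (inv_into U \<phi> x))"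
proof -
  have "\<forall>(U, \<phi>)\<in>atlas M. \<forall>(U', \<psi>)\<in>atlas M. smooth_on (\<phi> ` (U \<inter> U')) (\<psi> \<circ> inv_into U \<phi>)"
    using assms(1) by (simp add: smooth_manifold_def)
  from bspec[OF this assms(2)] assms(3) show ?thesis by (auto simp: o_def)
qed

lemma manifold_cover:
  assumes "smooth_manifold M" and "p \<in> topspace (mtop M)"
  obtains U \<phi> where "(U, \<phi>) \<in> atlas M" and "p \<in> U"
proof -
  have "p \<in> (\<Union>(U, \<phi>)\<in>atlas M. U)"
    using assms unfolding smooth_manifold_def by simp
  then show thesis using that by auto
qed

lemma open_charts_manifold:
  assumes "smooth_manifold M"
  shows "open_charts M"
  unfolding open_charts_def
proof (safe)
  fix U \<phi> assume c: "(U, \<phi>) \<in> atlas M"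
  note h = manifold_chart[OF assms c]
  have U: "U \<subseteq> topspace (mtop M)" using h(1) openin_subset by blast
  then show "x \<in> topspace (mtop M)" if "x \<in> U" for x using that by auto
  show "inj_on \<phi> U"
    using homeomorphic_imp_injective_map[OF h(2)] U by (simp add: inf.absorb2)
  fix A assume "openin (mtop M) A"
  then have "openin (subtopology (mtop M) U) (U \<inter> A)"
    using openin_subtopology_Int2 by blast
  then show "openin (top_of_set (\<phi> ` U)) (\<phi> ` (U \<inter> A))"
    using homeomorphic_imp_open_map[OF h(2)] by (simp add: open_map_def)
qed

lemma continuous_map_chart_inv:
  assumes "smooth_manifold M" and "(U, \<phi>) \<in> atlas M"
  shows "continuous_map (top_of_set (\<phi> ` U)) (mtop M) (inv_into U \<phi>)"
proof -
  note h = manifold_chart[OF assms]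
  note oc = open_chartsD[OF open_charts_manifold[OF assms(1)] assms(2)]
  show ?thesis
    unfolding continuous_map_def
  proof (intro conjI allI impI)
    show "inv_into U \<phi> \<in> topspace (top_of_set (\<phi> ` U)) \<rightarrow> topspace (mtop M)"
      using oc(1,2) by auto
    fix A assume A: "openin (mtop M) A"
    have "{x \<in> topspace (top_of_set (\<phi> ` U)). inv_into U \<phi> x \<in> A} = \<phi> ` (U \<inter> A)"
      using oc(2) by auto
    then show "openin (top_of_set (\<phi> ` U)) {x \<in> topspace (top_of_set (\<phi> ` U)). inv_into U \<phi> x \<in> A}"
      using oc(3)[OF A] by simp
  qed
qed

lemma open_charts_prod:
  assumes "open_charts M" and "open_charts N"
  shows "open_charts (prod_charted M N)"
  unfolding open_charts_def
proof (safe)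
  fix W \<theta> assume c: "(W, \<theta>) \<in> atlas (prod_charted M N)"
  then obtain U \<phi> U' \<psi> where W: "W = U \<times> U'" "\<theta> = map_prod \<phi> \<psi>"
    and c1: "(U, \<phi>) \<in> atlas M" and c2: "(U', \<psi>) \<in> atlas N"
    by (auto simp: prod_charted_def)
  note m = open_chartsD[OF assms(1) c1] and n = open_chartsD[OF assms(2) c2]
  show "z \<in> topspace (mtop (prod_charted M N))" if "z \<in> W" for z
    using that m(1) n(1) by (auto simp: prod_charted_def W)
  show "inj_on \<theta> W"
    unfolding W by (rule map_prod_inj_on[OF m(2) n(2)])
  fix A assume A: "openin (mtop (prod_charted M N)) A"
  show "openin (top_of_set (\<theta> ` W)) (\<theta> ` (W \<inter> A))"
  proof (subst openin_subopen, intro ballI)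
    fix z assume "z \<in> \<theta> ` (W \<inter> A)"
    then obtain p q where pq: "p \<in> U" "q \<in> U'" "(p, q) \<in> A" "z = (\<phi> p, \<psi> q)"
      by (auto simp: W)
    obtain B C where BC: "openin (mtop M) B" "openin (mtop N) C" "p \<in> B" "q \<in> C" "B \<times> C \<subseteq> A"
      using A pq(3) unfolding prod_charted_def by (simp add: openin_prod_topology_alt) meson
    let ?T = "\<phi> ` (U \<inter> B) \<times> \<psi> ` (U' \<inter> C)"
    have "openin (top_of_set (\<phi> ` U \<times> \<psi> ` U')) ?T"
      by (intro openin_Times m(3) n(3) BC)
    moreover have "\<theta> ` W = \<phi> ` U \<times> \<psi> ` U'"
      unfolding W by force
    moreover have "z \<in> ?T" using pq BC by auto
    moreover have "?T \<subseteq> \<theta> ` (W \<inter> A)"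
      using BC(5) unfolding W by force
    ultimately show "\<exists>T. openin (top_of_set (\<theta> ` W)) T \<and> z \<in> T \<and> T \<subseteq> \<theta> ` (W \<inter> A)"
      by metis
  qed
qed

lemma fns_manifold_iff:
  "F \<in> fns (manifold_space M) \<longleftrightarrow>
     (\<forall>U \<phi>. (U, \<phi>) \<in> atlas M \<longrightarrow> smooth_on (\<phi> ` U) (\<lambda>x. F (inv_into U \<phi> x)))"
  by (auto simp: manifold_space_def o_def)

lemma fns_prod_iff:
  assumes "open_charts M" and "open_charts N"
  shows "F \<in> fns (manifold_space (prod_charted M N)) \<longleftrightarrow>
     (\<forall>U \<phi> U' \<psi>. (U, \<phi>) \<in> atlas M \<longrightarrow> (U', \<psi>) \<in> atlas N \<longrightarrow>
        smooth_on (\<phi> ` U \<times> \<psi> ` U') (\<lambda>p. F (inv_into U \<phi> (fst p), inv_into U' \<psi> (snd p))))"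
proof -
  have *: "smooth_on (map_prod \<phi> \<psi> ` (U \<times> U')) (\<lambda>x. F (inv_into (U \<times> U') (map_prod \<phi> \<psi>) x))
      \<longleftrightarrow> smooth_on (\<phi> ` U \<times> \<psi> ` U') (\<lambda>p. F (inv_into U \<phi> (fst p), inv_into U' \<psi> (snd p)))"
    if c1: "(U, \<phi>) \<in> atlas M" and c2: "(U', \<psi>) \<in> atlas N" for U \<phi> U' \<psi>
  proof -
    note m = open_chartsD(2)[OF assms(1) c1] and n = open_chartsD(2)[OF assms(2) c2]
    have im: "map_prod \<phi> \<psi> ` (U \<times> U') = \<phi> ` U \<times> \<psi> ` U'" by force
    have "inv_into (U \<times> U') (map_prod \<phi> \<psi>) z = (inv_into U \<phi> (fst z), inv_into U' \<psi> (snd z))"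
      if z: "z \<in> \<phi> ` U \<times> \<psi> ` U'" for z
    proof (rule inv_into_f_eq[OF map_prod_inj_on[OF m n]])
      show "(inv_into U \<phi> (fst z), inv_into U' \<psi> (snd z)) \<in> U \<times> U'"
        using z by (auto intro: inv_into_into)
      show "map_prod \<phi> \<psi> (inv_into U \<phi> (fst z), inv_into U' \<psi> (snd z)) = z"
        using z by (auto simp: f_inv_into_f)
    qed
    then show ?thesis
      unfolding im by (intro iffI; elim smooth_on_cong) auto
  qed
  show ?thesis (is "?L \<longleftrightarrow> ?R")
  proof
    assume L: ?L
    show ?R
    proof (intro allI impI)
      fix U \<phi> U' \<psi> assume c: "(U, \<phi>) \<in> atlas M" "(U', \<psi>) \<in> atlas N"
      then have "(U \<times> U', map_prod \<phi> \<psi>) \<in> atlas (prod_charted M N)"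
        by (auto simp: prod_charted_def)
      then show "smooth_on (\<phi> ` U \<times> \<psi> ` U') (\<lambda>p. F (inv_into U \<phi> (fst p), inv_into U' \<psi> (snd p)))"
        using L *[OF c] by (simp add: fns_manifold_iff)
    qed
  next
    assume R: ?R
    show ?L
      unfolding fns_manifold_iff
    proof (intro allI impI)
      fix W \<theta> assume "(W, \<theta>) \<in> atlas (prod_charted M N)"
      then obtain U \<phi> U' \<psi> where W: "W = U \<times> U'" "\<theta> = map_prod \<phi> \<psi>"
        and c: "(U, \<phi>) \<in> atlas M" "(U', \<psi>) \<in> atlas N"
        by (auto simp: prod_charted_def)
      show "smooth_on (\<theta> ` W) (\<lambda>x. F (inv_into W \<theta> x))"
        unfolding W using R c *[OF c] by simp
    qed
  qed
qed

lemma fns_manifold_cong: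
  assumes "open_charts M" and "f \<in> fns (manifold_space M)"
    and "\<And>p. p \<in> topspace (mtop M) \<Longrightarrow> f p = g p"
  shows "g \<in> fns (manifold_space M)"
  unfolding fns_manifold_iff
proof (intro allI impI)
  fix U \<phi> assume c: "(U, \<phi>) \<in> atlas M"
  have "smooth_on (\<phi> ` U) (\<lambda>x. f (inv_into U \<phi> x))"
    using assms(2) c by (simp add: fns_manifold_iff)
  then show "smooth_on (\<phi> ` U) (\<lambda>x. g (inv_into U \<phi> x))"
  proof (rule smooth_on_cong)
    fix x assume "x \<in> \<phi> ` U"
    then have "inv_into U \<phi> x \<in> topspace (mtop M)"
      using open_chartsD(1)[OF assms(1) c] inv_into_into[of x \<phi> U] by auto
    then show "f (inv_into U \<phi> x) = g (inv_into U \<phi> x)" by (rule assms(3))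
  qed
qed

lemma fns_manifold_const: "(\<lambda>p. c) \<in> fns (manifold_space M)"
  by (simp add: fns_manifold_iff)

lemma fns_manifold_add:
  "f \<in> fns (manifold_space M) \<Longrightarrow> g \<in> fns (manifold_space M) \<Longrightarrow> (\<lambda>p. f p + g p) \<in> fns (manifold_space M)"
  by (simp add: fns_manifold_iff smooth_on_add)

lemma fns_manifold_mult:
  "f \<in> fns (manifold_space M) \<Longrightarrow> g \<in> fns (manifold_space M) \<Longrightarrow> (\<lambda>p. f p * g p) \<in> fns (manifold_space M)"
  by (simp add: fns_manifold_iff smooth_on_mult)

text \<open>Near each point \<open>F\<close> is read in a chart of \<open>N\<close> around the image
  point. Continuity of \<open>F\<close> makes the part mapped into that chart domain relatively
  open, so the local statements glue.\<close>

lemma fns_smooth_map: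
  assumes M: "open_charts M" and N: "smooth_manifold N" and F: "smooth_map M N F"
    and f: "f \<in> fns (manifold_space N)"
  shows "(\<lambda>p. f (F p)) \<in> fns (manifold_space M)"
  unfolding fns_manifold_iff
proof (intro allI impI)
  fix U \<phi> assume c: "(U, \<phi>) \<in> atlas M"
  note m = open_chartsD[OF M c]
  have cont: "continuous_map (mtop M) (mtop N) F"
    using F by (simp add: smooth_map_def)
  show "smooth_on (\<phi> ` U) (\<lambda>x. f (F (inv_into U \<phi> x)))"
  proof (rule smooth_on_local)
    fix x assume "x \<in> \<phi> ` U"
    then obtain p where p: "p \<in> U" "x = \<phi> p" by auto
    then have "F p \<in> topspace (mtop N)"
      using m(1) cont by (auto simp: continuous_map_def)
    then obtain U' \<psi> where c': "(U', \<psi>) \<in> atlas N" "F p \<in> U'"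
      using manifold_cover[OF N] by metis
    note n = open_chartsD[OF open_charts_manifold[OF N] c'(1)]
    let ?T = "\<phi> ` {q \<in> U. F q \<in> U'}"
    have "openin (mtop M) {q \<in> topspace (mtop M). F q \<in> U'}"
      using cont manifold_chart(1)[OF N c'(1)] by (rule openin_continuous_map_preimage)
    from m(3)[OF this] have "openin (top_of_set (\<phi> ` U)) ?T"
      using m(1) by (simp add: Int_def subset_iff cong: conj_cong)
    moreover have "x \<in> ?T" using p c' by auto
    moreover have "smooth_on ?T (\<lambda>x. f (F (inv_into U \<phi> x)))"
    proof -
      have s1: "smooth_on ?T (\<lambda>x. \<psi> (F (inv_into U \<phi> x)))"
        using F c c'(1) unfolding smooth_map_def by (fastforce simp: o_def)
      have s2: "smooth_on (\<psi> ` U') (\<lambda>y. f (inv_into U' \<psi> y))"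
        using f c'(1) by (simp add: fns_manifold_iff)
      have "smooth_on ?T (\<lambda>x. f (inv_into U' \<psi> (\<psi> (F (inv_into U \<phi> x)))))"
        by (rule smooth_on_compose[OF s1 s2]) (use m(2) in auto)
      then show ?thesis
        by (rule smooth_on_cong) (use m(2) n(2) in auto)
    qed
    ultimately show "\<exists>T. openin (top_of_set (\<phi> ` U)) T \<and> x \<in> T \<and> smooth_on T (\<lambda>x. f (F (inv_into U \<phi> x)))"
      by blast
  qed
qed

lemma fns_slice_snd:
  assumes M: "smooth_manifold M" and N: "smooth_manifold N" and p: "p \<in> topspace (mtop M)"
    and F: "F \<in> fns (manifold_space (prod_charted M N))"
  shows "(\<lambda>q. F (p, q)) \<in> fns (manifold_space N)"
  unfolding fns_manifold_iff
proof (intro allI impI)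
  fix U' \<psi> assume c': "(U', \<psi>) \<in> atlas N"
  obtain U \<phi> where c: "(U, \<phi>) \<in> atlas M" "p \<in> U"
    using manifold_cover[OF M p] by metis
  note oc = open_charts_manifold[OF M] open_charts_manifold[OF N]
  have "smooth_on (\<phi> ` U \<times> \<psi> ` U') (\<lambda>z. F (inv_into U \<phi> (fst z), inv_into U' \<psi> (snd z)))"
    using F c(1) c' by (simp add: fns_prod_iff[OF oc])
  moreover have "smooth_on (\<psi> ` U') (\<lambda>y. (\<phi> p, y))"
    by (intro smooth_on_Pair smooth_on_const smooth_on_bounded_linear bounded_linear_ident)
  moreover have "(\<lambda>y. (\<phi> p, y)) ` \<psi> ` U' \<subseteq> \<phi> ` U \<times> \<psi> ` U'"
    using c(2) by auto
  ultimately have "smooth_on (\<psi> ` U')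
      (\<lambda>y. F (inv_into U \<phi> (fst (\<phi> p, y)), inv_into U' \<psi> (snd (\<phi> p, y))))"
    using smooth_on_compose by blast
  then show "smooth_on (\<psi> ` U') (\<lambda>y. F (p, inv_into U' \<psi> y))"
    using c(2) open_chartsD(2)[OF oc(1) c(1)] by simp
qed

lemma fns_swap:
  assumes M: "open_charts M" and N: "open_charts N"
    and F: "F \<in> fns (manifold_space (prod_charted M N))"
  shows "(\<lambda>p. F (snd p, fst p)) \<in> fns (manifold_space (prod_charted N M))"
  unfolding fns_prod_iff[OF N M]
proof (intro allI impI)
  fix U' \<psi> U \<phi> assume c: "(U', \<psi>) \<in> atlas N" "(U, \<phi>) \<in> atlas M"
  have "smooth_on (\<phi> ` U \<times> \<psi> ` U') (\<lambda>z. F (inv_into U \<phi> (fst z), inv_into U' \<psi> (snd z)))"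
    using F c by (simp add: fns_prod_iff[OF M N])
  from smooth_on_compose[OF smooth_on_Pair[OF smooth_on_bounded_linear[OF bounded_linear_snd]
        smooth_on_bounded_linear[OF bounded_linear_fst]] this, of "\<psi> ` U' \<times> \<phi> ` U"]
  have "smooth_on (\<psi> ` U' \<times> \<phi> ` U) (\<lambda>z. F (inv_into U \<phi> (snd z), inv_into U' \<psi> (fst z)))"
    by (simp add: image_subset_iff)
  then show "smooth_on (\<psi> ` U' \<times> \<phi> ` U) (\<lambda>z. F (snd (inv_into U' \<psi> (fst z), inv_into U \<phi> (snd z)),
      fst (inv_into U' \<psi> (fst z), inv_into U \<phi> (snd z))))"
    by simp
qed

lemma fns_slice_fst:
  assumes M: "smooth_manifold M" and N: "smooth_manifold N" and q: "q \<in> topspace (mtop N)"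
    and F: "F \<in> fns (manifold_space (prod_charted M N))"
  shows "(\<lambda>p. F (p, q)) \<in> fns (manifold_space M)"
  using fns_slice_snd[OF N M q fns_swap[OF open_charts_manifold[OF M] open_charts_manifold[OF N] F]] by simp

lemma fns_lift_snd:
  assumes M: "open_charts M" and N: "open_charts N" and f: "f \<in> fns (manifold_space N)"
  shows "(\<lambda>p. f (snd p)) \<in> fns (manifold_space (prod_charted M N))"
  unfolding fns_prod_iff[OF M N]
proof (intro allI impI)
  fix U \<phi> U' \<psi> assume c: "(U, \<phi>) \<in> atlas M" "(U', \<psi>) \<in> atlas N"
  have "smooth_on (\<psi> ` U') (\<lambda>z. f (inv_into U' \<psi> z))"
    using f c by (simp add: fns_manifold_iff)
  from smooth_on_compose[OF smooth_on_bounded_linear[OF bounded_linear_snd] this, of "\<phi> ` U \<times> \<psi> ` U'"]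
  show "smooth_on (\<phi> ` U \<times> \<psi> ` U') (\<lambda>p. f (snd (inv_into U \<phi> (fst p), inv_into U' \<psi> (snd p))))"
    by auto
qed

lemma fns_lift_fst:
  assumes M: "open_charts M" and N: "open_charts N" and f: "f \<in> fns (manifold_space M)"
  shows "(\<lambda>p. f (fst p)) \<in> fns (manifold_space (prod_charted M N))"
  using fns_swap[OF N M fns_lift_snd[OF N M f]] by simp

text \<open>Cutting off turns a function that is smooth in one chart of \<open>M\<close> into a
  global one, with the second variable as a smooth parameter throughout. Inside the ball of radius
  \<open>R\<close> the formula is smooth by the change of charts; elsewhere it vanishes in a
  neighbourhood, as the support stays within the smaller radius \<open>r\<close>.\<close>

lemma fns_extend_by_zero:
  assumes M: "smooth_manifold M" and N: "open_charts N"
    and c: "(U, \<phi>) \<in> atlas M" and V: "subspace V" "\<phi> ` U \<subseteq> V" "ball x0 R \<inter> V \<subseteq> \<phi> ` U"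
    and r: "0 < r" "r < R"
    and f: "\<And>U' \<psi>. (U', \<psi>) \<in> atlas N \<Longrightarrow>
      smooth_on ((ball x0 R \<inter> V) \<times> \<psi> ` U') (\<lambda>z. f (fst z) (inv_into U' \<psi> (snd z)))"
  shows "(\<lambda>(p, q). if p \<in> U then bump x0 r (\<phi> p) * f (\<phi> p) q else 0)
    \<in> fns (manifold_space (prod_charted M N))"
    (is "?F \<in> _")
proof -
  note ocM = open_charts_manifold[OF M]
  note u = open_chartsD[OF ocM c]
  show ?thesis
    unfolding fns_prod_iff[OF ocM N]
  proof (intro allI impI smooth_on_local)
    fix U1 \<phi>1 U2 \<psi> z
    assume c1: "(U1, \<phi>1) \<in> atlas M" and c2: "(U2, \<psi>) \<in> atlas N" and "z \<in> \<phi>1 ` U1 \<times> \<psi> ` U2"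
    then obtain p q where p: "p \<in> U1" "q \<in> U2" "z = (\<phi>1 p, \<psi> q)" by auto
    note u1 = open_chartsD[OF ocM c1] and u2 = open_chartsD[OF N c2]
    let ?G = "\<lambda>z. ?F (inv_into U1 \<phi>1 (fst z), inv_into U2 \<psi> (snd z))"
    have op: "openin (top_of_set (\<phi>1 ` U1 \<times> \<psi> ` U2)) (\<phi>1 ` (U1 \<inter> A) \<times> \<psi> ` U2)"
      if "openin (mtop M) A" for A
      using u1(3)[OF that] by (intro openin_Times) auto
    show "\<exists>T. openin (top_of_set (\<phi>1 ` U1 \<times> \<psi> ` U2)) T \<and> z \<in> T \<and> smooth_on T ?G"
    proof (cases "p \<in> U \<and> \<phi> p \<in> ball x0 R")
      case True
      define A where "A = {p \<in> U. \<phi> p \<in> ball x0 R}"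
      have "openin (subtopology (mtop M) U) {x \<in> topspace (subtopology (mtop M) U). \<phi> x \<in> \<phi> ` U \<inter> ball x0 R}"
        by (rule openin_continuous_map_preimage[OF homeomorphic_imp_continuous_map[OF manifold_chart(2)[OF M c]]])
          (simp add: openin_open_Int)
      moreover have "{x \<in> topspace (subtopology (mtop M) U). \<phi> x \<in> \<phi> ` U \<inter> ball x0 R} = A"
        using u(1) by (auto simp: A_def)
      ultimately have A: "openin (mtop M) A"
        using manifold_chart(1)[OF M c] by (simp add: openin_open_subtopology)
      let ?T = "\<phi>1 ` (U1 \<inter> A) \<times> \<psi> ` U2"
      define \<tau> where "\<tau> x = \<phi> (inv_into U1 \<phi>1 x)" for x
      have "smooth_on (\<phi>1 ` (U1 \<inter> A)) \<tau>"
        unfolding \<tau>_def by (rule smooth_on_subset[OF manifold_transition[OF M c1 c]]) (auto simp: A_def)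
      from smooth_on_compose[OF smooth_on_bounded_linear[OF bounded_linear_fst] this, of ?T]
      have \<tau>: "smooth_on ?T (\<lambda>z. \<tau> (fst z))" by auto
      have \<tau>2: "\<tau> x \<in> ball x0 R \<inter> V" if "x \<in> \<phi>1 ` (U1 \<inter> A)" for x
        using that u1(2) V(2) by (auto simp: \<tau>_def A_def)
      have b: "smooth_on ?T (\<lambda>z. bump x0 r (\<tau> (fst z)))"
        by (rule smooth_on_compose[OF \<tau> smooth_on_bump[of UNIV]]) auto
      have "smooth_on ?T (\<lambda>z. (\<tau> (fst z), snd z))"
        by (intro smooth_on_Pair \<tau> smooth_on_bounded_linear bounded_linear_snd)
      from smooth_on_compose[OF this f[OF c2]]
      have "smooth_on ?T (\<lambda>z. f (\<tau> (fst z)) (inv_into U2 \<psi> (snd z)))"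
        using \<tau>2 by force
      from smooth_on_mult[OF b this]
      have "smooth_on ?T ?G"
      proof (rule smooth_on_cong)
        fix z assume "z \<in> ?T"
        then have "inv_into U1 \<phi>1 (fst z) \<in> U"
          using u1(2) by (auto simp: A_def)
        then show "bump x0 r (\<tau> (fst z)) * f (\<tau> (fst z)) (inv_into U2 \<psi> (snd z)) = ?G z"
          by (simp add: \<tau>_def)
      qed
      moreover have "z \<in> ?T" using p True by (auto simp: A_def)
      ultimately show ?thesis using op[OF A] by blast
    next
      case False
      \<comment> \<open>The support of the cut-off lies in this compact set, which is closed because
        \<open>M\<close> is Hausdorff; otherwise the zero extension could jump at a point that is
        not separated from the chart.\<close>
      define C where "C = inv_into U \<phi> ` (cball x0 r \<inter> V)"
      have sub: "cball x0 r \<inter> V \<subseteq> \<phi> ` U"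
        using V(3) r by (auto simp: subset_iff)
      have "compact (cball x0 r \<inter> V)"
        using closed_subspace[OF V(1)] by (intro compact_Int_closed) auto
      then have "compactin (top_of_set (\<phi> ` U)) (cball x0 r \<inter> V)"
        using sub by (simp add: compactin_subtopology)
      then have "compactin (mtop M) C"
        unfolding C_def using continuous_map_chart_inv[OF M c] by (rule image_compactin)
      moreover have "Hausdorff_space (mtop M)"
        using M by (simp add: smooth_manifold_def)
      ultimately have A: "openin (mtop M) (topspace (mtop M) - C)" (is "openin _ ?A")
        using compactin_imp_closedin by blast
      let ?T = "\<phi>1 ` (U1 \<inter> ?A) \<times> \<psi> ` U2"
      have "p \<notin> C"
      proof
        assume "p \<in> C"
        then obtain x where x: "x \<in> cball x0 r \<inter> V" "p = inv_into U \<phi> x" by (auto simp: C_def)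
        then have "x \<in> \<phi> ` U" using sub by blast
        then have "p \<in> U" "\<phi> p = x" using x(2) by (auto simp: inv_into_into f_inv_into_f)
        then show False using False x(1) r by auto
      qed
      then have "z \<in> ?T" using p u1(1) by auto
      moreover have "smooth_on ?T ?G"
      proof (rule smooth_on_cong[OF smooth_on_const[of _ 0]])
        fix z assume "z \<in> ?T"
        then obtain p' where p': "p' \<in> U1" "p' \<notin> C" "fst z = \<phi>1 p'" by auto
        have "bump x0 r (\<phi> p') = 0" if "p' \<in> U"
        proof (rule bump_eq_0[OF r(1)], rule ccontr)
          assume "\<not> r \<le> dist x0 (\<phi> p')"
          then have "\<phi> p' \<in> cball x0 r \<inter> V" using that V(2) by auto
          then have "inv_into U \<phi> (\<phi> p') \<in> C" unfolding C_def by blast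
          then show False using p'(2) that u(2) by simp
        qed
        then show "0 = ?G z" using p' u1(2) by simp
      qed
      ultimately show ?thesis using op[OF A] by blast
    qed
  qed
qed

text \<open>Precomposition with \<open>P\<close> extends a function from a relatively open part of
  \<open>V\<close> to an open subset of the whole space, where Frechet derivatives make
  sense.\<close>

lemma subspace_linear_retraction:
  fixes V :: "'e::euclidean_space set"
  assumes "subspace V"
  obtains P where "linear P" and "\<And>x. P x \<in> V" and "\<And>x. x \<in> V \<Longrightarrow> P x = x"
proof -
  have "\<exists>g. g ` UNIV \<subseteq> V \<and> linear g \<and> (\<forall>v\<in>V. g (id v) = v)"
    using linear_exists_left_inverse_on[OF linear_id assms] by (auto simp: id_def)
  then show thesis using that by auto
qed

text \<open>Asking for the decomposition of functions on the product, with coefficients smooth in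
  both variables, is what yields smooth dependence on parameters and commuting derivatives. The
  vector 0 is not in \<open>Basis\<close> and serves as a spare index.\<close>

definition hadamard_coordinates ::
    "('a, 'e::euclidean_space) charted \<Rightarrow> 'a \<Rightarrow> ('e \<Rightarrow> 'a \<Rightarrow> real) \<Rightarrow> bool" where
  "hadamard_coordinates M e x \<longleftrightarrow>
     (\<forall>i. x i \<in> fns (manifold_space M) \<and> x i e = 0) \<and>
     (\<forall>F\<in>fns (manifold_space (prod_charted M M)).
        \<exists>H. (\<forall>i. H i \<in> fns (manifold_space (prod_charted M M))) \<and>
          (\<forall>p\<in>topspace (mtop M). \<forall>q\<in>topspace (mtop M).
            F (p, q) = F (e, q) + (\<Sum>i\<in>insert 0 Basis. x i p * H i (p, q))))"

text \<open>With a cut-off \<open>\<eta>\<close> that is 1 at \<open>e\<close>, the difference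
  \<open>F (p, q) - F (e, q)\<close> is the sum of its multiples by
  \<open>1 - \<eta>\<^sup>2\<close> and by \<open>\<eta>\<^sup>2\<close>. In the first,
  \<open>1 - \<eta>\<^sup>2\<close> is itself a coordinate vanishing at \<open>e\<close>, carried by
  the index 0. To the second Hadamard's formula in a chart applies; one factor \<open>\<eta>\<close>
  extends the chart coordinate by zero, the other the coefficient.\<close>

theorem ex_hadamard_coordinates:
  fixes M :: "('a, 'e::euclidean_space) charted"
  assumes M: "smooth_manifold M" and e: "e \<in> topspace (mtop M)"
  shows "\<exists>x. hadamard_coordinates M e x"
proof -
  note oc = open_charts_manifold[OF M]
  let ?S2 = "fns (manifold_space (prod_charted M M))"
  obtain U \<phi> where c: "(U, \<phi>) \<in> atlas M" and eU: "e \<in> U"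
    using manifold_cover[OF M e] by metis
  note u = open_chartsD[OF oc c]
  obtain V where V: "subspace V" "openin (top_of_set V) (\<phi> ` U)"
    using manifold_chart(3)[OF M c] by auto
  have VU: "\<phi> ` U \<subseteq> V" using openin_imp_subset[OF V(2)] .
  define x0 where "x0 = \<phi> e"
  have x0U: "x0 \<in> \<phi> ` U" using eU by (simp add: x0_def)
  obtain R where R: "0 < R" "ball x0 R \<inter> V \<subseteq> \<phi> ` U"
    using V(2) x0U unfolding openin_contains_ball by blast
  define r where "r = R / 2"
  have r: "0 < r" "r < R" using R(1) by (auto simp: r_def)
  obtain P where P: "linear P" "\<And>x. P x \<in> V" "\<And>x. x \<in> V \<Longrightarrow> P x = x"
    using subspace_linear_retraction[OF V(1)] by metis
  have contP: "continuous_on UNIV P"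
    using P(1) by (simp add: linear_continuous_on linear_conv_bounded_linear)
  \<comment> \<open>Open and convex in the whole space, although the chart image only fills a part
    of the subspace \<open>V\<close>.\<close>
  define C where "C = P -` ball x0 R"
  have C: "open C" "convex C"
    unfolding C_def using contP P(1) by (auto intro!: open_vimage convex_linear_vimage)
  have Px0: "P x0 = x0" using P(3) VU x0U by auto
  have x0C: "x0 \<in> C" using Px0 R(1) by (simp add: C_def)
  have VC: "y \<in> C" if "y \<in> ball x0 R \<inter> V" for y using that P(3) by (auto simp: C_def)
  have PC: "P y \<in> \<phi> ` U" if "y \<in> C" for y using that P(2) R(2) by (auto simp: C_def)
  define k where "k F q = (\<lambda>y. F (inv_into U \<phi> (P y), q))" for F :: "'a \<times> 'a \<Rightarrow> real" and q
  define h where "h F b y q = hadamard_coeff (k F q) x0 b y" for F b y q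
  let ?ext = "\<lambda>f p q. if p \<in> U then bump x0 r (\<phi> p) * f (\<phi> p) q else 0"
  have ext: "(\<lambda>(p, q). ?ext f p q) \<in> ?S2"
    if "\<And>U' \<psi>. (U', \<psi>) \<in> atlas M \<Longrightarrow>
      smooth_on ((ball x0 R \<inter> V) \<times> \<psi> ` U') (\<lambda>z. f (fst z) (inv_into U' \<psi> (snd z)))" for f :: "'e \<Rightarrow> 'a \<Rightarrow> real"
    by (rule fns_extend_by_zero[OF M oc c V(1) VU R(2) r]) (fact that)
  \<comment> \<open>Cut-offs in one variable come from those in two variables by freezing the second
    one at \<open>e\<close>.\<close>
  have ext1: "(\<lambda>p. ?ext (\<lambda>y q. g y) p e) \<in> fns (manifold_space M)"
    if "smooth_on UNIV g" for g :: "'e \<Rightarrow> real"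
  proof -
    have "smooth_on W (\<lambda>z. g (fst z))" for W :: "('e \<times> 'e) set"
      using smooth_on_compose[OF smooth_on_bounded_linear[OF bounded_linear_fst] that] by blast
    then show ?thesis
      using fns_slice_fst[OF M M e ext[of "\<lambda>y q. g y"]] by simp
  qed
  define \<eta> where "\<eta> p = ?ext (\<lambda>y q. 1) p e" for p
  have \<eta>: "\<eta> \<in> fns (manifold_space M)"
    unfolding \<eta>_def by (rule ext1) simp
  have \<eta>e: "\<eta> e = 1" using eU r by (simp add: \<eta>_def bump_center flip: x0_def)
  have \<eta>0: "\<eta> p = 0" if "\<not> (p \<in> U \<and> \<phi> p \<in> ball x0 R)" for p
    using that r bump_eq_0[of r x0 "\<phi> p"] by (auto simp: \<eta>_def)
  define xx where "xx i p = (if i = 0 then 1 + (- 1) * (\<eta> p * \<eta> p)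
      else ?ext (\<lambda>y q. (y - x0) \<bullet> i) p e)" for i :: 'e and p
  have xx_fns: "xx i \<in> fns (manifold_space M)" for i
  proof (cases "i = 0")
    case True
    have "(\<lambda>p. 1 + (- 1) * (\<eta> p * \<eta> p)) \<in> fns (manifold_space M)"
      by (intro fns_manifold_add fns_manifold_mult fns_manifold_const \<eta>)
    then show ?thesis using True by (simp add: xx_def[abs_def])
  next
    case False
    have "smooth_on UNIV (\<lambda>y. (y + - x0) \<bullet> i)"
      by (intro smooth_on_inner smooth_on_add smooth_on_const smooth_on_bounded_linear bounded_linear_ident)
    then have "smooth_on UNIV (\<lambda>y. (y - x0) \<bullet> i)" by simp
    from ext1[OF this] show ?thesis using False by (simp add: xx_def[abs_def])
  qed
  have xx_e: "xx i e = 0" for i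
    using \<eta>e by (simp add: xx_def x0_def)
  have H: "\<exists>H. (\<forall>i. H i \<in> ?S2) \<and> (\<forall>p\<in>topspace (mtop M). \<forall>q\<in>topspace (mtop M).
          F (p, q) = F (e, q) + (\<Sum>i\<in>insert 0 Basis. xx i p * H i (p, q)))"
    if F: "F \<in> ?S2" for F
  proof -
    define H where "H i = (if i = 0 then (\<lambda>z. F z + (- 1) * F (e, snd z))
        else (\<lambda>(p, q). ?ext (h F i) p q))" for i
    have Fe: "(\<lambda>q. F (e, q)) \<in> fns (manifold_space M)"
      by (rule fns_slice_snd[OF M M e F])
    have "H i \<in> ?S2" for i
    proof (cases "i = 0")
      case True
      have "(\<lambda>z. F z + (- 1) * F (e, snd z)) \<in> ?S2"
        by (intro fns_manifold_add fns_manifold_mult fns_manifold_const F fns_lift_snd[OF oc oc Fe])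
      then show ?thesis using True by (simp add: H_def)
    next
      case False
      have "(\<lambda>(p, q). ?ext (h F i) p q) \<in> ?S2"
      proof (rule ext)
        fix U' \<psi> assume c': "(U', \<psi>) \<in> atlas M"
        obtain V' where V': "subspace V'" "openin (top_of_set V') (\<psi> ` U')"
          using manifold_chart(3)[OF M c'] by auto
        obtain P' where P': "linear P'" "\<And>x. P' x \<in> V'" "\<And>x. x \<in> V' \<Longrightarrow> P' x = x"
          using subspace_linear_retraction[OF V'(1)] by metis
        obtain W' where W': "open W'" "\<psi> ` U' = V' \<inter> W'" using V'(2) openin_open by metis
        \<comment> \<open>The chart of the parameter is thickened in the same way by its own
          retraction, so that the coefficient is formed on the open set
          \<open>C \<times> W\<close>.\<close>
        define W where "W = P' -` W'"
        have contP': "continuous_on UNIV P'"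
          using P'(1) by (simp add: linear_continuous_on linear_conv_bounded_linear)
        have W: "open W" unfolding W_def by (rule open_vimage[OF W'(1) contP'])
        have PW: "P' z \<in> \<psi> ` U'" if "z \<in> W" for z using that P'(2) W'(2) by (auto simp: W_def)
        have UW: "z \<in> W \<and> P' z = z" if "z \<in> \<psi> ` U'" for z
          using that P'(3) W'(2) by (auto simp: W_def)
        let ?f = "\<lambda>z. F (inv_into U \<phi> (P (fst z)), inv_into U' \<psi> (P' (snd z)))"
        have s1: "smooth_on (C \<times> W) (\<lambda>z. (P (fst z), P' (snd z)))"
          using P(1) P'(1) unfolding linear_conv_bounded_linear
          by (intro smooth_on_Pair smooth_on_bounded_linear
              bounded_linear_compose[OF _ bounded_linear_fst] bounded_linear_compose[OF _ bounded_linear_snd])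
        have s2: "smooth_on (\<phi> ` U \<times> \<psi> ` U') (\<lambda>z. F (inv_into U \<phi> (fst z), inv_into U' \<psi> (snd z)))"
          using F c c' by (simp add: fns_prod_iff[OF oc oc])
        have "(\<lambda>z. (P (fst z), P' (snd z))) ` (C \<times> W) \<subseteq> \<phi> ` U \<times> \<psi> ` U'"
          using PC PW by (auto simp del: image_eqI)
        from smooth_on_compose[OF s1 s2 this] have "smooth_on (C \<times> W) ?f" by simp
        then have Cf: "Ck_on n ?f (C \<times> W)" for n
          using smooth_on_open_iff[OF open_Times[OF C(1) W]] by blast
        have "smooth_on (C \<times> W) (\<lambda>p. hadamard_coeff (\<lambda>y. ?f (y, snd p)) x0 i (fst p))"
          by (rule smooth_onI_open[OF open_Times[OF C(1) W] Ck_on_hadamard_coeff[OF C x0C W Cf]])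
        then show "smooth_on ((ball x0 R \<inter> V) \<times> \<psi> ` U') (\<lambda>z. h F i (fst z) (inv_into U' \<psi> (snd z)))"
          by (rule smooth_on_cong_subset) (use VC UW in \<open>auto simp: h_def k_def\<close>)
      qed
      then show ?thesis using False by (simp add: H_def)
    qed
    moreover have "F (p, q) = F (e, q) + (\<Sum>i\<in>insert 0 Basis. xx i p * H i (p, q))"
      if "p \<in> topspace (mtop M)" "q \<in> topspace (mtop M)" for p q
    proof -
      have "(\<Sum>i\<in>insert 0 Basis. xx i p * H i (p, q))
          = xx 0 p * H 0 (p, q) + (\<Sum>i\<in>Basis. xx i p * H i (p, q))"
        by (rule sum.insert) auto
      also have "xx 0 p * H 0 (p, q) = (1 - \<eta> p * \<eta> p) * (F (p, q) - F (e, q))"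
        by (simp add: xx_def H_def)
      also have "(\<Sum>i\<in>Basis. xx i p * H i (p, q)) = \<eta> p * \<eta> p * (F (p, q) - F (e, q))"
      proof (cases "p \<in> U \<and> \<phi> p \<in> ball x0 R")
        case True
        have pC: "\<phi> p \<in> C" and PP: "P (\<phi> p) = \<phi> p" using True VC VU P(3) by auto
        have "k F q (\<phi> p) - k F q x0 = (\<Sum>b\<in>Basis. ((\<phi> p - x0) \<bullet> b) * h F b (\<phi> p) q)"
          unfolding h_def
        proof (rule hadamard_formula[OF C x0C pC])
          have q: "q \<in> topspace (mtop M)" by fact
          have s1: "smooth_on C P"
            using P(1) by (intro smooth_on_bounded_linear) (simp add: linear_conv_bounded_linear)
          have "(\<lambda>p. F (p, q)) \<in> fns (manifold_space M)"
            by (rule fns_slice_fst[OF M M q F])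
          then have s2: "smooth_on (\<phi> ` U) (\<lambda>y. F (inv_into U \<phi> y, q))"
            using c by (simp add: fns_manifold_iff)
          have "smooth_on C (k F q)"
            unfolding k_def by (rule smooth_on_compose[OF s1 s2]) (use PC in blast)
          then show "Ck_on 1 (k F q) C" using smooth_on_open_iff[OF C(1)] by blast
        qed
        moreover have "k F q (\<phi> p) = F (p, q)" "k F q x0 = F (e, q)"
          using True PP Px0 u(2) eU by (simp_all add: k_def x0_def)
        moreover have "xx i p * H i (p, q) = \<eta> p * \<eta> p * (((\<phi> p - x0) \<bullet> i) * h F i (\<phi> p) q)"
          if "i \<in> Basis" for i
        proof -
          have "i \<noteq> 0" using that by auto
          then show ?thesis using True by (simp add: xx_def H_def \<eta>_def)
        qed
        ultimately show ?thesis by (simp add: sum_distrib_left)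
      next
        case False
        \<comment> \<open>Off the ball the cut-off and all chart coordinates vanish, and the spare
          index 0 alone carries the difference.\<close>
        then have "xx i p = 0" if "i \<in> Basis" for i
          using that \<eta>0[OF False] nonzero_Basis[OF that] by (simp add: xx_def \<eta>_def split: if_splits)
        then show ?thesis using \<eta>0[OF False] by simp
      qed
      finally show ?thesis by (simp add: algebra_simps)
    qed
    ultimately show ?thesis by blast
  qed
  have "hadamard_coordinates M e xx"
    unfolding hadamard_coordinates_def by (intro conjI allI ballI xx_fns xx_e H)
  then show ?thesis by blast
qed

section \<open>Derivations of algebras of functions\<close>

text \<open>The group, the coset space and the orbit are all instances, so that derivations can be
  treated once, without charts.\<close>

locale smooth_algebra =
  fixes N :: "'a smooth_space"
  assumes fns_const [simp]: "(\<lambda>x. c) \<in> fns N"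
    and fns_add: "f \<in> fns N \<Longrightarrow> h \<in> fns N \<Longrightarrow> (\<lambda>x. f x + h x) \<in> fns N"
    and fns_mult: "f \<in> fns N \<Longrightarrow> h \<in> fns N \<Longrightarrow> (\<lambda>x. f x * h x) \<in> fns N"
    and fns_cong: "f \<in> fns N \<Longrightarrow> (\<And>x. x \<in> pts N \<Longrightarrow> f x = h x) \<Longrightarrow> h \<in> fns N"
begin

lemma fns_cmult: "f \<in> fns N \<Longrightarrow> (\<lambda>x. c * f x) \<in> fns N"
  by (rule fns_mult) simp_all

lemma fns_minus: "f \<in> fns N \<Longrightarrow> (\<lambda>x. - f x) \<in> fns N"
  using fns_cmult[of f "- 1"] by simp

lemma fns_diff: "f \<in> fns N \<Longrightarrow> h \<in> fns N \<Longrightarrow> (\<lambda>x. f x - h x) \<in> fns N"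
  using fns_add[OF _ fns_minus, of f h] by simp

lemma fns_sum: "(\<And>i. i \<in> I \<Longrightarrow> f i \<in> fns N) \<Longrightarrow> (\<lambda>x. \<Sum>i\<in>I. f i x) \<in> fns N"
  by (induction I rule: infinite_finite_induct) (auto intro: fns_add)

context
  fixes p v
  assumes v: "v \<in> tangent_space N p"
begin

lemma tangent_lin: "f \<in> fns N \<Longrightarrow> h \<in> fns N \<Longrightarrow> v (\<lambda>x. a * f x + b * h x) = a * v f + b * v h"
  using v by (simp add: tangent_space_def)

lemma tangent_mult: "f \<in> fns N \<Longrightarrow> h \<in> fns N \<Longrightarrow> v (\<lambda>x. f x * h x) = f p * v h + h p * v f"
  using v by (simp add: tangent_space_def)

lemma tangent_outside: "f \<notin> fns N \<Longrightarrow> v f = 0"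
  using v by (simp add: tangent_space_def)

lemma tangent_add: "f \<in> fns N \<Longrightarrow> h \<in> fns N \<Longrightarrow> v (\<lambda>x. f x + h x) = v f + v h"
  using tangent_lin[of f h 1 1] by simp

lemma tangent_diff: "f \<in> fns N \<Longrightarrow> h \<in> fns N \<Longrightarrow> v (\<lambda>x. f x - h x) = v f - v h"
  using tangent_lin[of f h 1 "- 1"] by simp

lemma tangent_cmult: "f \<in> fns N \<Longrightarrow> v (\<lambda>x. c * f x) = c * v f"
  using tangent_lin[of f f c 0] by simp

lemma tangent_const [simp]: "v (\<lambda>x. c) = 0"
proof -
  have "v (\<lambda>x. 1) = 0"
    using tangent_mult[of "\<lambda>x. 1" "\<lambda>x. 1"] by simp
  then show ?thesis
    using tangent_cmult[of "\<lambda>x. 1" c] by simp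
qed

lemma tangent_sum: "(\<And>i. i \<in> I \<Longrightarrow> f i \<in> fns N) \<Longrightarrow> v (\<lambda>x. \<Sum>i\<in>I. f i x) = (\<Sum>i\<in>I. v (f i))"
proof (induction I rule: infinite_finite_induct)
  case (insert i I)
  then have "v (\<lambda>x. f i x + (\<Sum>i\<in>I. f i x)) = v (f i) + (\<Sum>i\<in>I. v (f i))"
    by (subst tangent_add) (auto intro: fns_sum)
  with insert(1,2) show ?case by simp
qed auto

lemma tangent_cong:
  assumes p: "p \<in> pts N" and f: "f \<in> fns N" and eq: "\<And>x. x \<in> pts N \<Longrightarrow> f x = h x"
  shows "v f = v h"
proof -
  have h: "h \<in> fns N" by (rule fns_cong[OF f eq])
  \<comment> \<open>This function vanishes on \<open>pts N\<close>, hence it is smooth, and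
    multiplying \<open>f - h\<close> by it changes nothing; Leibniz at \<open>p\<close> then gives
    0.\<close>
  let ?i = "\<lambda>x. if x \<in> pts N then 0 else (1::real)"
  have i: "?i \<in> fns N" by (rule fns_cong[of "\<lambda>x. 0"]) auto
  have d: "(\<lambda>x. f x - h x) \<in> fns N" by (rule fns_diff[OF f h])
  have "v f - v h = v (\<lambda>x. f x - h x)" by (rule tangent_diff[OF f h, symmetric])
  also have "(\<lambda>x. f x - h x) = (\<lambda>x. (f x - h x) * ?i x)" using eq by auto
  also have "v \<dots> = 0"
    by (subst tangent_mult[OF d i]) (use p eq in simp)
  finally show ?thesis by simp
qed

end

lemma tangent_eqI:
  assumes "u \<in> tangent_space N p" and "v \<in> tangent_space N p" and "\<And>f. f \<in> fns N \<Longrightarrow> u f = v f"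
  shows "u = v"
proof
  show "u f = v f" for f
    using assms tangent_outside[OF assms(1)] tangent_outside[OF assms(2)] by (cases "f \<in> fns N") auto
qed

lemma tangent_comb:
  assumes "u \<in> tangent_space N p" and "v \<in> tangent_space N p"
  shows "(\<lambda>f. a * u f + b * v f) \<in> tangent_space N p"
  using assms unfolding tangent_space_def by (auto simp: algebra_simps)

lemma tangent_zero: "(\<lambda>f. 0) \<in> tangent_space N p"
  by (simp add: tangent_space_def)

lemma tangent_minus:
  "u \<in> tangent_space N p \<Longrightarrow> v \<in> tangent_space N p \<Longrightarrow> (\<lambda>f. u f - v f) \<in> tangent_space N p"
  using tangent_comb[of u p v 1 "- 1"] by simp

lemma tangent_sumI:
  fixes c :: "'i \<Rightarrow> real"
  shows "(\<And>i. i \<in> I \<Longrightarrow> u i \<in> tangent_space N p) \<Longrightarrow> (\<lambda>f. \<Sum>i\<in>I. c i * u i f) \<in> tangent_space N p"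
proof (induction I rule: infinite_finite_induct)
  case (insert i I)
  then show ?case
    using tangent_comb[of "u i" p "\<lambda>f. \<Sum>i\<in>I. c i * u i f" "c i" 1] by simp
qed (auto simp: tangent_zero)

lemma vector_fieldsD:
  assumes "X \<in> vector_fields N"
  shows "p \<in> pts N \<Longrightarrow> X p \<in> tangent_space N p" and "f \<in> fns N \<Longrightarrow> (\<lambda>p. X p f) \<in> fns N"
  using assms by (auto simp: vector_fields_def)

text \<open>On a product \<open>f h\<close>, the mixed part \<open>X f * Y h + X h * Y f\<close> of
  the second derivative is symmetric in \<open>X\<close> and \<open>Y\<close>, so it drops out of
  the commutator and the Leibniz rule remains.\<close>

lemma vf_bracket_field:
  assumes X: "X \<in> vector_fields N" and Y: "Y \<in> vector_fields N"
  shows "vf_bracket N X Y \<in> vector_fields N"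
proof -
  note XD = vector_fieldsD[OF X] and YD = vector_fieldsD[OF Y]
  have t: "vf_bracket N X Y p \<in> tangent_space N p" if p: "p \<in> pts N" for p
    unfolding tangent_space_def
  proof (intro CollectI conjI ballI allI impI)
    fix f h a b assume f: "f \<in> fns N" and h: "h \<in> fns N"
    have "X p (\<lambda>q. Y q (\<lambda>x. a * f x + b * h x)) = a * X p (\<lambda>q. Y q f) + b * X p (\<lambda>q. Y q h)"
      if X: "X \<in> vector_fields N" and Y: "Y \<in> vector_fields N" for X Y
    proof -
      have "X p (\<lambda>q. Y q (\<lambda>x. a * f x + b * h x)) = X p (\<lambda>q. a * Y q f + b * Y q h)"
        by (rule tangent_cong[OF vector_fieldsD(1)[OF X p] p])
          (auto intro!: vector_fieldsD[OF Y] fns_add fns_cmult f h tangent_lin[OF vector_fieldsD(1)[OF Y]])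
      also have "\<dots> = a * X p (\<lambda>q. Y q f) + b * X p (\<lambda>q. Y q h)"
        by (intro tangent_lin[OF vector_fieldsD(1)[OF X p]] vector_fieldsD(2)[OF Y] f h)
      finally show ?thesis .
    qed
    from this[OF X Y] this[OF Y X]
    show "vf_bracket N X Y p (\<lambda>x. a * f x + b * h x) = a * vf_bracket N X Y p f + b * vf_bracket N X Y p h"
      by (simp add: vf_bracket_def fns_add fns_cmult f h algebra_simps)
  next
    fix f h assume f: "f \<in> fns N" and h: "h \<in> fns N"
    have "X p (\<lambda>q. Y q (\<lambda>x. f x * h x))
        = f p * X p (\<lambda>q. Y q h) + X p f * Y p h + h p * X p (\<lambda>q. Y q f) + X p h * Y p f"
      if X: "X \<in> vector_fields N" and Y: "Y \<in> vector_fields N" for X Y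
    proof -
      note XD = vector_fieldsD[OF X] and YD = vector_fieldsD[OF Y]
      have "X p (\<lambda>q. Y q (\<lambda>x. f x * h x)) = X p (\<lambda>q. f q * Y q h + h q * Y q f)"
        by (rule tangent_cong[OF XD(1)[OF p] p])
          (auto intro!: YD fns_add fns_mult f h tangent_mult[OF YD(1)])
      also have "\<dots> = X p (\<lambda>q. f q * Y q h) + X p (\<lambda>q. h q * Y q f)"
        by (intro tangent_add[OF XD(1)[OF p]] fns_mult f h YD(2))
      also have "\<dots> = f p * X p (\<lambda>q. Y q h) + X p f * Y p h + h p * X p (\<lambda>q. Y q f) + X p h * Y p f"
        using tangent_mult[OF XD(1)[OF p] f YD(2)[OF h]] tangent_mult[OF XD(1)[OF p] h YD(2)[OF f]]
        by simp
      finally show ?thesis .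
    qed
    from this[OF X Y] this[OF Y X]
    show "vf_bracket N X Y p (\<lambda>x. f x * h x) = f p * vf_bracket N X Y p h + h p * vf_bracket N X Y p f"
      by (simp add: vf_bracket_def fns_mult f h algebra_simps)
  qed (simp add: vf_bracket_def)
  have "(\<lambda>p. vf_bracket N X Y p f) \<in> fns N" if "f \<in> fns N" for f
    using that by (simp add: vf_bracket_def fns_diff XD YD)
  with t show ?thesis by (simp add: vector_fields_def)
qed

context
  fixes g p
  assumes g: "riemannian_metric N g" and p: "p \<in> pts N"
begin

lemma metric_lin:
  assumes "u \<in> tangent_space N p" "v \<in> tangent_space N p" "w \<in> tangent_space N p"
  shows "g p (\<lambda>f. a * u f + b * v f) w = a * g p u w + b * g p v w"
  using g p assms unfolding riemannian_metric_def by blast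

lemma metric_sym:
  assumes "u \<in> tangent_space N p" "v \<in> tangent_space N p"
  shows "g p u v = g p v u"
  using g p assms unfolding riemannian_metric_def by blast

lemma metric_pos: "u \<in> tangent_space N p \<Longrightarrow> u \<noteq> (\<lambda>f. 0) \<Longrightarrow> g p u u > 0"
  using g p unfolding riemannian_metric_def by blast

lemma metric_zero: "w \<in> tangent_space N p \<Longrightarrow> g p (\<lambda>f. 0) w = 0"
  using metric_lin[OF tangent_zero tangent_zero, of w 0 0] by simp

lemma metric_diff:
  assumes "u \<in> tangent_space N p" "v \<in> tangent_space N p" "w \<in> tangent_space N p"
  shows "g p (\<lambda>f. u f - v f) w = g p u w - g p v w"
  using metric_lin[OF assms, of 1 "- 1"] by simp

lemma metric_sum_left:
  fixes c :: "'i \<Rightarrow> real"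
  assumes w: "w \<in> tangent_space N p"
  shows "(\<And>i. i \<in> I \<Longrightarrow> u i \<in> tangent_space N p) \<Longrightarrow>
    g p (\<lambda>f. \<Sum>i\<in>I. c i * u i f) w = (\<Sum>i\<in>I. c i * g p (u i) w)"
proof (induction I rule: infinite_finite_induct)
  case (insert i I)
  have "(\<lambda>f. \<Sum>i\<in>I. c i * u i f) \<in> tangent_space N p"
    using insert.prems by (intro tangent_sumI) auto
  from metric_lin[OF _ this w, where u = "u i" and a = "c i" and b = 1] insert show ?case by simp
qed (auto simp: metric_zero w)

lemma metric_sum_right:
  fixes c :: "'i \<Rightarrow> real"
  assumes w: "w \<in> tangent_space N p" and u: "\<And>i. i \<in> I \<Longrightarrow> u i \<in> tangent_space N p"
  shows "g p w (\<lambda>f. \<Sum>i\<in>I. c i * u i f) = (\<Sum>i\<in>I. c i * g p w (u i))"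
proof -
  have "g p w (\<lambda>f. \<Sum>i\<in>I. c i * u i f) = g p (\<lambda>f. \<Sum>i\<in>I. c i * u i f) w"
    by (intro metric_sym w tangent_sumI u)
  also have "\<dots> = (\<Sum>i\<in>I. c i * g p (u i) w)"
    by (intro metric_sum_left w u)
  also have "\<dots> = (\<Sum>i\<in>I. c i * g p w (u i))"
    by (intro sum.cong refl arg_cong[where f = "\<lambda>x. c _ * x"] metric_sym u w)
  finally show ?thesis .
qed

end

lemma metric_field:
  "riemannian_metric N g \<Longrightarrow> X \<in> vector_fields N \<Longrightarrow> Y \<in> vector_fields N \<Longrightarrow> (\<lambda>p. g p (X p) (Y p)) \<in> fns N"
  unfolding riemannian_metric_def by blast

end

lemma differential_in_tangent_space:
  assumes "smooth_algebra N'" and F: "smooth_space_map N N' F" and v: "v \<in> tangent_space N p"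
  shows "differential N' F v \<in> tangent_space N' (F p)"
proof -
  interpret smooth_algebra N' by fact
  have "(\<lambda>x. f (F x)) \<in> fns N" if "f \<in> fns N'" for f
    using F that by (simp add: smooth_space_map_def o_def)
  then show ?thesis
    using v by (simp add: tangent_space_def differential_def o_def fns_add fns_mult fns_cmult)
qed

lemma smooth_algebra_manifold:
  assumes "smooth_manifold M"
  shows "smooth_algebra (manifold_space M)"
proof
  fix f h assume "f \<in> fns (manifold_space M)" "\<And>x. x \<in> pts (manifold_space M) \<Longrightarrow> f x = h x"
  then show "h \<in> fns (manifold_space M)"
    using fns_manifold_cong[OF open_charts_manifold[OF assms], of f h] by (simp add: manifold_space_def)
qed (rule fns_manifold_const fns_manifold_add fns_manifold_mult; assumption)+

section \<open>Partial derivations on products\<close>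

context
  fixes M :: "('a, 'e::euclidean_space) charted"
  assumes M: "smooth_manifold M"
begin

interpretation smooth_algebra "manifold_space M"
  by (rule smooth_algebra_manifold[OF M])

lemma pts_manifold: "pts (manifold_space M) = topspace (mtop M)"
  by (simp add: manifold_space_def)

text \<open>All \<open>x i\<close> vanish at \<open>p\<close>, so by Leibniz a derivation at
  \<open>p\<close> sees the coefficients only through their values there. One family
  \<open>H\<close> serves every \<open>v\<close> and every \<open>q\<close>.\<close>

lemma hadamard_expansion:
  assumes p: "p \<in> topspace (mtop M)" and x: "hadamard_coordinates M p x"
    and F: "F \<in> fns (manifold_space (prod_charted M M))"
  shows "\<exists>H. (\<forall>i. H i \<in> fns (manifold_space (prod_charted M M))) \<and>
    (\<forall>r\<in>topspace (mtop M). \<forall>q\<in>topspace (mtop M).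
      F (r, q) = F (p, q) + (\<Sum>i\<in>insert 0 Basis. x i r * H i (r, q))) \<and>
    (\<forall>v\<in>tangent_space (manifold_space M) p. \<forall>q\<in>topspace (mtop M).
      v (\<lambda>r. F (r, q)) = (\<Sum>i\<in>insert 0 Basis. v (x i) * H i (p, q)))"
proof -
  have xf: "x i \<in> fns (manifold_space M)" "x i p = 0" for i
    using x by (simp_all add: hadamard_coordinates_def)
  have "\<exists>H. (\<forall>i. H i \<in> fns (manifold_space (prod_charted M M))) \<and>
      (\<forall>r\<in>topspace (mtop M). \<forall>q\<in>topspace (mtop M).
        F (r, q) = F (p, q) + (\<Sum>i\<in>insert 0 Basis. x i r * H i (r, q)))"
    using x F by (simp add: hadamard_coordinates_def)
  then obtain H where H1: "\<forall>i. H i \<in> fns (manifold_space (prod_charted M M))"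
    and H2: "\<forall>r\<in>topspace (mtop M). \<forall>q\<in>topspace (mtop M).
        F (r, q) = F (p, q) + (\<Sum>i\<in>insert 0 Basis. x i r * H i (r, q))"
    by (elim exE conjE)
  have "v (\<lambda>r. F (r, q)) = (\<Sum>i\<in>insert 0 Basis. v (x i) * H i (p, q))"
    if v: "v \<in> tangent_space (manifold_space M) p" and q: "q \<in> topspace (mtop M)" for v q
  proof -
    have Hq: "(\<lambda>r. H i (r, q)) \<in> fns (manifold_space M)" for i
      by (rule fns_slice_fst[OF M M q H1[rule_format]])
    have "v (\<lambda>r. F (r, q)) = v (\<lambda>r. F (p, q) + (\<Sum>i\<in>insert 0 Basis. x i r * H i (r, q)))"
      by (rule tangent_cong[OF v _ fns_slice_fst[OF M M q F]], unfold pts_manifold)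
        (rule p, rule bspec[OF bspec[OF H2] q])
    also have "\<dots> = v (\<lambda>r. F (p, q)) + v (\<lambda>r. \<Sum>i\<in>insert 0 Basis. x i r * H i (r, q))"
      by (intro tangent_add[OF v] fns_const fns_sum fns_mult xf Hq)
    also have "\<dots> = (\<Sum>i\<in>insert 0 Basis. v (\<lambda>r. x i r * H i (r, q)))"
      by (subst tangent_sum[OF v fns_mult[OF xf(1) Hq]]) (simp only: tangent_const[OF v] add_0)
    also have "\<dots> = (\<Sum>i\<in>insert 0 Basis. v (x i) * H i (p, q))"
      by (intro sum.cong refl, subst tangent_mult[OF v xf(1) Hq]) (simp add: xf)
    finally show ?thesis .
  qed
  then show ?thesis
    by (intro exI[of _ H] conjI ballI H1 H2[rule_format]) simp_all
qed

text \<open>By Hadamard's formula a derivation is determined by its values on finitely many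
  coordinates; this is the source of finite dimensionality.\<close>

lemma tangent_space_coordinates:
  assumes p: "p \<in> topspace (mtop M)"
  shows "\<exists>x :: 'e \<Rightarrow> 'a \<Rightarrow> real. (\<forall>i. x i \<in> fns (manifold_space M)) \<and>
    (\<forall>v\<in>tangent_space (manifold_space M) p. (\<forall>i\<in>insert 0 Basis. v (x i) = 0) \<longrightarrow> v = (\<lambda>f. 0))"
proof -
  obtain x where x: "hadamard_coordinates M p x"
    using ex_hadamard_coordinates[OF M p] by blast
  note oc = open_charts_manifold[OF M]
  show ?thesis
  proof (intro exI[of _ x] conjI allI ballI impI)
    show "x i \<in> fns (manifold_space M)" for i
      using x by (simp add: hadamard_coordinates_def)
    fix v assume v: "v \<in> tangent_space (manifold_space M) p" and 0: "\<forall>i\<in>insert 0 Basis. v (x i) = 0"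
    show "v = (\<lambda>f. 0)"
    proof (rule tangent_eqI[OF v tangent_zero])
      fix f assume f: "f \<in> fns (manifold_space M)"
      obtain H where "\<forall>v\<in>tangent_space (manifold_space M) p. \<forall>q\<in>topspace (mtop M).
          v (\<lambda>r. f (fst (r, q))) = (\<Sum>i\<in>insert 0 Basis. v (x i) * H i (p, q))"
        using hadamard_expansion[OF p x fns_lift_fst[OF oc oc f]] by (elim exE conjE)
      from bspec[OF bspec[OF this v] p] show "v f = 0"
        using 0 by simp
    qed
  qed
qed

text \<open>The derivative is a combination of the slices \<open>H i (p, q)\<close> with the
  constant weights \<open>v (x i)\<close>.\<close>

lemma partial_derivation_smooth:
  assumes p: "p \<in> topspace (mtop M)" and v: "v \<in> tangent_space (manifold_space M) p"
    and F: "F \<in> fns (manifold_space (prod_charted M M))"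
  shows "(\<lambda>q. v (\<lambda>r. F (r, q))) \<in> fns (manifold_space M)"
proof -
  obtain x where x: "hadamard_coordinates M p x"
    using ex_hadamard_coordinates[OF M p] by blast
  obtain H where H1: "\<forall>i. H i \<in> fns (manifold_space (prod_charted M M))"
    and H2: "\<forall>v\<in>tangent_space (manifold_space M) p. \<forall>q\<in>topspace (mtop M).
        v (\<lambda>r. F (r, q)) = (\<Sum>i\<in>insert 0 Basis. v (x i) * H i (p, q))"
    using hadamard_expansion[OF p x F] by (elim exE conjE)
  have "(\<lambda>q. \<Sum>i\<in>insert 0 Basis. v (x i) * H i (p, q)) \<in> fns (manifold_space M)"
    by (intro fns_sum fns_cmult fns_slice_snd[OF M M p H1[rule_format]])
  then show ?thesis
    by (rule fns_cong) (use H2 v in \<open>simp add: pts_manifold\<close>)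
qed

lemma partial_derivation_smooth':
  assumes p: "p \<in> topspace (mtop M)" and v: "v \<in> tangent_space (manifold_space M) p"
    and F: "F \<in> fns (manifold_space (prod_charted M M))"
  shows "(\<lambda>q. v (\<lambda>r. F (q, r))) \<in> fns (manifold_space M)"
  using partial_derivation_smooth[OF p v fns_swap[OF open_charts_manifold[OF M] open_charts_manifold[OF M] F]]
  by simp

text \<open>Hadamard coefficients turn the derivation \<open>u\<close> into a finite sum of
  evaluations at \<open>p\<close>: both orders reduce to the sum of
  \<open>u (x i) * v (\<lambda>s. H i (p, s))\<close>.\<close>

lemma partial_derivations_commute:
  assumes p: "p \<in> topspace (mtop M)" and q: "q \<in> topspace (mtop M)"
    and u: "u \<in> tangent_space (manifold_space M) p" and v: "v \<in> tangent_space (manifold_space M) q"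
    and F: "F \<in> fns (manifold_space (prod_charted M M))"
  shows "u (\<lambda>r. v (\<lambda>s. F (r, s))) = v (\<lambda>s. u (\<lambda>r. F (r, s)))"
proof -
  obtain x where hx: "hadamard_coordinates M p x"
    using ex_hadamard_coordinates[OF M p] by blast
  have x: "x i \<in> fns (manifold_space M)" "x i p = 0" for i
    using hx by (simp_all add: hadamard_coordinates_def)
  obtain H where H1: "\<forall>i. H i \<in> fns (manifold_space (prod_charted M M))"
    and H2: "\<forall>r\<in>topspace (mtop M). \<forall>q\<in>topspace (mtop M).
        F (r, q) = F (p, q) + (\<Sum>i\<in>insert 0 Basis. x i r * H i (r, q))"
    and "\<forall>v\<in>tangent_space (manifold_space M) p. \<forall>q\<in>topspace (mtop M).
        v (\<lambda>r. F (r, q)) = (\<Sum>i\<in>insert 0 Basis. v (x i) * H i (p, q))"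
    using hadamard_expansion[OF p hx F] by (elim exE conjE)
  note H3 = bspec[OF this(3) u]
  have Hs: "(\<lambda>s. H i (r, s)) \<in> fns (manifold_space M)" if "r \<in> topspace (mtop M)" for i r
    by (rule fns_slice_snd[OF M M that H1[rule_format]])
  have vH: "(\<lambda>r. v (\<lambda>s. H i (r, s))) \<in> fns (manifold_space M)" for i
    by (rule partial_derivation_smooth'[OF q v H1[rule_format]])
  have "v (\<lambda>s. u (\<lambda>r. F (r, s))) = v (\<lambda>s. \<Sum>i\<in>insert 0 Basis. u (x i) * H i (p, s))"
    by (rule tangent_cong[OF v _ partial_derivation_smooth[OF p u F]]) (use q H3 in \<open>simp_all add: pts_manifold\<close>)
  also have "\<dots> = (\<Sum>i\<in>insert 0 Basis. u (x i) * v (\<lambda>s. H i (p, s)))"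
    by (subst tangent_sum[OF v fns_cmult[OF Hs[OF p]]]) (simp only: tangent_cmult[OF v Hs[OF p]])
  finally have R: "v (\<lambda>s. u (\<lambda>r. F (r, s))) = (\<Sum>i\<in>insert 0 Basis. u (x i) * v (\<lambda>s. H i (p, s)))" .
  have vF: "v (\<lambda>s. F (r, s)) = v (\<lambda>s. F (p, s)) + (\<Sum>i\<in>insert 0 Basis. x i r * v (\<lambda>s. H i (r, s)))"
    if r: "r \<in> topspace (mtop M)" for r
  proof -
    have "v (\<lambda>s. F (r, s)) = v (\<lambda>s. F (p, s) + (\<Sum>i\<in>insert 0 Basis. x i r * H i (r, s)))"
      by (rule tangent_cong[OF v _ fns_slice_snd[OF M M r F]], unfold pts_manifold)
        (rule q, rule bspec[OF bspec[OF H2 r]])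
    also have "\<dots> = v (\<lambda>s. F (p, s)) + v (\<lambda>s. \<Sum>i\<in>insert 0 Basis. x i r * H i (r, s))"
      by (intro tangent_add[OF v] fns_slice_snd[OF M M p F] fns_sum fns_cmult Hs r)
    also have "v (\<lambda>s. \<Sum>i\<in>insert 0 Basis. x i r * H i (r, s)) = (\<Sum>i\<in>insert 0 Basis. x i r * v (\<lambda>s. H i (r, s)))"
      by (subst tangent_sum[OF v fns_cmult[OF Hs[OF r]]]) (simp only: tangent_cmult[OF v Hs[OF r]])
    finally show ?thesis .
  qed
  have "u (\<lambda>r. v (\<lambda>s. F (r, s)))
      = u (\<lambda>r. v (\<lambda>s. F (p, s)) + (\<Sum>i\<in>insert 0 Basis. x i r * v (\<lambda>s. H i (r, s))))"
    by (rule tangent_cong[OF u _ partial_derivation_smooth'[OF q v F]], unfold pts_manifold)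
      (rule p, rule vF)
  also have "\<dots> = u (\<lambda>r. v (\<lambda>s. F (p, s))) + u (\<lambda>r. \<Sum>i\<in>insert 0 Basis. x i r * v (\<lambda>s. H i (r, s)))"
    by (intro tangent_add[OF u] fns_const fns_sum fns_mult x vH)
  also have "\<dots> = (\<Sum>i\<in>insert 0 Basis. u (\<lambda>r. x i r * v (\<lambda>s. H i (r, s))))"
    by (subst tangent_sum[OF u fns_mult[OF x(1) vH]]) (simp only: tangent_const[OF u] add_0)
  also have "\<dots> = (\<Sum>i\<in>insert 0 Basis. u (x i) * v (\<lambda>s. H i (p, s)))"
    by (intro sum.cong refl, subst tangent_mult[OF u x(1) vH]) (simp add: x)
  finally show ?thesis using R by simp
qed

end

section \<open>Orthonormal bases of spaces of derivations\<close>

text \<open>Gaussian elimination: equation \<open>j\<close> is solved for an unknown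
  \<open>b\<close> that occurs in it, and the other unknowns come from the reduced system.\<close>

lemma homogeneous_system:
  fixes \<phi> :: "'a \<Rightarrow> 'i \<Rightarrow> real"
  assumes "finite I" and "finite A" and "card I < card A"
  shows "\<exists>c. (\<exists>a\<in>A. c a \<noteq> 0) \<and> (\<forall>i\<in>I. (\<Sum>a\<in>A. c a * \<phi> a i) = 0)"
  using assms
proof (induction I arbitrary: A \<phi> rule: finite_induct)
  case empty
  then have "A \<noteq> {}" by auto
  then show ?case by (intro exI[of _ "\<lambda>a. 1"]) auto
next
  case (insert j I)
  show ?case
  proof (cases "\<forall>a\<in>A. \<phi> a j = 0")
    case True
    have "card I < card A" using insert.prems insert.hyps by simp
    from insert.IH[OF insert.prems(1) this, of \<phi>] True show ?thesis by auto
  next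
    case False
    then obtain b where b: "b \<in> A" "\<phi> b j \<noteq> 0" by auto
    have "card I < card (A - {b})" using insert.prems insert.hyps b by simp
    from insert.IH[OF finite_Diff[OF insert.prems(1)] this,
        of "\<lambda>a i. \<phi> a i - \<phi> a j / \<phi> b j * \<phi> b i"]
    obtain c where c: "\<exists>a\<in>A - {b}. c a \<noteq> 0"
      and c0: "\<forall>i\<in>I. (\<Sum>a\<in>A - {b}. c a * (\<phi> a i - \<phi> a j / \<phi> b j * \<phi> b i)) = 0"
      by (elim exE conjE)
    define s where "s = (\<Sum>a\<in>A - {b}. c a * \<phi> a j)"
    \<comment> \<open>The value at \<open>b\<close> is the one forced by equation
      \<open>j\<close>.\<close>
    define c' where "c' = c(b := - s / \<phi> b j)"
    have sum: "(\<Sum>a\<in>A. c' a * \<phi> a i) = (\<Sum>a\<in>A - {b}. c a * \<phi> a i) - s / \<phi> b j * \<phi> b i" for i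
    proof -
      have "(\<Sum>a\<in>A. c' a * \<phi> a i) = c' b * \<phi> b i + (\<Sum>a\<in>A - {b}. c' a * \<phi> a i)"
        by (rule sum.remove[OF insert.prems(1) b(1)])
      also have "(\<Sum>a\<in>A - {b}. c' a * \<phi> a i) = (\<Sum>a\<in>A - {b}. c a * \<phi> a i)"
        by (rule sum.cong) (auto simp: c'_def)
      finally show ?thesis by (simp add: c'_def)
    qed
    have "(\<Sum>a\<in>A. c' a * \<phi> a i) = 0" if "i \<in> insert j I" for i
    proof (cases "i = j")
      case True
      then show ?thesis using b(2) by (simp add: sum) (simp add: s_def)
    next
      case False
      then have "(\<Sum>a\<in>A - {b}. c a * (\<phi> a i - \<phi> a j / \<phi> b j * \<phi> b i)) = 0"
        using c0 that by auto
      then have "(\<Sum>a\<in>A - {b}. c a * \<phi> a i) - (\<Sum>a\<in>A - {b}. c a * \<phi> a j) / \<phi> b j * \<phi> b i = 0"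
        by (simp add: algebra_simps sum_subtractf sum_distrib_left sum_divide_distrib)
      then show ?thesis by (simp add: sum s_def)
    qed
    moreover have "\<exists>a\<in>A. c' a \<noteq> 0" using c by (auto simp: c'_def)
    ultimately show ?thesis by blast
  qed
qed

context smooth_algebra
begin

lemma comb_closed_sum:
  fixes c :: "'i \<Rightarrow> real"
  assumes "\<And>u v a b. u \<in> W \<Longrightarrow> v \<in> W \<Longrightarrow> (\<lambda>f. a * u f + b * v f) \<in> (W :: 'a tvec set)"
    and "(\<lambda>f. 0) \<in> W" and "\<And>i. i \<in> I \<Longrightarrow> u i \<in> W"
  shows "(\<lambda>f. \<Sum>i\<in>I. c i * u i f) \<in> W"
  using assms(3)
proof (induction I rule: infinite_finite_induct)
  case (insert i I)
  then show ?case
    using assms(1)[of "u i" "\<lambda>f. \<Sum>i\<in>I. c i * u i f" "c i" 1] by simp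
qed (auto simp: assms(2))

definition orthonormal :: "('a tvec \<Rightarrow> 'a tvec \<Rightarrow> real) \<Rightarrow> 'a tvec set \<Rightarrow> bool" where
  "orthonormal ip A \<longleftrightarrow> (\<forall>a\<in>A. \<forall>b\<in>A. ip a b = (if a = b then 1 else 0))"

lemma orthonormal_coefficient:
  assumes g: "riemannian_metric N g" and p: "p \<in> pts N"
    and A: "finite A" "A \<subseteq> tangent_space N p" "orthonormal (g p) A" and b: "b \<in> A"
  shows "g p (\<lambda>f. \<Sum>a\<in>A. c a * a f) b = c b"
proof -
  have "g p (\<lambda>f. \<Sum>a\<in>A. c a * a f) b = (\<Sum>a\<in>A. c a * g p a b)"
    by (rule metric_sum_left[OF g p]) (use A b in auto)
  also have "\<dots> = (\<Sum>a\<in>A. if a = b then c b else 0)"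
    using A(3) b by (intro sum.cong) (auto simp: orthonormal_def)
  also have "\<dots> = c b" using A(1) b by simp
  finally show ?thesis .
qed

text \<open>A maximal orthonormal subset of \<open>W\<close> works. Its size is at most that of
  \<open>X\<close>: with more vectors some nontrivial combination would be killed by all of
  \<open>X\<close> and hence vanish, against orthonormality. If some \<open>w\<close> were not
  expanded, its normalised residual could be added.\<close>

lemma ex_orthonormal_basis:
  assumes g: "riemannian_metric N g" and p: "p \<in> pts N"
    and X: "finite X" "\<And>v. v \<in> tangent_space N p \<Longrightarrow> (\<forall>f\<in>X. v f = 0) \<Longrightarrow> v = (\<lambda>f. 0)"
    and W: "W \<subseteq> tangent_space N p" "(\<lambda>f. 0) \<in> W"
      "\<And>u v a b. u \<in> W \<Longrightarrow> v \<in> W \<Longrightarrow> (\<lambda>f. a * u f + b * v f) \<in> W"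
  shows "\<exists>A. finite A \<and> A \<subseteq> W \<and> orthonormal (g p) A \<and> (\<forall>w\<in>W. w = (\<lambda>f. \<Sum>a\<in>A. g p w a * a f))"
proof -
  let ?P = "\<lambda>A. finite A \<and> A \<subseteq> W \<and> orthonormal (g p) A"
  have bound: "card A \<le> card X" if A: "?P A" for A
  proof (rule ccontr)
    assume "\<not> card A \<le> card X"
    then obtain c b where b: "b \<in> A" "c b \<noteq> 0" and c: "\<forall>f\<in>X. (\<Sum>a\<in>A. c a * a f) = 0"
      using homogeneous_system[OF X(1), of A "\<lambda>a f. a f"] A by auto
    have "(\<lambda>f. \<Sum>a\<in>A. c a * a f) \<in> tangent_space N p"
      using A W(1) by (intro tangent_sumI) auto
    from X(2)[OF this c] have "(\<lambda>f. \<Sum>a\<in>A. c a * a f) = (\<lambda>f. 0)" .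
    moreover have "g p (\<lambda>f. \<Sum>a\<in>A. c a * a f) b = c b"
      using A W(1) b(1) by (intro orthonormal_coefficient[OF g p]) auto
    moreover have "g p (\<lambda>f. 0) b = 0"
      using A W(1) b(1) by (intro metric_zero[OF g p]) auto
    ultimately show False using b(2) by simp
  qed
  have "?P {}" by (simp add: orthonormal_def)
  then obtain A where A: "?P A" and max: "\<And>B. ?P B \<Longrightarrow> card B \<le> card A"
    using ex_has_greatest_nat[of ?P "{}" card "card X + 1"] bound by (metis less_Suc_eq_le Suc_eq_plus1)
  have AT: "A \<subseteq> tangent_space N p" using A W(1) by auto
  have "w = (\<lambda>f. \<Sum>a\<in>A. g p w a * a f)" if w: "w \<in> W" for w
  proof (rule ccontr)
    assume ne: "w \<noteq> (\<lambda>f. \<Sum>a\<in>A. g p w a * a f)"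
    define s where "s = (\<lambda>f. \<Sum>a\<in>A. g p w a * a f)"
    define r where "r = (\<lambda>f. w f - s f)"
    have sW: "s \<in> W"
      unfolding s_def by (rule comb_closed_sum[OF W(3,2)]) (use A in auto)
    have rW: "r \<in> W"
      using W(3)[OF w sW, of 1 "- 1"] by (simp add: r_def)
    have rT: "r \<in> tangent_space N p" and sT: "s \<in> tangent_space N p" and wT: "w \<in> tangent_space N p"
      using rW sW w W(1) by auto
    have "r \<noteq> (\<lambda>f. 0)" using ne by (auto simp: r_def s_def fun_eq_iff)
    then have pos: "g p r r > 0" by (rule metric_pos[OF g p rT])
    define e where "e = (\<lambda>f. (1 / sqrt (g p r r)) * r f)"
    have eW: "e \<in> W"
      using W(3)[OF rW rW, of "1 / sqrt (g p r r)" 0] by (simp add: e_def)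
    then have eT: "e \<in> tangent_space N p" using W(1) by auto
    have scale: "g p e v = (1 / sqrt (g p r r)) * g p r v" if "v \<in> tangent_space N p" for v
      using metric_lin[OF g p rT rT that, of "1 / sqrt (g p r r)" 0] by (simp add: e_def)
    have "g p r e = (1 / sqrt (g p r r)) * g p r r"
      using scale[OF rT] metric_sym[OF g p rT eT] by simp
    then have ee: "g p e e = 1"
      using scale[OF eT] pos by (simp add: power2_eq_square[symmetric])
    have ea: "g p e a = 0" if a: "a \<in> A" for a
    proof -
      have aT: "a \<in> tangent_space N p" using AT a by auto
      have "g p s a = g p w a"
        unfolding s_def using orthonormal_coefficient[OF g p _ AT _ a] A by auto
      then have "g p r a = 0"
        using metric_diff[OF g p wT sT aT] by (simp add: r_def)
      then show ?thesis using scale[OF aT] by simp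
    qed
    have "e \<notin> A" using ea ee by fastforce
    have ae: "g p a e = 0" if "a \<in> A" for a
      using ea[OF that] metric_sym[OF g p eT, of a] AT that by auto
    have "?P (insert e A)"
      using A eW ee ea ae \<open>e \<notin> A\<close> unfolding orthonormal_def by auto
    from max[OF this] show False using \<open>e \<notin> A\<close> A by simp
  qed
  with A show ?thesis by blast
qed

end

section \<open>Invariant vector fields\<close>

text \<open>All that is kept of the manifold structure of the group. The axioms on derivatives and
  on dimension are the consequences of Hadamard's formula, applied to pullbacks along the
  multiplication.\<close>

locale lie_space = group G + smooth_algebra N
  for G :: "'g monoid" (structure) and N :: "'g smooth_space" +
  assumes pts: "pts N = carrier G"
    and left_translation: "Q \<in> carrier G \<Longrightarrow> f \<in> fns N \<Longrightarrow> (\<lambda>P. f (Q \<otimes> P)) \<in> fns N"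
    and right_translation: "Q \<in> carrier G \<Longrightarrow> f \<in> fns N \<Longrightarrow> (\<lambda>P. f (P \<otimes> Q)) \<in> fns N"
    and left_derivative: "u \<in> tangent_space N \<one> \<Longrightarrow> f \<in> fns N \<Longrightarrow> (\<lambda>Q. u (\<lambda>P. f (Q \<otimes> P))) \<in> fns N"
    and right_derivative: "u \<in> tangent_space N \<one> \<Longrightarrow> f \<in> fns N \<Longrightarrow> (\<lambda>Q. u (\<lambda>P. f (P \<otimes> Q))) \<in> fns N"
    and derivatives_commute: "Q \<in> carrier G \<Longrightarrow> u \<in> tangent_space N \<one> \<Longrightarrow> v \<in> tangent_space N Q \<Longrightarrow>
      f \<in> fns N \<Longrightarrow> u (\<lambda>P. v (\<lambda>R. f (P \<otimes> R))) = v (\<lambda>R. u (\<lambda>P. f (P \<otimes> R)))"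
    and finite_dimensional: "\<exists>X. finite X \<and> (\<forall>v\<in>tangent_space N \<one>. (\<forall>f\<in>X. v f = 0) \<longrightarrow> v = (\<lambda>f. 0))"

lemma lie_space_lie_group:
  assumes "lie_group G MG"
  shows "lie_space G (manifold_space MG)"
proof -
  have G: "group G" and M: "smooth_manifold MG" and top: "topspace (mtop MG) = carrier G"
    and m: "smooth_map (prod_charted MG MG) MG (\<lambda>(P, Q). P \<otimes>\<^bsub>G\<^esub> Q)"
    using assms by (auto simp: lie_group_def)
  interpret group G by fact
  interpret smooth_algebra "manifold_space MG" by (rule smooth_algebra_manifold[OF M])
  note oc = open_charts_manifold[OF M]
  have S2: "(\<lambda>z. f (fst z \<otimes>\<^bsub>G\<^esub> snd z)) \<in> fns (manifold_space (prod_charted MG MG))"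
    if "f \<in> fns (manifold_space MG)" for f
    using fns_smooth_map[OF open_charts_prod[OF oc oc] M m that] by (simp add: split_beta)
  have one: "\<one>\<^bsub>G\<^esub> \<in> topspace (mtop MG)" by (simp add: top)
  show ?thesis
  proof unfold_locales
    show "pts (manifold_space MG) = carrier G" by (simp add: pts_manifold[OF M] top)
  next
    fix Q f assume Q: "Q \<in> carrier G" and f: "f \<in> fns (manifold_space MG)"
    show "(\<lambda>P. f (Q \<otimes>\<^bsub>G\<^esub> P)) \<in> fns (manifold_space MG)"
      using fns_slice_snd[OF M M _ S2[OF f], of Q] Q by (simp add: top)
    show "(\<lambda>P. f (P \<otimes>\<^bsub>G\<^esub> Q)) \<in> fns (manifold_space MG)"
      using fns_slice_fst[OF M M _ S2[OF f], of Q] Q by (simp add: top)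
  next
    fix u f assume u: "u \<in> tangent_space (manifold_space MG) \<one>\<^bsub>G\<^esub>" and f: "f \<in> fns (manifold_space MG)"
    show "(\<lambda>Q. u (\<lambda>P. f (Q \<otimes>\<^bsub>G\<^esub> P))) \<in> fns (manifold_space MG)"
      using partial_derivation_smooth'[OF M one u S2[OF f]] by simp
    show "(\<lambda>Q. u (\<lambda>P. f (P \<otimes>\<^bsub>G\<^esub> Q))) \<in> fns (manifold_space MG)"
      using partial_derivation_smooth[OF M one u S2[OF f]] by simp
    fix Q v assume Q: "Q \<in> carrier G" and v: "v \<in> tangent_space (manifold_space MG) Q"
    then show "u (\<lambda>P. v (\<lambda>R. f (P \<otimes>\<^bsub>G\<^esub> R))) = v (\<lambda>R. u (\<lambda>P. f (P \<otimes>\<^bsub>G\<^esub> R)))"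
      using partial_derivations_commute[OF M one _ u v S2[OF f]] by (simp add: top)
  next
    obtain x :: "'b \<Rightarrow> 'a \<Rightarrow> real" where
      x: "\<forall>v\<in>tangent_space (manifold_space MG) \<one>\<^bsub>G\<^esub>. (\<forall>i\<in>insert 0 Basis. v (x i) = 0) \<longrightarrow> v = (\<lambda>f. 0)"
      using tangent_space_coordinates[OF M one] by auto
    show "\<exists>X. finite X \<and> (\<forall>v\<in>tangent_space (manifold_space MG) \<one>\<^bsub>G\<^esub>. (\<forall>f\<in>X. v f = 0) \<longrightarrow> v = (\<lambda>f. 0))"
      by (rule exI[of _ "x ` insert 0 Basis"]) (use x in simp)
  qed
qed

context lie_space
begin

abbreviation "T \<equiv> tangent_space N \<one>"

abbreviation LI :: "'g tvec \<Rightarrow> 'g vfield" where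
  "LI u \<equiv> left_invariant_field G N u"

text \<open>Right-invariant fields generate left translations, which cover the action; they
  therefore project to the orbit.\<close>

definition RI :: "'g tvec \<Rightarrow> 'g vfield" where
  "RI u = (\<lambda>Q. differential N (\<lambda>P. P \<otimes> Q) u)"

abbreviation br :: "'g tvec \<Rightarrow> 'g tvec \<Rightarrow> 'g tvec" where
  "br u v \<equiv> lie_bracket G N u v"

lemma LI_apply: "f \<in> fns N \<Longrightarrow> LI u Q f = u (\<lambda>P. f (Q \<otimes> P))"
  by (simp add: left_invariant_field_def differential_def o_def)

lemma RI_apply: "f \<in> fns N \<Longrightarrow> RI u Q f = u (\<lambda>P. f (P \<otimes> Q))"
  by (simp add: RI_def differential_def o_def)

lemma differential_left:
  assumes "Q \<in> carrier G" and "u \<in> tangent_space N P"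
  shows "differential N (\<lambda>R. Q \<otimes> R) u \<in> tangent_space N (Q \<otimes> P)"
  by (rule differential_in_tangent_space[OF smooth_algebra_axioms _ assms(2)])
    (simp add: smooth_space_map_def pts assms(1) o_def left_translation)

lemma differential_right:
  assumes "Q \<in> carrier G" and "u \<in> tangent_space N P"
  shows "differential N (\<lambda>R. R \<otimes> Q) u \<in> tangent_space N (P \<otimes> Q)"
  by (rule differential_in_tangent_space[OF smooth_algebra_axioms _ assms(2)])
    (simp add: smooth_space_map_def pts assms(1) o_def right_translation)

lemma LI_tangent: "u \<in> T \<Longrightarrow> Q \<in> carrier G \<Longrightarrow> LI u Q \<in> tangent_space N Q"
  using differential_left[of Q u \<one>] by (simp add: left_invariant_field_def)

lemma RI_tangent: "u \<in> T \<Longrightarrow> Q \<in> carrier G \<Longrightarrow> RI u Q \<in> tangent_space N Q"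
  using differential_right[of Q u \<one>] by (simp add: RI_def)

lemma LI_field: "u \<in> T \<Longrightarrow> LI u \<in> vector_fields N"
  by (simp add: vector_fields_def pts LI_tangent LI_apply left_derivative)

lemma RI_field: "u \<in> T \<Longrightarrow> RI u \<in> vector_fields N"
  by (simp add: vector_fields_def pts RI_tangent RI_apply right_derivative)

lemma LI_fns: "u \<in> T \<Longrightarrow> f \<in> fns N \<Longrightarrow> (\<lambda>Q. LI u Q f) \<in> fns N"
  using LI_field vector_fieldsD(2) by blast

lemma one_pts: "\<one> \<in> pts N"
  by (simp add: pts)

lemma LI_one:
  assumes u: "u \<in> T"
  shows "LI u \<one> = u"
proof (rule tangent_eqI[OF LI_tangent[OF u one_closed] u])
  fix f assume f: "f \<in> fns N"
  show "LI u \<one> f = u f"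
    unfolding LI_apply[OF f]
    by (rule tangent_cong[OF u one_pts left_translation[OF one_closed f]]) (simp add: pts)
qed

lemma RI_one:
  assumes u: "u \<in> T"
  shows "RI u \<one> = u"
proof (rule tangent_eqI[OF RI_tangent[OF u one_closed] u])
  fix f assume f: "f \<in> fns N"
  show "RI u \<one> f = u f"
    unfolding RI_apply[OF f]
    by (rule tangent_cong[OF u one_pts right_translation[OF one_closed f]]) (simp add: pts)
qed

lemma br_tangent:
  assumes "u \<in> T" and "v \<in> T"
  shows "br u v \<in> T"
  unfolding lie_bracket_def
  by (rule vector_fieldsD(1)[OF vf_bracket_field[OF LI_field LI_field] one_pts]) fact+

lemma br_apply:
  assumes "u \<in> T" and "v \<in> T" and "f \<in> fns N"
  shows "br u v f = u (\<lambda>Q. LI v Q f) - v (\<lambda>Q. LI u Q f)"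
  using assms by (simp add: lie_bracket_def vf_bracket_def LI_one)

lemma br_antisym: "br u v = (\<lambda>f. - br v u f)"
  by (auto simp: lie_bracket_def vf_bracket_def)

lemma LI_translate:
  assumes v: "v \<in> T" and Q: "Q \<in> carrier G" and R: "R \<in> carrier G" and f: "f \<in> fns N"
  shows "LI v (Q \<otimes> R) f = LI v R (\<lambda>P. f (Q \<otimes> P))"
  unfolding LI_apply[OF f] LI_apply[OF left_translation[OF Q f]]
  by (rule tangent_cong[OF v one_pts left_translation[OF m_closed[OF Q R] f]])
    (use Q R in \<open>simp add: pts m_assoc\<close>)

text \<open>\<open>lie_bracket\<close> records the commutator at the identity only; invariance under
  left translation carries it to every \<open>Q\<close>.\<close>

lemma LI_br:
  assumes u: "u \<in> T" and v: "v \<in> T" and Q: "Q \<in> carrier G" and f: "f \<in> fns N"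
  shows "LI (br u v) Q f = LI u Q (\<lambda>R. LI v R f) - LI v Q (\<lambda>R. LI u R f)"
proof -
  have *: "LI u Q (\<lambda>R. LI v R f) = u (\<lambda>P. LI v P (\<lambda>R. f (Q \<otimes> R)))"
    if u: "u \<in> T" and v: "v \<in> T" for u v
    unfolding LI_apply[OF LI_fns[OF v f]]
    by (rule tangent_cong[OF u one_pts left_translation[OF Q LI_fns[OF v f]]])
      (simp add: pts LI_translate v Q f)
  show ?thesis
    using br_apply[OF u v left_translation[OF Q f]] *[OF u v] *[OF v u] LI_apply[OF f, of "br u v" Q]
    by simp
qed

text \<open>\<open>RI u\<close> differentiates the left factor of a product and \<open>LI v\<close>
  the right one, so the fields commute as partial derivatives do.\<close>

lemma LI_RI_commute:
  assumes u: "u \<in> T" and v: "v \<in> T" and Q: "Q \<in> carrier G" and f: "f \<in> fns N"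
  shows "LI v Q (\<lambda>R. RI u R f) = RI u Q (\<lambda>R. LI v R f)"
proof -
  have eq: "LI v Q (\<lambda>R. f (P \<otimes> R)) = LI v (P \<otimes> Q) f" if "P \<in> carrier G" for P
    using LI_translate[OF v that Q f] by simp
  have "LI v Q (\<lambda>R. RI u R f) = LI v Q (\<lambda>R. u (\<lambda>P. f (P \<otimes> R)))"
    by (simp add: RI_apply f)
  also have "\<dots> = u (\<lambda>P. LI v Q (\<lambda>R. f (P \<otimes> R)))"
    by (rule derivatives_commute[OF Q u LI_tangent[OF v Q] f, symmetric])
  also have "\<dots> = u (\<lambda>P. LI v (P \<otimes> Q) f)"
    by (rule tangent_cong[OF u one_pts, symmetric])
      (use right_translation[OF Q LI_fns[OF v f]] eq in \<open>simp_all add: pts\<close>)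
  also have "\<dots> = RI u Q (\<lambda>R. LI v R f)"
    by (simp add: RI_apply LI_fns v f)
  finally show ?thesis .
qed

lemma LI_comb: "f \<in> fns N \<Longrightarrow> LI (\<lambda>f. \<Sum>i\<in>I. c i * u i f) Q f = (\<Sum>i\<in>I. c i * LI (u i) Q f)"
  by (simp add: LI_apply)

end

section \<open>Bi-invariant metrics\<close>

locale lie_metric = lie_space +
  fixes g
  assumes metric: "riemannian_metric N g"
    and bi_invariant: "bi_invariant G N g"
begin

lemma LI_metric:
  assumes "u \<in> T" and "v \<in> T" and "Q \<in> carrier G"
  shows "g Q (LI u Q) (LI v Q) = g \<one> u v"
proof -
  have "g (Q \<otimes> \<one>) (differential N (\<lambda>R. Q \<otimes> R) u) (differential N (\<lambda>R. Q \<otimes> R) v) = g \<one> u v"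
    using bi_invariant assms one_closed unfolding bi_invariant_def by blast
  then show ?thesis using assms(3) by (simp add: left_invariant_field_def)
qed

lemma RI_metric:
  assumes "u \<in> T" and "v \<in> T" and "Q \<in> carrier G"
  shows "g Q (RI u Q) (RI v Q) = g \<one> u v"
proof -
  have "g (\<one> \<otimes> Q) (differential N (\<lambda>R. R \<otimes> Q) u) (differential N (\<lambda>R. R \<otimes> Q) v) = g \<one> u v"
    using bi_invariant assms one_closed unfolding bi_invariant_def by blast
  then show ?thesis using assms(3) by (simp add: RI_def)
qed

text \<open>The explicit action of \<open>u\<close> on functions shows later that vertical vectors,
  translated back to the identity, stay vertical.\<close>

lemma LI_surj:
  assumes Q: "Q \<in> carrier G" and w: "w \<in> tangent_space N Q"
  shows "\<exists>u\<in>T. LI u Q = w \<and> (\<forall>f\<in>fns N. u f = w (\<lambda>P. f (inv Q \<otimes> P)))"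
proof
  let ?u = "differential N (\<lambda>R. inv Q \<otimes> R) w"
  show u: "?u \<in> T"
    using differential_left[OF inv_closed[OF Q] w] Q by simp
  have "LI ?u Q = w"
  proof (rule tangent_eqI[OF LI_tangent[OF u Q] w])
    fix f assume f: "f \<in> fns N"
    have "LI ?u Q f = w (\<lambda>P. f (Q \<otimes> (inv Q \<otimes> P)))"
      by (simp add: LI_apply f differential_def left_translation Q o_def)
    also have "\<dots> = w f"
      by (rule tangent_cong[OF w _ f, symmetric]) (use Q in \<open>simp_all add: pts flip: m_assoc\<close>)
    finally show "LI ?u Q f = w f" .
  qed
  then show "LI ?u Q = w \<and> (\<forall>f\<in>fns N. ?u f = w (\<lambda>P. f (inv Q \<otimes> P)))"
    by (simp add: differential_def o_def)
qed

lemma RI_surj: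
  assumes Q: "Q \<in> carrier G" and w: "w \<in> tangent_space N Q"
  shows "\<exists>u\<in>T. RI u Q = w"
proof
  let ?u = "differential N (\<lambda>R. R \<otimes> inv Q) w"
  show u: "?u \<in> T"
    using differential_right[OF inv_closed[OF Q] w] Q by simp
  show "RI ?u Q = w"
  proof (rule tangent_eqI[OF RI_tangent[OF u Q] w])
    fix f assume f: "f \<in> fns N"
    have "RI ?u Q f = w (\<lambda>P. f ((P \<otimes> inv Q) \<otimes> Q))"
      by (simp add: RI_apply f differential_def right_translation Q o_def)
    also have "\<dots> = w f"
      by (rule tangent_cong[OF w _ f, symmetric]) (use Q in \<open>simp_all add: pts m_assoc\<close>)
    finally show "RI ?u Q f = w f" .
  qed
qed

end

locale lie_basis = lie_metric +
  fixes A
  assumes A_finite [simp]: "finite A"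
    and A_tangent: "a \<in> A \<Longrightarrow> a \<in> T"
    and A_orthonormal: "a \<in> A \<Longrightarrow> b \<in> A \<Longrightarrow> g \<one> a b = (if a = b then 1 else 0)"
    and A_expand: "u \<in> T \<Longrightarrow> u = (\<lambda>f. \<Sum>a\<in>A. g \<one> u a * a f)"
begin

lemma A_expand': "u \<in> T \<Longrightarrow> u f = (\<Sum>a\<in>A. g \<one> u a * a f)"
  using A_expand by metis

lemma LI_frame:
  assumes Q: "Q \<in> carrier G" and w: "w \<in> tangent_space N Q" and f: "f \<in> fns N"
  shows "w f = (\<Sum>a\<in>A. g Q w (LI a Q) * LI a Q f)"
proof -
  obtain u where u: "u \<in> T" "LI u Q = w" using LI_surj[OF Q w] by blast
  have "LI u Q f = (\<Sum>a\<in>A. g \<one> u a * LI a Q f)"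
    unfolding LI_apply[OF f] by (rule A_expand'[OF u(1)])
  then show ?thesis
    unfolding u(2)[symmetric] using LI_metric[OF u(1) A_tangent Q] by (simp cong: sum.cong)
qed

lemma RI_frame:
  assumes Q: "Q \<in> carrier G" and w: "w \<in> tangent_space N Q" and f: "f \<in> fns N"
  shows "w f = (\<Sum>a\<in>A. g Q w (RI a Q) * RI a Q f)"
proof -
  obtain u where u: "u \<in> T" "RI u Q = w" using RI_surj[OF Q w] by blast
  have "RI u Q f = (\<Sum>a\<in>A. g \<one> u a * RI a Q f)"
    unfolding RI_apply[OF f] by (rule A_expand'[OF u(1)])
  then show ?thesis
    unfolding u(2)[symmetric] using RI_metric[OF u(1) A_tangent Q] by (simp cong: sum.cong)
qed

text \<open>Parseval's identity, for an arbitrary frame \<open>Z\<close> because it is applied to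
  the left-invariant and to the right-invariant one.\<close>

lemma metric_frame:
  assumes Q: "Q \<in> carrier G" and v: "v \<in> tangent_space N Q" and w: "w \<in> tangent_space N Q"
    and Z: "\<And>a. a \<in> A \<Longrightarrow> Z a \<in> tangent_space N Q"
    and frame: "\<And>f. f \<in> fns N \<Longrightarrow> v f = (\<Sum>a\<in>A. g Q v (Z a) * Z a f)"
  shows "g Q v w = (\<Sum>a\<in>A. g Q v (Z a) * g Q w (Z a))"
proof -
  have p: "Q \<in> pts N" using Q by (simp add: pts)
  have "v = (\<lambda>f. \<Sum>a\<in>A. g Q v (Z a) * Z a f)"
    by (rule tangent_eqI[OF v tangent_sumI[OF Z] frame])
  then have "g Q v w = g Q (\<lambda>f. \<Sum>a\<in>A. g Q v (Z a) * Z a f) w"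
    by (rule arg_cong[where f = "\<lambda>v. g Q v w"])
  also have "\<dots> = (\<Sum>a\<in>A. g Q v (Z a) * g Q (Z a) w)"
    by (rule metric_sum_left[OF metric p w Z])
  also have "\<dots> = (\<Sum>a\<in>A. g Q v (Z a) * g Q w (Z a))"
    by (intro sum.cong refl arg_cong[where f = "\<lambda>x. _ * x"] metric_sym[OF metric p] Z w)
  finally show ?thesis .
qed

text \<open>The coordinates of \<open>Ad(Q\<^sup>-\<^sup>1) u\<close> in the basis \<open>A\<close>.\<close>

definition adc :: "'a tvec \<Rightarrow> 'a tvec \<Rightarrow> 'a \<Rightarrow> real" where
  "adc u a Q = g Q (RI u Q) (LI a Q)"

text \<open>Structure constants, once the arguments run through \<open>A\<close>.\<close>

definition sc :: "'a tvec \<Rightarrow> 'a tvec \<Rightarrow> 'a tvec \<Rightarrow> real" where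
  "sc u v a = g \<one> (br u v) a"

lemma adc_fns: "u \<in> T \<Longrightarrow> a \<in> T \<Longrightarrow> adc u a \<in> fns N"
  using metric_field[OF metric RI_field LI_field, of u a] by (simp add: adc_def[abs_def])

lemma adc_one: "u \<in> T \<Longrightarrow> a \<in> T \<Longrightarrow> adc u a \<one> = g \<one> u a"
  by (simp add: adc_def LI_one RI_one)

lemma RI_adc:
  "u \<in> T \<Longrightarrow> Q \<in> carrier G \<Longrightarrow> f \<in> fns N \<Longrightarrow>
    RI u Q f = (\<Sum>a\<in>A. adc u a Q * LI a Q f)"
  unfolding adc_def by (rule LI_frame[OF _ RI_tangent])

text \<open>\<open>adc\<close> compares two orthonormal frames, so it is an orthogonal matrix:
  Parseval in the left-invariant frame gives the rows, in the right-invariant frame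
  (\<open>adc_columns\<close>) the columns.\<close>

lemma adc_rows:
  assumes "u \<in> T" "v \<in> T" "Q \<in> carrier G"
  shows "(\<Sum>a\<in>A. adc u a Q * adc v a Q) = g \<one> u v"
proof -
  have "g Q (RI u Q) (RI v Q) = (\<Sum>a\<in>A. g Q (RI u Q) (LI a Q) * g Q (RI v Q) (LI a Q))"
    by (intro metric_frame LI_frame LI_tangent A_tangent RI_tangent assms)
  then show ?thesis using RI_metric[OF assms] by (simp add: adc_def)
qed

lemma adc_columns:
  assumes a: "a \<in> T" and b: "b \<in> T" and Q: "Q \<in> carrier G"
  shows "(\<Sum>u\<in>A. adc u a Q * adc u b Q) = g \<one> a b"
proof -
  have p: "Q \<in> pts N" using Q by (simp add: pts)
  have "adc u a Q = g Q (LI a Q) (RI u Q)" if "u \<in> A" "a \<in> T" for u a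
    unfolding adc_def by (rule metric_sym[OF metric p RI_tangent[OF A_tangent[OF that(1)] Q] LI_tangent[OF that(2) Q]])
  then show ?thesis
    using metric_frame[OF Q LI_tangent[OF a Q] LI_tangent[OF b Q] RI_tangent[OF A_tangent Q]
        RI_frame[OF Q LI_tangent[OF a Q]]] LI_metric[OF a b Q] a b
    by (simp cong: sum.cong)
qed

text \<open>Left- and right-invariant fields commute, so differentiating the expansion \<open>RI_adc\<close> along
  \<open>LI w\<close> gives \<open>\<nabla>(Ad(Q\<^sup>-\<^sup>1) u) = - [w, Ad(Q\<^sup>-\<^sup>1) u]\<close>.\<close>

lemma LI_adc:
  assumes w: "w \<in> T" and u: "u \<in> T" and a: "a \<in> A" and Q: "Q \<in> carrier G"
  shows "LI w Q (adc u a) = - (\<Sum>b\<in>A. adc u b Q * sc w b a)"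
proof -
  have p: "Q \<in> pts N" using Q by (simp add: pts)
  note wQ = LI_tangent[OF w Q]
  have Lt: "LI b Q \<in> tangent_space N Q" if "b \<in> A" for b
    by (rule LI_tangent[OF A_tangent[OF that] Q])
  have Bt: "LI (br w b) Q \<in> tangent_space N Q" if "b \<in> A" for b
    by (rule LI_tangent[OF br_tangent[OF w A_tangent[OF that]] Q])
  \<comment> \<open>The product rule for the expansion and the commutation relation give two
    expressions for the same derivative; comparing them yields \<open>s1 = s2\<close>, and pairing
    with \<open>LI a Q\<close> isolates one coefficient.\<close>
  define s1 where "s1 = (\<lambda>f. \<Sum>b\<in>A. LI w Q (adc u b) * LI b Q f)"
  define s2 where "s2 = (\<lambda>f. \<Sum>b\<in>A. (- adc u b Q) * LI (br w b) Q f)"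
  have "s1 = s2"
  proof (rule tangent_eqI)
    show "s1 \<in> tangent_space N Q" unfolding s1_def by (rule tangent_sumI[OF Lt])
    show "s2 \<in> tangent_space N Q" unfolding s2_def by (rule tangent_sumI[OF Bt])
    fix f assume f: "f \<in> fns N"
    have cb: "adc u b \<in> fns N" if "b \<in> A" for b by (rule adc_fns[OF u A_tangent[OF that]])
    have Lb: "(\<lambda>R. LI b R f) \<in> fns N" if "b \<in> A" for b by (rule LI_fns[OF A_tangent[OF that] f])
    have "LI w Q (\<lambda>R. RI u R f) = LI w Q (\<lambda>R. \<Sum>b\<in>A. adc u b R * LI b R f)"
      by (rule tangent_cong[OF wQ p vector_fieldsD(2)[OF RI_field[OF u] f]]) (simp add: pts RI_adc u f)
    also have "\<dots> = (\<Sum>b\<in>A. LI w Q (\<lambda>R. adc u b R * LI b R f))"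
      by (rule tangent_sum[OF wQ fns_mult[OF cb Lb]])
    also have "\<dots> = (\<Sum>b\<in>A. adc u b Q * LI w Q (\<lambda>R. LI b R f) + LI b Q f * LI w Q (adc u b))"
      by (intro sum.cong refl tangent_mult[OF wQ] cb Lb)
    finally have 1: "LI w Q (\<lambda>R. RI u R f) = \<dots>" .
    have "RI u Q (\<lambda>R. LI w R f) = (\<Sum>b\<in>A. adc u b Q * LI b Q (\<lambda>R. LI w R f))"
      by (rule RI_adc[OF u Q LI_fns[OF w f]])
    with 1 LI_RI_commute[OF u w Q f]
    have "(\<Sum>b\<in>A. LI b Q f * LI w Q (adc u b))
        = (\<Sum>b\<in>A. adc u b Q * LI b Q (\<lambda>R. LI w R f)) - (\<Sum>b\<in>A. adc u b Q * LI w Q (\<lambda>R. LI b R f))"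
      by (simp add: sum.distrib)
    also have "\<dots> = (\<Sum>b\<in>A. - adc u b Q * LI (br w b) Q f)"
      unfolding sum_subtractf[symmetric]
      by (intro sum.cong refl) (simp add: LI_br[OF w A_tangent Q f] algebra_simps)
    finally show "s1 f = s2 f" by (simp add: s1_def s2_def mult.commute)
  qed
  then have "g Q s1 (LI a Q) = g Q s2 (LI a Q)" by simp
  moreover have "g Q s1 (LI a Q) = (\<Sum>b\<in>A. LI w Q (adc u b) * g Q (LI b Q) (LI a Q))"
    unfolding s1_def by (rule metric_sum_left[OF metric p Lt[OF a] Lt])
  moreover have "\<dots> = (\<Sum>b\<in>A. if b = a then LI w Q (adc u a) else 0)"
    by (intro sum.cong refl) (simp add: LI_metric A_tangent Q a A_orthonormal)
  moreover have "\<dots> = LI w Q (adc u a)" using a by simp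
  moreover have "g Q s2 (LI a Q) = (\<Sum>b\<in>A. (- adc u b Q) * g Q (LI (br w b) Q) (LI a Q))"
    unfolding s2_def by (rule metric_sum_left[OF metric p Lt[OF a] Bt])
  moreover have "\<dots> = (\<Sum>b\<in>A. (- adc u b Q) * sc w b a)"
    by (intro sum.cong refl) (simp add: LI_metric A_tangent br_tangent w Q a sc_def)
  ultimately show ?thesis by (simp add: sum_negf)
qed

lemma sc_swap12:
  assumes u: "u \<in> T" and v: "v \<in> T" and a: "a \<in> T"
  shows "sc u v a = - sc v u a"
proof -
  have "br u v = (\<lambda>f. (- 1) * br v u f + 0 * br v u f)" by (subst br_antisym) simp
  then have "g \<one> (br u v) a = g \<one> (\<lambda>f. (- 1) * br v u f + 0 * br v u f) a"
    by (rule arg_cong[where f = "\<lambda>x. g \<one> x a"])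
  also have "\<dots> = - g \<one> (br v u) a"
    by (subst metric_lin[OF metric one_pts br_tangent[OF v u] br_tangent[OF v u] a]) simp
  finally show ?thesis by (simp add: sc_def)
qed

text \<open>The rows of \<open>Ad(Q\<^sup>-\<^sup>1)\<close> are orthonormal for all \<open>Q\<close>; differentiate at the identity.\<close>

lemma sc_swap23:
  assumes w: "w \<in> T" and a: "a \<in> A" and b: "b \<in> A"
  shows "sc w a b = - sc w b a"
proof -
  have c: "adc u d \<in> fns N" if "u \<in> A" "d \<in> A" for u d
    by (rule adc_fns[OF A_tangent[OF that(1)] A_tangent[OF that(2)]])
  have c1: "adc u d \<one> = (if u = d then 1 else 0)" if "u \<in> A" "d \<in> A" for u d
    using adc_one[OF A_tangent A_tangent] A_orthonormal that by simp
  \<comment> \<open>At the identity \<open>adc\<close> is the unit matrix, so \<open>LI_adc\<close>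
    reduces to a single structure constant.\<close>
  have D: "w (adc u d) = - sc w u d" if u: "u \<in> A" and d: "d \<in> A" for u d
  proof -
    have "w (adc u d) = - (\<Sum>b\<in>A. adc u b \<one> * sc w b d)"
      using LI_adc[OF w A_tangent[OF u] d one_closed] by (simp add: LI_one[OF w])
    also have "(\<Sum>b\<in>A. adc u b \<one> * sc w b d) = (\<Sum>b\<in>A. if b = u then sc w u d else 0)"
      by (intro sum.cong refl) (auto simp: c1 u)
    finally show ?thesis using u by simp
  qed
  have "w (\<lambda>Q. \<Sum>d\<in>A. adc a d Q * adc b d Q) = w (\<lambda>Q. g \<one> a b)"
    by (rule tangent_cong[OF w one_pts]) (simp_all add: fns_sum fns_mult c a b pts adc_rows A_tangent)
  also have "\<dots> = 0" by (rule tangent_const[OF w])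
  also have "w (\<lambda>Q. \<Sum>d\<in>A. adc a d Q * adc b d Q) = (\<Sum>d\<in>A. w (\<lambda>Q. adc a d Q * adc b d Q))"
    by (rule tangent_sum[OF w fns_mult[OF c c]]) (use a b in auto)
  also have "\<dots> = (\<Sum>d\<in>A. adc a d \<one> * w (adc b d) + adc b d \<one> * w (adc a d))"
    by (intro sum.cong refl tangent_mult[OF w] c a b)
  also have "\<dots> = (\<Sum>d\<in>A. (if d = a then - sc w b a else 0) + (if d = b then - sc w a b else 0))"
    by (intro sum.cong refl) (auto simp: c1 D a b)
  also have "\<dots> = - sc w b a - sc w a b"
    using a b by (simp add: sum.distrib)
  finally show ?thesis by simp
qed

end

section \<open>Horizontal lifts\<close>

text \<open>The orbit enters as the base of an equivariant Riemannian submersion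
  (\<open>\<pi>_act\<close>, \<open>submersion\<close>) with the quotient smooth structure
  (\<open>fns_pullback\<close>). \<open>Ak\<close> and \<open>Am\<close> are the vertical and the
  horizontal part of one orthonormal basis at the identity.\<close>

locale orbit_frame = lie_basis G N g "Ak \<union> Am" + B: smooth_algebra B
  for G :: "'g monoid" (structure) and N g Ak Am and B :: "'m smooth_space" +
  fixes gB :: "'m metric_tensor" and \<pi> :: "'g \<Rightarrow> 'm" and act :: "'g \<Rightarrow> 'm \<Rightarrow> 'm"
  assumes \<pi>_pts: "Q \<in> carrier G \<Longrightarrow> \<pi> Q \<in> pts B"
    and \<pi>_surj: "b \<in> pts B \<Longrightarrow> \<exists>Q\<in>carrier G. \<pi> Q = b"
    and \<pi>_act: "Q \<in> carrier G \<Longrightarrow> P \<in> carrier G \<Longrightarrow> act Q (\<pi> P) = \<pi> (Q \<otimes> P)"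
    and fns_pullback: "f \<in> fns B \<longleftrightarrow> (\<lambda>Q. f (\<pi> Q)) \<in> fns N"
    and metricB: "riemannian_metric B gB"
    and submersion: "riemannian_submersion N g B gB \<pi>"
    and Ak: "Ak \<subseteq> tangent_kernel N B \<pi> \<one>"
    and Am: "Am \<subseteq> orthogonal_complement N g \<one> (tangent_kernel N B \<pi> \<one>)"
begin

abbreviation "\<kk> \<equiv> tangent_kernel N B \<pi> \<one>"
abbreviation "\<mm> \<equiv> orthogonal_complement N g \<one> \<kk>"

text \<open>A frame along \<open>\<pi>\<close>: it depends on \<open>Q\<close> and not only on
  \<open>\<pi> Q\<close>, so it is no vector field on the orbit. For this reason coordinates of
  fields are functions on the group.\<close>

definition E :: "'g tvec \<Rightarrow> 'g \<Rightarrow> 'm tvec" where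
  "E a Q = differential B \<pi> (LI a Q)"

definition lift :: "'m vfield \<Rightarrow> 'g tvec \<Rightarrow> 'g \<Rightarrow> real" where
  "lift X a Q = gB (\<pi> Q) (X (\<pi> Q)) (E a Q)"

definition hor :: "'m vfield \<Rightarrow> 'g \<Rightarrow> 'g tvec" where
  "hor X Q f = (\<Sum>a\<in>Am. lift X a Q * LI a Q f)"

lemma Am_A: "a \<in> Am \<Longrightarrow> a \<in> Ak \<union> Am" and Ak_A: "a \<in> Ak \<Longrightarrow> a \<in> Ak \<union> Am"
  by auto

lemma Am_finite [simp]: "finite Am" and Ak_finite [simp]: "finite Ak"
  using A_finite by auto

lemma Am_tangent: "a \<in> Am \<Longrightarrow> a \<in> T"
  using A_tangent by auto

lemma km_orthogonal:
  assumes "k \<in> \<kk>" and "m \<in> \<mm>"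
  shows "g \<one> m k = 0" and "g \<one> k m = 0"
proof -
  show *: "g \<one> m k = 0" using assms by (simp add: orthogonal_complement_def)
  have "k \<in> T" "m \<in> T"
    using assms by (simp_all add: orthogonal_complement_def tangent_kernel_def)
  then show "g \<one> k m = 0" using * metric_sym[OF metric one_pts] by metis
qed

lemma Ak_Am_disjoint: "Ak \<inter> Am = {}"
proof -
  have False if "a \<in> Ak" "a \<in> Am" for a
    using km_orthogonal(1)[of a a] Ak Am A_orthonormal[of a a] that by auto
  then show ?thesis by blast
qed

lemma sum_A: "(\<Sum>a\<in>Ak \<union> Am. h a) = (\<Sum>a\<in>Ak. h a) + (\<Sum>a\<in>Am. (h a :: real))"
  by (rule sum.union_disjoint) (simp_all add: Ak_Am_disjoint)

lemma pull: "f \<in> fns B \<Longrightarrow> (\<lambda>Q. f (\<pi> Q)) \<in> fns N"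
  by (simp flip: fns_pullback)

lemma E_apply: "f \<in> fns B \<Longrightarrow> E a Q f = LI a Q (\<lambda>P. f (\<pi> P))"
  by (simp add: E_def differential_def o_def)

lemma differential_tangent:
  "Q \<in> carrier G \<Longrightarrow> v \<in> tangent_space N Q \<Longrightarrow> differential B \<pi> v \<in> tangent_space B (\<pi> Q)"
  using submersion unfolding riemannian_submersion_def by (auto simp: pts)

lemma E_tangent: "a \<in> T \<Longrightarrow> Q \<in> carrier G \<Longrightarrow> E a Q \<in> tangent_space B (\<pi> Q)"
  unfolding E_def by (rule differential_tangent[OF _ LI_tangent])

lemma act_fns:
  assumes Q: "Q \<in> carrier G" and f: "f \<in> fns B"
  shows "(\<lambda>b. f (act Q b)) \<in> fns B"
  unfolding fns_pullback
  by (rule fns_cong[OF left_translation[OF Q pull[OF f]]]) (simp add: pts \<pi>_act Q)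

text \<open>Left translation covers the action on the orbit, so it carries the kernel at the
  identity into the kernel at \<open>Q\<close>.\<close>

lemma LI_vertical:
  assumes w: "w \<in> \<kk>" and Q: "Q \<in> carrier G" and f: "f \<in> fns B"
  shows "LI w Q (\<lambda>P. f (\<pi> P)) = 0"
proof -
  have wt: "w \<in> T" and w0: "differential B \<pi> w = (\<lambda>f. 0)"
    using w by (simp_all add: tangent_kernel_def)
  have "LI w Q (\<lambda>P. f (\<pi> P)) = w (\<lambda>P. f (\<pi> (Q \<otimes> P)))"
    by (rule LI_apply[OF pull[OF f]])
  also have "\<dots> = w (\<lambda>P. f (act Q (\<pi> P)))"
    by (rule tangent_cong[OF wt one_pts left_translation[OF Q pull[OF f]]]) (simp add: pts \<pi>_act Q)
  also have "\<dots> = differential B \<pi> w (\<lambda>b. f (act Q b))"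
    using act_fns[OF Q f] by (simp add: differential_def o_def)
  finally show ?thesis by (simp add: w0)
qed

text \<open>A vertical vector at \<open>Q\<close>, translated back to the identity, is vertical
  there and so orthogonal to \<open>a\<close>; left-invariance of the metric transports this to
  \<open>Q\<close>.\<close>

lemma LI_horizontal:
  assumes a: "a \<in> \<mm>" and Q: "Q \<in> carrier G"
  shows "LI a Q \<in> orthogonal_complement N g Q (tangent_kernel N B \<pi> Q)"
proof -
  have at: "a \<in> T" using a by (simp add: orthogonal_complement_def)
  have "g Q (LI a Q) w = 0" if w: "w \<in> tangent_kernel N B \<pi> Q" for w
  proof -
    have wt: "w \<in> tangent_space N Q" and w0: "differential B \<pi> w = (\<lambda>f. 0)"
      using w by (simp_all add: tangent_kernel_def)
    obtain u where u: "u \<in> T" "LI u Q = w" "\<forall>f\<in>fns N. u f = w (\<lambda>P. f (inv Q \<otimes> P))"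
      using LI_surj[OF Q wt] by blast
    have "differential B \<pi> u f = 0" for f
    proof (cases "f \<in> fns B")
      case True
      have iQ: "inv Q \<in> carrier G" using Q by simp
      have "differential B \<pi> u f = w (\<lambda>P. f (\<pi> (inv Q \<otimes> P)))"
        using True u(3) pull[OF True] by (simp add: differential_def o_def)
      also have "\<dots> = w (\<lambda>P. f (act (inv Q) (\<pi> P)))"
        by (rule tangent_cong[OF wt _ left_translation[OF iQ pull[OF True]]]) (use Q in \<open>simp_all add: pts \<pi>_act\<close>)
      also have "\<dots> = differential B \<pi> w (\<lambda>b. f (act (inv Q) b))"
        using act_fns[OF iQ True] by (simp add: differential_def o_def)
      finally show ?thesis by (simp add: w0)
    qed (simp add: differential_def)
    then have "u \<in> \<kk>" using u(1) by (auto simp: tangent_kernel_def)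
    then show ?thesis
      using LI_metric[OF at u(1) Q] km_orthogonal(1)[OF _ a] u(2) by simp
  qed
  then show ?thesis using LI_tangent[OF at Q] by (simp add: orthogonal_complement_def)
qed

lemma E_metric:
  assumes "a \<in> Am" and "b \<in> Am" and Q: "Q \<in> carrier G"
  shows "gB (\<pi> Q) (E a Q) (E b Q) = (if a = b then 1 else 0)"
proof -
  have "gB (\<pi> Q) (E a Q) (E b Q) = g Q (LI a Q) (LI b Q)"
  proof -
    have h: "LI c Q \<in> orthogonal_complement N g Q (tangent_kernel N B \<pi> Q)" if "c \<in> Am" for c
      using LI_horizontal[OF _ Q] Am that by blast
    have "\<forall>u\<in>orthogonal_complement N g Q (tangent_kernel N B \<pi> Q).
        \<forall>v\<in>orthogonal_complement N g Q (tangent_kernel N B \<pi> Q).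
          gB (\<pi> Q) (differential B \<pi> u) (differential B \<pi> v) = g Q u v"
      using submersion Q by (simp add: riemannian_submersion_def pts)
    from bspec[OF bspec[OF this h[OF assms(1)]] h[OF assms(2)]] show ?thesis by (simp add: E_def)
  qed
  then show ?thesis
    using LI_metric[OF Am_tangent Am_tangent Q] A_orthonormal assms by simp
qed

lemma E_vertical: "k \<in> Ak \<Longrightarrow> Q \<in> carrier G \<Longrightarrow> f \<in> fns B \<Longrightarrow> LI k Q (\<lambda>P. f (\<pi> P)) = 0"
  using LI_vertical Ak by auto

text \<open>Coefficients in the orthonormal family \<open>E\<close> are unique, so a lift can be
  read off from any expansion; \<open>lift_star\<close> and \<open>lift_bracket\<close> are found
  this way.\<close>

lemma E_coefficient:
  assumes Q: "Q \<in> carrier G" and v: "v \<in> tangent_space B (\<pi> Q)"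
    and eq: "\<And>f. f \<in> fns B \<Longrightarrow> v f = (\<Sum>a\<in>Am. c a * LI a Q (\<lambda>P. f (\<pi> P)))" and d: "d \<in> Am"
  shows "gB (\<pi> Q) v (E d Q) = c d"
proof -
  have Et: "E a Q \<in> tangent_space B (\<pi> Q)" if "a \<in> Am" for a
    by (rule E_tangent[OF Am_tangent[OF that] Q])
  have "v = (\<lambda>f. \<Sum>a\<in>Am. c a * E a Q f)"
    by (rule B.tangent_eqI[OF v B.tangent_sumI[OF Et]]) (simp_all add: eq E_apply)
  then have "gB (\<pi> Q) v (E d Q) = gB (\<pi> Q) (\<lambda>f. \<Sum>a\<in>Am. c a * E a Q f) (E d Q)"
    by (rule arg_cong[where f = "\<lambda>v. gB (\<pi> Q) v (E d Q)"])
  also have "\<dots> = (\<Sum>a\<in>Am. c a * gB (\<pi> Q) (E a Q) (E d Q))"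
    by (rule B.metric_sum_left[OF metricB \<pi>_pts[OF Q] Et[OF d] Et])
  also have "\<dots> = (\<Sum>a\<in>Am. if a = d then c d else 0)"
    by (intro sum.cong refl) (auto simp: E_metric Q d)
  finally show ?thesis using d by simp
qed

text \<open>The differential is onto, and the \<open>Ak\<close> part of a preimage of
  \<open>v\<close> is projected away.\<close>

lemma E_expand:
  assumes Q: "Q \<in> carrier G" and v: "v \<in> tangent_space B (\<pi> Q)" and f: "f \<in> fns B"
  shows "v f = (\<Sum>a\<in>Am. gB (\<pi> Q) v (E a Q) * LI a Q (\<lambda>P. f (\<pi> P)))"
proof -
  have "v \<in> differential B \<pi> ` tangent_space N Q"
    using submersion v Q unfolding riemannian_submersion_def by (simp add: pts)
  then obtain w where w: "w \<in> tangent_space N Q" "v = differential B \<pi> w" by auto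
  have *: "v f = (\<Sum>a\<in>Am. g Q w (LI a Q) * LI a Q (\<lambda>P. f (\<pi> P)))" if f: "f \<in> fns B" for f
  proof -
    have "v f = w (\<lambda>P. f (\<pi> P))" using f by (simp add: w(2) differential_def o_def)
    also have "\<dots> = (\<Sum>a\<in>Ak \<union> Am. g Q w (LI a Q) * LI a Q (\<lambda>P. f (\<pi> P)))"
      by (rule LI_frame[OF Q w(1) pull[OF f]])
    also have "\<dots> = (\<Sum>a\<in>Am. g Q w (LI a Q) * LI a Q (\<lambda>P. f (\<pi> P)))"
      by (simp add: sum_A E_vertical Q f)
    finally show ?thesis .
  qed
  show ?thesis
    unfolding *[OF f]
    by (intro sum.cong refl arg_cong[where f = "\<lambda>x. x * _"] E_coefficient[OF Q v *, symmetric])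
qed

lemma gB_expand:
  assumes Q: "Q \<in> carrier G" and v: "v \<in> tangent_space B (\<pi> Q)" and w: "w \<in> tangent_space B (\<pi> Q)"
  shows "gB (\<pi> Q) v w = (\<Sum>a\<in>Am. gB (\<pi> Q) v (E a Q) * gB (\<pi> Q) w (E a Q))"
proof -
  have Et: "E a Q \<in> tangent_space B (\<pi> Q)" if "a \<in> Am" for a
    by (rule E_tangent[OF Am_tangent[OF that] Q])
  have "v = (\<lambda>f. \<Sum>a\<in>Am. gB (\<pi> Q) v (E a Q) * E a Q f)"
    by (rule B.tangent_eqI[OF v B.tangent_sumI[OF Et]]) (simp_all add: E_expand[OF Q v] E_apply)
  then have "gB (\<pi> Q) v w = gB (\<pi> Q) (\<lambda>f. \<Sum>a\<in>Am. gB (\<pi> Q) v (E a Q) * E a Q f) w"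
    by (rule arg_cong[where f = "\<lambda>v. gB (\<pi> Q) v w"])
  also have "\<dots> = (\<Sum>a\<in>Am. gB (\<pi> Q) v (E a Q) * gB (\<pi> Q) (E a Q) w)"
    by (rule B.metric_sum_left[OF metricB \<pi>_pts[OF Q] w Et])
  also have "\<dots> = (\<Sum>a\<in>Am. gB (\<pi> Q) v (E a Q) * gB (\<pi> Q) w (E a Q))"
    by (intro sum.cong refl arg_cong[where f = "\<lambda>x. _ * x"] B.metric_sym[OF metricB \<pi>_pts[OF Q]] Et w)
  finally show ?thesis .
qed

lemma field_at: "X \<in> vector_fields B \<Longrightarrow> Q \<in> carrier G \<Longrightarrow> X (\<pi> Q) \<in> tangent_space B (\<pi> Q)"
  using B.vector_fieldsD(1) \<pi>_pts by blast

lemma field_expand: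
  assumes "X \<in> vector_fields B" and "Q \<in> carrier G" and "f \<in> fns B"
  shows "X (\<pi> Q) f = hor X Q (\<lambda>P. f (\<pi> P))"
  unfolding hor_def lift_def by (rule E_expand[OF assms(2) field_at[OF assms(1,2)] assms(3)])

lemma gB_lift:
  assumes "X \<in> vector_fields B" and "Y \<in> vector_fields B" and "Q \<in> carrier G"
  shows "gB (\<pi> Q) (X (\<pi> Q)) (Y (\<pi> Q)) = (\<Sum>a\<in>Am. lift X a Q * lift Y a Q)"
  unfolding lift_def by (rule gB_expand[OF assms(3) field_at[OF assms(1,3)] field_at[OF assms(2,3)]])

lemma hor_tangent: "Q \<in> carrier G \<Longrightarrow> hor X Q \<in> tangent_space N Q"
  unfolding hor_def[abs_def] by (rule tangent_sumI) (rule LI_tangent[OF Am_tangent])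

text \<open>The vector fields generated by the action span every tangent space of \<open>B\<close>.\<close>

definition star :: "'g tvec \<Rightarrow> 'm vfield" where
  "star u = (\<lambda>b f. if f \<in> fns B then u (\<lambda>P. f (act P b)) else 0)"

lemma star_apply:
  assumes u: "u \<in> T" and Q: "Q \<in> carrier G" and f: "f \<in> fns B"
  shows "star u (\<pi> Q) f = RI u Q (\<lambda>P. f (\<pi> P))"
proof -
  have "RI u Q (\<lambda>P. f (\<pi> P)) = u (\<lambda>P. f (\<pi> (P \<otimes> Q)))" by (rule RI_apply[OF pull[OF f]])
  also have "\<dots> = u (\<lambda>P. f (act P (\<pi> Q)))"
    by (rule tangent_cong[OF u one_pts right_translation[OF Q pull[OF f]]]) (simp add: pts \<pi>_act Q)
  finally show ?thesis using f by (simp add: star_def)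
qed

lemma star_field:
  assumes u: "u \<in> T"
  shows "star u \<in> vector_fields B"
proof -
  have "star u b \<in> tangent_space B b" if "b \<in> pts B" for b
  proof -
    obtain Q where Q: "Q \<in> carrier G" "\<pi> Q = b" using \<pi>_surj \<open>b \<in> pts B\<close> by blast
    have "star u (\<pi> Q) = differential B \<pi> (RI u Q)"
    proof
      fix f
      show "star u (\<pi> Q) f = differential B \<pi> (RI u Q) f"
        using star_apply[OF u Q(1), of f]
        by (cases "f \<in> fns B") (simp_all add: differential_def o_def star_def)
    qed
    then show ?thesis
      using differential_tangent[OF Q(1) RI_tangent[OF u Q(1)]] Q(2) by simp
  qed
  moreover have "(\<lambda>b. star u b f) \<in> fns B" if f: "f \<in> fns B" for f
    unfolding fns_pullback
    by (rule fns_cong[OF vector_fieldsD(2)[OF RI_field[OF u] pull[OF f]]]) (simp add: pts star_apply u f)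
  ultimately show ?thesis by (simp add: vector_fields_def)
qed

text \<open>\<open>star u\<close> is the projection of \<open>RI u\<close>, whose expansion
  \<open>RI_adc\<close> loses its \<open>Ak\<close> terms.\<close>

lemma lift_star:
  assumes u: "u \<in> T" and Q: "Q \<in> carrier G" and a: "a \<in> Am"
  shows "lift (star u) a Q = adc u a Q"
  unfolding lift_def
proof (rule E_coefficient[OF Q field_at[OF star_field[OF u] Q] _ a])
  fix f assume f: "f \<in> fns B"
  show "star u (\<pi> Q) f = (\<Sum>a\<in>Am. adc u a Q * LI a Q (\<lambda>P. f (\<pi> P)))"
    unfolding star_apply[OF u Q f] RI_adc[OF u Q pull[OF f]] by (simp add: sum_A E_vertical Q f)
qed

definition star_coeff :: "'m vfield \<Rightarrow> 'g tvec \<Rightarrow> 'm \<Rightarrow> real" where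
  "star_coeff X u b = gB b (X b) (star u b)"

lemma star_coeff_fns: "X \<in> vector_fields B \<Longrightarrow> u \<in> T \<Longrightarrow> star_coeff X u \<in> fns B"
  unfolding star_coeff_def[abs_def] by (rule B.metric_field[OF metricB _ star_field])

lemma star_coeff_lift:
  assumes X: "X \<in> vector_fields B" and Q: "Q \<in> carrier G" and u: "u \<in> T"
  shows "star_coeff X u (\<pi> Q) = (\<Sum>b\<in>Am. lift X b Q * adc u b Q)"
  unfolding star_coeff_def gB_lift[OF X star_field[OF u] Q] by (simp add: lift_star u Q)

lemma adc_columns_Am:
  "a \<in> Am \<Longrightarrow> b \<in> Am \<Longrightarrow> Q \<in> carrier G \<Longrightarrow>
    (\<Sum>u\<in>Ak \<union> Am. adc u a Q * adc u b Q) = (if a = b then 1 else 0)"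
  using adc_columns[OF Am_tangent Am_tangent] A_orthonormal by simp

text \<open>Orthonormality of the columns of \<open>adc\<close> inverts
  \<open>star_coeff_lift\<close>. The right-hand side is visibly smooth, and it separates functions
  coming from the orbit from the matrix \<open>adc\<close>, whose derivatives are known.\<close>

lemma lift_eq:
  assumes X: "X \<in> vector_fields B" and Q: "Q \<in> carrier G" and a: "a \<in> Am"
  shows "lift X a Q = (\<Sum>u\<in>Ak \<union> Am. star_coeff X u (\<pi> Q) * adc u a Q)"
proof -
  have "(\<Sum>u\<in>Ak \<union> Am. star_coeff X u (\<pi> Q) * adc u a Q)
      = (\<Sum>u\<in>Ak \<union> Am. \<Sum>b\<in>Am. lift X b Q * (adc u b Q * adc u a Q))"
    by (intro sum.cong refl) (simp add: star_coeff_lift[OF X Q A_tangent] sum_distrib_right mult.assoc)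
  also have "\<dots> = (\<Sum>b\<in>Am. lift X b Q * (\<Sum>u\<in>Ak \<union> Am. adc u b Q * adc u a Q))"
    by (subst sum.swap) (simp add: sum_distrib_left)
  also have "\<dots> = (\<Sum>b\<in>Am. if b = a then lift X a Q else 0)"
    by (intro sum.cong refl) (auto simp: adc_columns_Am a Q)
  finally show ?thesis using a by simp
qed

lemma lift_fns:
  assumes X: "X \<in> vector_fields B" and a: "a \<in> Am"
  shows "lift X a \<in> fns N"
proof -
  have "(\<lambda>Q. \<Sum>u\<in>Ak \<union> Am. star_coeff X u (\<pi> Q) * adc u a Q) \<in> fns N"
    by (intro fns_sum fns_mult pull star_coeff_fns X adc_fns A_tangent Am_tangent a)
  then show ?thesis by (rule fns_cong) (simp add: pts lift_eq[OF X _ a])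
qed

text \<open>Left-invariant fields from \<open>\<kk>\<close> annihilate pulled back functions at
  every point, hence so does their commutator.\<close>

lemma br_kk:
  assumes "v \<in> \<kk>" and "w \<in> \<kk>"
  shows "br v w \<in> \<kk>"
proof -
  have t: "v \<in> T" "w \<in> T"
    using assms by (simp_all add: tangent_kernel_def)
  have z: "v (\<lambda>Q. LI w Q (\<lambda>P. f (\<pi> P))) = 0"
    if v: "v \<in> \<kk>" and w: "w \<in> \<kk>" and f: "f \<in> fns B" for v w f
  proof -
    have vt: "v \<in> T" and wt: "w \<in> T"
      using v w by (simp_all add: tangent_kernel_def)
    have "v (\<lambda>Q. LI w Q (\<lambda>P. f (\<pi> P))) = v (\<lambda>Q. 0)"
      by (rule tangent_cong[OF vt one_pts LI_fns[OF wt pull[OF f]]]) (simp add: pts LI_vertical w f)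
    then show ?thesis by (simp add: tangent_const[OF vt])
  qed
  have "differential B \<pi> (br v w) = (\<lambda>f. 0)"
    by (rule ext) (simp add: differential_def o_def br_apply t pull z assms)
  then show ?thesis using br_tangent[OF t] by (simp add: tangent_kernel_def)
qed

lemma sc_kk_mm: "k \<in> \<kk> \<Longrightarrow> b \<in> Ak \<Longrightarrow> a \<in> Am \<Longrightarrow> sc k b a = 0"
  unfolding sc_def by (rule km_orthogonal(2)[OF br_kk]) (use Ak Am in auto)

text \<open>Lifts are equivariant: along the fibres they vary by the adjoint action of the isotropy algebra.\<close>

lemma LI_lift_vertical:
  assumes X: "X \<in> vector_fields B" and Q: "Q \<in> carrier G" and a: "a \<in> Am" and k: "k \<in> \<kk>"
  shows "LI k Q (lift X a) = - (\<Sum>b\<in>Am. lift X b Q * sc k b a)"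
proof -
  have kt: "k \<in> T" using k by (simp add: tangent_kernel_def)
  note kQ = LI_tangent[OF kt Q]
  have p: "Q \<in> pts N" using Q by (simp add: pts)
  have cf: "adc u a \<in> fns N" if "u \<in> Ak \<union> Am" for u
    by (rule adc_fns[OF A_tangent[OF that] Am_tangent[OF a]])
  have sf: "(\<lambda>Q. star_coeff X u (\<pi> Q)) \<in> fns N" if "u \<in> Ak \<union> Am" for u
    by (rule pull[OF star_coeff_fns[OF X A_tangent[OF that]]])
  \<comment> \<open>The terms with \<open>b\<close> in \<open>Ak\<close> drop out because
    \<open>\<kk>\<close> is a subalgebra orthogonal to \<open>Am\<close>.\<close>
  have adc: "LI k Q (adc u a) = - (\<Sum>b\<in>Am. adc u b Q * sc k b a)" if "u \<in> Ak \<union> Am" for u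
    unfolding LI_adc[OF kt A_tangent[OF that] Am_A[OF a] Q] by (simp add: sum_A sc_kk_mm k a)
  have "LI k Q (lift X a) = LI k Q (\<lambda>Q. \<Sum>u\<in>Ak \<union> Am. star_coeff X u (\<pi> Q) * adc u a Q)"
    by (rule tangent_cong[OF kQ p lift_fns[OF X a]]) (simp add: pts lift_eq[OF X _ a])
  also have "\<dots> = (\<Sum>u\<in>Ak \<union> Am. LI k Q (\<lambda>Q. star_coeff X u (\<pi> Q) * adc u a Q))"
    by (rule tangent_sum[OF kQ fns_mult[OF sf cf]])
  \<comment> \<open>\<open>star_coeff X u\<close> lives on the orbit, so it is constant along the
    fibres and \<open>adc\<close> alone is differentiated.\<close>
  also have "\<dots> = (\<Sum>u\<in>Ak \<union> Am. star_coeff X u (\<pi> Q) * LI k Q (adc u a))"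
    by (intro sum.cong refl, subst tangent_mult[OF kQ sf cf])
      (simp_all add: LI_vertical k Q star_coeff_fns X A_tangent)
  also have "\<dots> = (\<Sum>u\<in>Ak \<union> Am. \<Sum>b\<in>Am. - (star_coeff X u (\<pi> Q) * adc u b Q * sc k b a))"
    by (intro sum.cong refl) (simp add: adc sum_distrib_left mult.assoc sum_negf)
  also have "\<dots> = (\<Sum>b\<in>Am. - ((\<Sum>u\<in>Ak \<union> Am. star_coeff X u (\<pi> Q) * adc u b Q) * sc k b a))"
    by (subst sum.swap) (simp add: sum_distrib_right sum_negf)
  also have "\<dots> = (\<Sum>b\<in>Am. - (lift X b Q * sc k b a))"
    by (intro sum.cong refl) (simp add: lift_eq[OF X Q])
  finally show ?thesis by (simp add: sum_negf)
qed

end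

section \<open>The curvature of the orbit\<close>

context orbit_frame
begin

text \<open>The bracket of two vectors of \<open>\<mm>\<close> in coordinates; the output index
  \<open>d\<close> is taken both from \<open>Ak\<close> and from \<open>Am\<close>.\<close>

definition brc :: "('g tvec \<Rightarrow> real) \<Rightarrow> ('g tvec \<Rightarrow> real) \<Rightarrow> 'g tvec \<Rightarrow> real" where
  "brc x y d = (\<Sum>a\<in>Am. \<Sum>b\<in>Am. x a * y b * sc a b d)"

abbreviation lifts :: "'m vfield \<Rightarrow> 'g \<Rightarrow> 'g tvec \<Rightarrow> real" where
  "lifts X Q \<equiv> (\<lambda>a. lift X a Q)"

lemma sc_swap: "a \<in> Am \<Longrightarrow> b \<in> Am \<Longrightarrow> d \<in> Ak \<union> Am \<Longrightarrow> sc a b d = - sc b a d"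
  by (rule sc_swap12) (auto intro: A_tangent)

lemma brc_swap:
  assumes "d \<in> Ak \<union> Am"
  shows "brc x y d = - brc y x d"
proof -
  have "brc x y d = (\<Sum>a\<in>Am. \<Sum>b\<in>Am. x b * y a * sc b a d)"
    unfolding brc_def by (rule sum.swap)
  also have "\<dots> = (\<Sum>a\<in>Am. \<Sum>b\<in>Am. - (y a * x b * sc a b d))"
  proof (intro sum.cong refl)
    fix a b assume "a \<in> Am" "b \<in> Am"
    then show "x b * y a * sc b a d = - (y a * x b * sc a b d)"
      using sc_swap[of b a d] assms by simp
  qed
  finally show ?thesis by (simp add: brc_def sum_negf)
qed

lemma brc_self: "d \<in> Ak \<union> Am \<Longrightarrow> brc x x d = 0"
  using brc_swap[of d x x] by simp

lemma brc_add_left: "brc (\<lambda>a. x a + x' a) y d = brc x y d + brc x' y d"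
  by (simp add: brc_def sum.distrib algebra_simps)

lemma brc_cmult_left: "brc (\<lambda>a. c * x a) y d = c * brc x y d"
  by (simp add: brc_def sum_distrib_left mult.assoc)

lemma brc_add_right: "brc x (\<lambda>a. y a + y' a) d = brc x y d + brc x y' d"
  by (simp add: brc_def sum.distrib algebra_simps)

lemma brc_cmult_right: "brc x (\<lambda>a. c * y a) d = c * brc x y d"
  by (simp add: brc_def sum_distrib_left mult.assoc mult.left_commute)

lemma brc_cong_right: "(\<And>b. b \<in> Am \<Longrightarrow> y b = y' b) \<Longrightarrow> brc x y d = brc x y' d"
  by (simp add: brc_def)

lemma brc_cong_left: "(\<And>b. b \<in> Am \<Longrightarrow> x b = x' b) \<Longrightarrow> brc x y d = brc x' y d"
  by (simp add: brc_def)

text \<open>This is \<open>sc_swap23\<close>, the skewness of \<open>ad\<close>, restricted to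
  \<open>\<mm>\<close>; the rest renames summation indices.\<close>

lemma brc_skew: "(\<Sum>d\<in>Am. brc x y d * z d) = - (\<Sum>d\<in>Am. brc x z d * y d)"
proof -
  have "(\<Sum>d\<in>Am. brc x y d * z d) = (\<Sum>d\<in>Am. \<Sum>a\<in>Am. \<Sum>b\<in>Am. x a * y b * z d * sc a b d)"
    by (simp add: brc_def sum_distrib_left sum_distrib_right mult_ac)
  also have "\<dots> = (\<Sum>d\<in>Am. \<Sum>a\<in>Am. \<Sum>b\<in>Am. - (x a * y b * z d * sc a d b))"
  proof (intro sum.cong refl)
    fix d a b assume "d \<in> Am" "a \<in> Am" "b \<in> Am"
    then show "x a * y b * z d * sc a b d = - (x a * y b * z d * sc a d b)"
      using sc_swap23[OF Am_tangent[of a], of b d] by simp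
  qed
  also have "\<dots> = (\<Sum>a\<in>Am. \<Sum>d\<in>Am. \<Sum>b\<in>Am. - (x a * y b * z d * sc a d b))"
    by (rule sum.swap)
  also have "\<dots> = (\<Sum>a\<in>Am. \<Sum>b\<in>Am. \<Sum>d\<in>Am. - (x a * y b * z d * sc a d b))"
    by (intro sum.cong refl sum.swap)
  also have "\<dots> = (\<Sum>b\<in>Am. \<Sum>a\<in>Am. \<Sum>d\<in>Am. - (x a * y b * z d * sc a d b))"
    by (rule sum.swap)
  also have "\<dots> = - (\<Sum>d\<in>Am. brc x z d * y d)"
    by (simp add: brc_def sum_distrib_left sum_distrib_right mult_ac sum_negf)
  finally show ?thesis .
qed

section \<open>Commutators of horizontal lifts\<close>

lemma LI_br_expand:
  assumes u: "u \<in> T" and v: "v \<in> T" and Q: "Q \<in> carrier G" and f: "f \<in> fns N"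
  shows "LI (br u v) Q f = (\<Sum>d\<in>Ak \<union> Am. sc u v d * LI d Q f)"
  unfolding LI_frame[OF Q LI_tangent[OF br_tangent[OF u v] Q] f]
  by (intro sum.cong refl) (simp add: sc_def LI_metric br_tangent u v A_tangent Q)

lemma hor_fns: "X \<in> vector_fields B \<Longrightarrow> f \<in> fns N \<Longrightarrow> (\<lambda>Q. hor X Q f) \<in> fns N"
  unfolding hor_def by (intro fns_sum fns_mult lift_fns LI_fns Am_tangent)

lemma hor_hor:
  assumes X: "X \<in> vector_fields B" and Y: "Y \<in> vector_fields B" and Q: "Q \<in> carrier G" and f: "f \<in> fns N"
  shows "hor X Q (\<lambda>R. hor Y R f) = (\<Sum>d\<in>Am. hor X Q (lift Y d) * LI d Q f)
    + (\<Sum>a\<in>Am. \<Sum>b\<in>Am. lift X a Q * lift Y b Q * LI a Q (\<lambda>R. LI b R f))"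
proof -
  note t = hor_tangent[OF Q, of X]
  have Lb: "(\<lambda>R. LI b R f) \<in> fns N" if "b \<in> Am" for b by (rule LI_fns[OF Am_tangent[OF that] f])
  have "hor X Q (\<lambda>R. hor Y R f) = (\<Sum>b\<in>Am. hor X Q (\<lambda>R. lift Y b R * LI b R f))"
    unfolding hor_def[of Y] by (rule tangent_sum[OF t fns_mult[OF lift_fns[OF Y] Lb]])
  also have "\<dots> = (\<Sum>b\<in>Am. lift Y b Q * hor X Q (\<lambda>R. LI b R f) + LI b Q f * hor X Q (lift Y b))"
    by (intro sum.cong refl tangent_mult[OF t] lift_fns Y Lb)
  also have "\<dots> = (\<Sum>b\<in>Am. hor X Q (lift Y b) * LI b Q f)
      + (\<Sum>b\<in>Am. \<Sum>a\<in>Am. lift X a Q * lift Y b Q * LI a Q (\<lambda>R. LI b R f))"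
    by (simp add: sum.distrib hor_def[of X Q "\<lambda>R. LI _ R f"] sum_distrib_left mult_ac)
  also have "(\<Sum>b\<in>Am. \<Sum>a\<in>Am. lift X a Q * lift Y b Q * LI a Q (\<lambda>R. LI b R f))
      = (\<Sum>a\<in>Am. \<Sum>b\<in>Am. lift X a Q * lift Y b Q * LI a Q (\<lambda>R. LI b R f))"
    by (rule sum.swap)
  finally show ?thesis .
qed

text \<open>The second-order terms combine into fields \<open>LI (br a b)\<close>. Their expansion
  runs over \<open>Ak\<close> as well: the commutator of horizontal fields need not be
  horizontal.\<close>

lemma hor_commutator:
  assumes X: "X \<in> vector_fields B" and Y: "Y \<in> vector_fields B" and Q: "Q \<in> carrier G" and f: "f \<in> fns N"
  shows "hor X Q (\<lambda>R. hor Y R f) - hor Y Q (\<lambda>R. hor X R f)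
    = (\<Sum>d\<in>Am. (hor X Q (lift Y d) - hor Y Q (lift X d)) * LI d Q f)
      + (\<Sum>d\<in>Ak \<union> Am. brc (lifts X Q) (lifts Y Q) d * LI d Q f)"
proof -
  have s: "(\<Sum>a\<in>Am. \<Sum>b\<in>Am. lift Y a Q * lift X b Q * LI a Q (\<lambda>R. LI b R f))
      = (\<Sum>a\<in>Am. \<Sum>b\<in>Am. lift X a Q * lift Y b Q * LI b Q (\<lambda>R. LI a R f))"
    by (subst sum.swap) (simp only: mult.commute)
  have "(\<Sum>a\<in>Am. \<Sum>b\<in>Am. lift X a Q * lift Y b Q * LI a Q (\<lambda>R. LI b R f))
      - (\<Sum>a\<in>Am. \<Sum>b\<in>Am. lift X a Q * lift Y b Q * LI b Q (\<lambda>R. LI a R f))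
      = (\<Sum>a\<in>Am. \<Sum>b\<in>Am. lift X a Q * lift Y b Q * LI (br a b) Q f)"
    unfolding sum_subtractf[symmetric]
    by (intro sum.cong refl) (simp add: LI_br[OF Am_tangent Am_tangent Q f] algebra_simps)
  also have "\<dots> = (\<Sum>a\<in>Am. \<Sum>b\<in>Am. \<Sum>d\<in>Ak \<union> Am. lift X a Q * lift Y b Q * sc a b d * LI d Q f)"
    by (intro sum.cong refl) (simp add: LI_br_expand[OF Am_tangent Am_tangent Q f] sum_distrib_left mult.assoc)
  also have "\<dots> = (\<Sum>a\<in>Am. \<Sum>d\<in>Ak \<union> Am. \<Sum>b\<in>Am. lift X a Q * lift Y b Q * sc a b d * LI d Q f)"
    by (intro sum.cong refl sum.swap)
  also have "\<dots> = (\<Sum>d\<in>Ak \<union> Am. \<Sum>a\<in>Am. \<Sum>b\<in>Am. lift X a Q * lift Y b Q * sc a b d * LI d Q f)"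
    by (rule sum.swap)
  also have "\<dots> = (\<Sum>d\<in>Ak \<union> Am. brc (lifts X Q) (lifts Y Q) d * LI d Q f)"
    by (simp add: brc_def sum_distrib_right)
  finally show ?thesis
    unfolding hor_hor[OF X Y Q f] hor_hor[OF Y X Q f] s
    by (simp add: sum_subtractf left_diff_distrib)
qed

text \<open>Tested on pulled back functions, the \<open>Ak\<close> terms of
  \<open>hor_commutator\<close> vanish.\<close>

lemma lift_bracket:
  assumes X: "X \<in> vector_fields B" and Y: "Y \<in> vector_fields B" and Q: "Q \<in> carrier G" and d: "d \<in> Am"
  shows "lift (vf_bracket B X Y) d Q
    = hor X Q (lift Y d) - hor Y Q (lift X d) + brc (lifts X Q) (lifts Y Q) d"
  unfolding lift_def[of "vf_bracket B X Y"]
proof (rule E_coefficient[OF Q field_at[OF B.vf_bracket_field[OF X Y] Q] _ d])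
  fix f assume f: "f \<in> fns B"
  have *: "X (\<pi> Q) (\<lambda>q. Y q f) = hor X Q (\<lambda>R. hor Y R (\<lambda>P. f (\<pi> P)))"
    if X: "X \<in> vector_fields B" and Y: "Y \<in> vector_fields B" for X Y
  proof -
    note Yf = B.vector_fieldsD(2)[OF Y f]
    show ?thesis
      unfolding field_expand[OF X Q Yf]
      by (rule tangent_cong[OF hor_tangent[OF Q] _ pull[OF Yf]]) (simp_all add: pts Q field_expand[OF Y _ f])
  qed
  have "vf_bracket B X Y (\<pi> Q) f = hor X Q (\<lambda>R. hor Y R (\<lambda>P. f (\<pi> P))) - hor Y Q (\<lambda>R. hor X R (\<lambda>P. f (\<pi> P)))"
    using f by (simp add: vf_bracket_def *[OF X Y] *[OF Y X])
  also have "\<dots> = (\<Sum>d\<in>Am. (hor X Q (lift Y d) - hor Y Q (lift X d)) * LI d Q (\<lambda>P. f (\<pi> P)))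
      + (\<Sum>d\<in>Am. brc (lifts X Q) (lifts Y Q) d * LI d Q (\<lambda>P. f (\<pi> P)))"
    unfolding hor_commutator[OF X Y Q pull[OF f]] by (simp add: sum_A E_vertical Q f)
  finally show "vf_bracket B X Y (\<pi> Q) f = (\<Sum>d\<in>Am. (hor X Q (lift Y d) - hor Y Q (lift X d)
      + brc (lifts X Q) (lifts Y Q) d) * LI d Q (\<lambda>P. f (\<pi> P)))"
    by (simp add: sum.distrib distrib_right)
qed

text \<open>The vertical defect between the commutator of the lifts and the lift of the commutator,
  O'Neill's tensor up to a factor 2. It is the source of the \<open>\<kk>\<close>-component of the
  curvature.\<close>

lemma hor_bracket:
  assumes X: "X \<in> vector_fields B" and Y: "Y \<in> vector_fields B" and Q: "Q \<in> carrier G" and f: "f \<in> fns N"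
  shows "hor X Q (\<lambda>R. hor Y R f) - hor Y Q (\<lambda>R. hor X R f) - hor (vf_bracket B X Y) Q f
    = (\<Sum>k\<in>Ak. brc (lifts X Q) (lifts Y Q) k * LI k Q f)"
  unfolding hor_commutator[OF X Y Q f] hor_def[of "vf_bracket B X Y"]
  by (simp add: lift_bracket X Y Q sum_A sum.distrib distrib_right)

end

section \<open>The Levi-Civita connection and the curvature in terms of lifts\<close>

locale orbit_connection = orbit_frame +
  fixes D
  assumes levi_civita: "levi_civita B gB D"
begin

lemma D_field: "X \<in> vector_fields B \<Longrightarrow> Y \<in> vector_fields B \<Longrightarrow> D X Y \<in> vector_fields B"
  using levi_civita by (simp add: levi_civita_def affine_connection_def)

lemma D_torsion:
  assumes X: "X \<in> vector_fields B" and Y: "Y \<in> vector_fields B" and Q: "Q \<in> carrier G" and d: "d \<in> Am"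
  shows "lift (D X Y) d Q - lift (D Y X) d Q = lift (vf_bracket B X Y) d Q"
proof -
  have "(\<lambda>f. D X Y (\<pi> Q) f - D Y X (\<pi> Q) f) = vf_bracket B X Y (\<pi> Q)"
    using levi_civita X Y \<pi>_pts[OF Q] by (simp add: levi_civita_def)
  then show ?thesis
    using B.metric_diff[OF metricB \<pi>_pts[OF Q] field_at[OF D_field[OF X Y] Q] field_at[OF D_field[OF Y X] Q]
        E_tangent[OF Am_tangent[OF d] Q]]
    by (simp add: lift_def)
qed

lemma D_compatible:
  assumes X: "X \<in> vector_fields B" and Y: "Y \<in> vector_fields B" and Z: "Z \<in> vector_fields B" and Q: "Q \<in> carrier G"
  shows "(\<Sum>d\<in>Am. lift Y d Q * hor X Q (lift Z d) + lift Z d Q * hor X Q (lift Y d))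
    = (\<Sum>d\<in>Am. lift (D X Y) d Q * lift Z d Q) + (\<Sum>d\<in>Am. lift Y d Q * lift (D X Z) d Q)"
proof -
  note t = hor_tangent[OF Q, of X]
  have gf: "(\<lambda>q. gB q (Y q) (Z q)) \<in> fns B" by (rule B.metric_field[OF metricB Y Z])
  have "X (\<pi> Q) (\<lambda>q. gB q (Y q) (Z q)) = gB (\<pi> Q) (D X Y (\<pi> Q)) (Z (\<pi> Q)) + gB (\<pi> Q) (Y (\<pi> Q)) (D X Z (\<pi> Q))"
    using levi_civita X Y Z \<pi>_pts[OF Q] by (simp add: levi_civita_def)
  also have "\<dots> = (\<Sum>d\<in>Am. lift (D X Y) d Q * lift Z d Q) + (\<Sum>d\<in>Am. lift Y d Q * lift (D X Z) d Q)"
    by (simp only: gB_lift[OF D_field[OF X Y] Z Q] gB_lift[OF Y D_field[OF X Z] Q])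
  finally have 1: "X (\<pi> Q) (\<lambda>q. gB q (Y q) (Z q)) = \<dots>" .
  have "X (\<pi> Q) (\<lambda>q. gB q (Y q) (Z q)) = hor X Q (\<lambda>P. gB (\<pi> P) (Y (\<pi> P)) (Z (\<pi> P)))"
    by (rule field_expand[OF X Q gf])
  also have "\<dots> = hor X Q (\<lambda>P. \<Sum>d\<in>Am. lift Y d P * lift Z d P)"
    by (rule tangent_cong[OF t _ pull[OF gf]]) (simp_all add: pts Q gB_lift Y Z)
  also have "\<dots> = (\<Sum>d\<in>Am. hor X Q (\<lambda>P. lift Y d P * lift Z d P))"
    by (rule tangent_sum[OF t fns_mult[OF lift_fns[OF Y] lift_fns[OF Z]]])
  also have "\<dots> = (\<Sum>d\<in>Am. lift Y d Q * hor X Q (lift Z d) + lift Z d Q * hor X Q (lift Y d))"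
    by (intro sum.cong refl tangent_mult[OF t] lift_fns Y Z)
  finally show ?thesis using 1 by simp
qed

text \<open>The difference \<open>W\<close> of both sides is symmetric in \<open>X, Y\<close> because \<open>D\<close> is torsion-free and
  \<open>\<langle>W X Y, Z\<rangle>\<close> is antisymmetric in \<open>Y, Z\<close> because \<open>D\<close> is metric; so it vanishes.\<close>

lemma lift_D:
  assumes X: "X \<in> vector_fields B" and Y: "Y \<in> vector_fields B" and Q: "Q \<in> carrier G" and d: "d \<in> Am"
  shows "lift (D X Y) d Q = hor X Q (lift Y d) + 1 / 2 * brc (lifts X Q) (lifts Y Q) d"
proof -
  define W where "W X Y d = lift (D X Y) d Q - hor X Q (lift Y d) - 1 / 2 * brc (lifts X Q) (lifts Y Q) d" for X Y d
  define t where "t X Y Z = (\<Sum>d\<in>Am. W X Y d * lift Z d Q)" for X Y Z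
  have W_sym: "W X Y d = W Y X d"
    if X: "X \<in> vector_fields B" and Y: "Y \<in> vector_fields B" and d: "d \<in> Am" for X Y d
    using D_torsion[OF X Y Q d] lift_bracket[OF X Y Q d] brc_swap[OF Am_A[OF d], of "lifts Y Q" "lifts X Q"]
    by (simp add: W_def)
  have t_sym: "t X Y Z = t Y X Z"
    if "X \<in> vector_fields B" "Y \<in> vector_fields B" for X Y Z
    unfolding t_def using W_sym[OF that] by simp
  have t_skew: "t X Y Z = - t X Z Y"
    if X: "X \<in> vector_fields B" and Y: "Y \<in> vector_fields B" and Z: "Z \<in> vector_fields B" for X Y Z
  proof -
    have e: "t X Y Z = (\<Sum>d\<in>Am. lift (D X Y) d Q * lift Z d Q) - (\<Sum>d\<in>Am. hor X Q (lift Y d) * lift Z d Q)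
        - 1 / 2 * (\<Sum>d\<in>Am. brc (lifts X Q) (lifts Y Q) d * lift Z d Q)" for Y Z
      unfolding t_def W_def by (simp add: left_diff_distrib sum_subtractf sum_distrib_left mult.assoc)
    show ?thesis
      unfolding e[of Y Z] e[of Z Y]
      using D_compatible[OF X Y Z Q] brc_skew[of "lifts X Q" "lifts Y Q" "lifts Z Q"]
      by (simp add: sum.distrib mult.commute)
  qed
  \<comment> \<open>Alternating the two symmetries returns to the start with the opposite sign:
    \<open>XYZ = - XZY = - ZXY = ZYX = YZX = - YXZ = - XYZ\<close>.\<close>
  have t0: "t X Y Z = 0"
    if "X \<in> vector_fields B" "Y \<in> vector_fields B" "Z \<in> vector_fields B" for X Y Z
    using t_skew[of X Y Z] t_sym[of X Z Y] t_skew[of Z X Y] t_sym[of Z Y X] t_skew[of Y Z X] t_sym[of Y X Z] that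
    by simp
  \<comment> \<open>\<open>t\<close> tests \<open>W\<close> against fields on the orbit only. The
    fundamental fields suffice to recover the coordinate \<open>d\<close>, again because the columns
    of \<open>adc\<close> are orthonormal.\<close>
  have "W X Y d = (\<Sum>e\<in>Am. if e = d then W X Y d else 0)" using d by simp
  also have "\<dots> = (\<Sum>e\<in>Am. W X Y e * (\<Sum>u\<in>Ak \<union> Am. adc u e Q * adc u d Q))"
    by (intro sum.cong refl) (auto simp: adc_columns_Am d Q)
  also have "\<dots> = (\<Sum>e\<in>Am. \<Sum>u\<in>Ak \<union> Am. W X Y e * adc u e Q * adc u d Q)"
    by (simp only: sum_distrib_left mult.assoc)
  also have "\<dots> = (\<Sum>u\<in>Ak \<union> Am. t X Y (star u) * adc u d Q)"
    by (subst sum.swap, intro sum.cong refl) (simp add: t_def lift_star A_tangent Q sum_distrib_right)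
  also have "\<dots> = 0"
    by (intro sum.neutral ballI) (simp add: t0 X Y star_field A_tangent)
  finally show ?thesis by (simp add: W_def)
qed

text \<open>Two contributions survive: the vertical defect of \<open>hor_bracket\<close>, which acts
  on the lift of \<open>Y\<close> through the adjoint action, and a quarter of the bracket of
  \<open>U\<close> with this lift.\<close>

lemma curvature_lift:
  assumes X: "X \<in> vector_fields B" and Y: "Y \<in> vector_fields B" and Q: "Q \<in> carrier G" and d: "d \<in> Am"
  defines "U \<equiv> brc (lifts X Q) (lifts Y Q)"
  shows "gB (\<pi> Q) (curvature B D X Y Y (\<pi> Q)) (E d Q)
    = - (\<Sum>k\<in>Ak. U k * (\<Sum>b\<in>Am. lift Y b Q * sc k b d)) - 1 / 4 * brc U (lifts Y Q) d"
proof -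
  note p = \<pi>_pts[OF Q]
  have F1: "D X (D Y Y) \<in> vector_fields B" and F2: "D Y (D X Y) \<in> vector_fields B"
    and F3: "D (vf_bracket B X Y) Y \<in> vector_fields B" and XY: "vf_bracket B X Y \<in> vector_fields B"
    by (intro D_field X Y B.vf_bracket_field)+
  note a1 = field_at[OF F1 Q] and a2 = field_at[OF F2 Q] and a3 = field_at[OF F3 Q]
  note tX = hor_tangent[OF Q, of X] and tY = hor_tangent[OF Q, of Y]
  have pQ: "Q \<in> pts N" using Q by (simp add: pts)
  note dA = Am_A[OF d]
  define x y where "x = lifts X Q" and "y = lifts Y Q"
  define HXy HYx HYy where "HXy = (\<lambda>b. hor X Q (lift Y b))" and "HYx = (\<lambda>b. hor Y Q (lift X b))"
    and "HYy = (\<lambda>b. hor Y Q (lift Y b))"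
  have sum: "gB (\<pi> Q) (curvature B D X Y Y (\<pi> Q)) (E d Q)
      = lift (D X (D Y Y)) d Q - lift (D Y (D X Y)) d Q - lift (D (vf_bracket B X Y) Y) d Q"
    unfolding curvature_def lift_def
    using B.metric_diff[OF metricB p B.tangent_minus[OF a1 a2] a3 E_tangent[OF Am_tangent[OF d] Q]]
      B.metric_diff[OF metricB p a1 a2 E_tangent[OF Am_tangent[OF d] Q]]
    by simp
  \<comment> \<open>The bracket term of \<open>lift_D\<close> vanishes on equal arguments.\<close>
  have DYY: "lift (D Y Y) e R = hor Y R (lift Y e)" if "e \<in> Am" "R \<in> carrier G" for e R
    using lift_D[OF Y Y that(2,1)] brc_self[OF Am_A[OF that(1)]] by simp
  have t1: "lift (D X (D Y Y)) d Q = hor X Q (\<lambda>R. hor Y R (lift Y d)) + 1 / 2 * brc x HYy d"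
  proof -
    have "hor X Q (lift (D Y Y) d) = hor X Q (\<lambda>R. hor Y R (lift Y d))"
      by (rule tangent_cong[OF tX pQ lift_fns[OF D_field[OF Y Y] d]]) (simp add: pts DYY d)
    moreover have "brc x (lifts (D Y Y) Q) d = brc x HYy d"
      by (rule brc_cong_right) (simp add: DYY Q HYy_def)
    ultimately show ?thesis
      unfolding lift_D[OF X D_field[OF Y Y] Q d] x_def by simp
  qed
  have t2: "lift (D Y (D X Y)) d Q = hor Y Q (\<lambda>R. hor X R (lift Y d)) + 1 / 2 * (brc HYx y d + brc x HYy d)
      + 1 / 2 * (brc y HXy d + 1 / 2 * brc y U d)"
  proof -
    let ?b = "\<lambda>R. brc (lifts X R) (lifts Y R) d"
    have bf: "?b \<in> fns N"
      unfolding brc_def by (intro fns_sum fns_mult lift_fns fns_const X Y)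
    have hb: "hor Y Q ?b = brc HYx y d + brc x HYy d"
    proof -
      have ab: "(\<lambda>R. lift X a R * lift Y b R * sc a b d) \<in> fns N" if "a \<in> Am" "b \<in> Am" for a b
        using that by (intro fns_mult lift_fns fns_const X Y)
      have "hor Y Q ?b = (\<Sum>a\<in>Am. hor Y Q (\<lambda>R. \<Sum>b\<in>Am. lift X a R * lift Y b R * sc a b d))"
        unfolding brc_def by (rule tangent_sum[OF tY fns_sum[OF ab]])
      also have "\<dots> = (\<Sum>a\<in>Am. \<Sum>b\<in>Am. hor Y Q (\<lambda>R. lift X a R * lift Y b R * sc a b d))"
        by (intro sum.cong refl tangent_sum[OF tY] ab)
      also have "\<dots> = (\<Sum>a\<in>Am. \<Sum>b\<in>Am. HYx a * y b * sc a b d + x a * HYy b * sc a b d)"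
      proof (intro sum.cong refl)
        fix a b assume a: "a \<in> Am" and b: "b \<in> Am"
        have "hor Y Q (\<lambda>R. lift X a R * lift Y b R * sc a b d)
            = hor Y Q (\<lambda>R. sc a b d * (lift X a R * lift Y b R))"
          by (simp only: mult.commute)
        also have "\<dots> = sc a b d * hor Y Q (\<lambda>R. lift X a R * lift Y b R)"
          by (intro tangent_cmult[OF tY] fns_mult lift_fns X Y a b)
        also have "hor Y Q (\<lambda>R. lift X a R * lift Y b R)
            = lift X a Q * hor Y Q (lift Y b) + lift Y b Q * hor Y Q (lift X a)"
          by (intro tangent_mult[OF tY] lift_fns X Y a b)
        finally show "hor Y Q (\<lambda>R. lift X a R * lift Y b R * sc a b d) = HYx a * y b * sc a b d + x a * HYy b * sc a b d"
          by (simp add: x_def y_def HYx_def HYy_def algebra_simps)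
      qed
      finally show ?thesis by (simp add: brc_def sum.distrib)
    qed
    have "hor Y Q (lift (D X Y) d) = hor Y Q (\<lambda>R. hor X R (lift Y d) + 1 / 2 * ?b R)"
      by (rule tangent_cong[OF tY pQ lift_fns[OF D_field[OF X Y] d]]) (simp add: pts lift_D[OF X Y _ d])
    also have "\<dots> = hor Y Q (\<lambda>R. hor X R (lift Y d)) + hor Y Q (\<lambda>R. 1 / 2 * ?b R)"
      by (intro tangent_add[OF tY] hor_fns X lift_fns Y d fns_cmult bf)
    also have "hor Y Q (\<lambda>R. 1 / 2 * ?b R) = 1 / 2 * hor Y Q ?b"
      by (rule tangent_cmult[OF tY bf])
    finally have h: "hor Y Q (lift (D X Y) d) = hor Y Q (\<lambda>R. hor X R (lift Y d)) + 1 / 2 * (brc HYx y d + brc x HYy d)"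
      unfolding hb .
    have "brc y (lifts (D X Y) Q) d = brc y (\<lambda>b. HXy b + 1 / 2 * U b) d"
      by (rule brc_cong_right) (simp add: lift_D[OF X Y Q] HXy_def U_def)
    then have "brc y (lifts (D X Y) Q) d = brc y HXy d + 1 / 2 * brc y U d"
      by (simp only: brc_add_right brc_cmult_right)
    then show ?thesis
      unfolding lift_D[OF Y D_field[OF X Y] Q d] h y_def[symmetric] by simp
  qed
  have t3: "lift (D (vf_bracket B X Y) Y) d Q = hor (vf_bracket B X Y) Q (lift Y d)
      + 1 / 2 * (brc HXy y d - brc HYx y d + brc U y d)"
  proof -
    have "brc (lifts (vf_bracket B X Y) Q) y d = brc (\<lambda>b. (HXy b + (- 1) * HYx b) + U b) y d"
      by (rule brc_cong_left) (simp add: lift_bracket[OF X Y Q] HXy_def HYx_def U_def)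
    then have "brc (lifts (vf_bracket B X Y) Q) y d = brc HXy y d - brc HYx y d + brc U y d"
      by (simp only: brc_add_left brc_cmult_left)
    then show ?thesis
      unfolding lift_D[OF XY Y Q d] y_def[symmetric] by simp
  qed
  have "(\<Sum>k\<in>Ak. U k * LI k Q (lift Y d)) = - (\<Sum>k\<in>Ak. U k * (\<Sum>b\<in>Am. lift Y b Q * sc k b d))"
    unfolding sum_negf[symmetric] using Ak
    by (intro sum.cong refl, subst LI_lift_vertical[OF Y Q d]) auto
  then have v: "hor X Q (\<lambda>R. hor Y R (lift Y d)) - hor Y Q (\<lambda>R. hor X R (lift Y d)) - hor (vf_bracket B X Y) Q (lift Y d)
      = - (\<Sum>k\<in>Ak. U k * (\<Sum>b\<in>Am. lift Y b Q * sc k b d))"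
    unfolding hor_bracket[OF X Y Q lift_fns[OF Y d]] U_def .
  have "brc U (lifts Y Q) d = brc U y d" by (simp add: y_def)
  moreover have "hor X Q (\<lambda>R. hor Y R (lift Y d)) = hor Y Q (\<lambda>R. hor X R (lift Y d))
      + hor (vf_bracket B X Y) Q (lift Y d) - (\<Sum>k\<in>Ak. U k * (\<Sum>b\<in>Am. lift Y b Q * sc k b d))"
    using v by (simp add: algebra_simps)
  \<comment> \<open>All brackets containing a differentiated lift cancel. Subtracting
    \<open>t2\<close> contributes 1/4 of \<open>brc U y\<close> after a swap, and subtracting
    \<open>t3\<close> contributes -1/2 of it; together -1/4.\<close>
  ultimately show ?thesis
    unfolding sum t1 t2 t3 using brc_swap[OF dA, of y HXy] brc_swap[OF dA, of y U]
    by (simp add: field_simps)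
qed

theorem sectional_curvature_orbit:
  assumes X: "X \<in> vector_fields B" and Y: "Y \<in> vector_fields B" and Q: "Q \<in> carrier G"
  defines "U \<equiv> brc (lifts X Q) (lifts Y Q)"
  shows "sectional_curvature B gB D (\<pi> Q) X Y = (\<Sum>k\<in>Ak. (U k)\<^sup>2) + 1 / 4 * (\<Sum>d\<in>Am. (U d)\<^sup>2)"
proof -
  define x y where "x = lifts X Q" and "y = lifts Y Q"
  have XY: "vf_bracket B X Y \<in> vector_fields B" by (rule B.vf_bracket_field[OF X Y])
  have c: "curvature B D X Y Y (\<pi> Q) \<in> tangent_space B (\<pi> Q)"
    unfolding curvature_def
    by (intro B.tangent_minus field_at[OF _ Q] D_field X Y XY)
  have "sectional_curvature B gB D (\<pi> Q) X Y
      = (\<Sum>d\<in>Am. gB (\<pi> Q) (curvature B D X Y Y (\<pi> Q)) (E d Q) * x d)"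
    unfolding sectional_curvature_def gB_expand[OF Q c field_at[OF X Q]] by (simp add: x_def lift_def)
  also have "\<dots> = (\<Sum>d\<in>Am. (- (\<Sum>k\<in>Ak. U k * (\<Sum>b\<in>Am. y b * sc k b d)) - 1 / 4 * brc U y d) * x d)"
    unfolding U_def y_def by (intro sum.cong refl) (simp add: curvature_lift[OF X Y Q])
  also have "\<dots> = - (\<Sum>d\<in>Am. (\<Sum>k\<in>Ak. U k * (\<Sum>b\<in>Am. y b * sc k b d)) * x d) - 1 / 4 * (\<Sum>d\<in>Am. brc U y d * x d)"
    by (simp add: distrib_right sum.distrib sum_negf sum_distrib_left mult.assoc sum_subtractf left_diff_distrib)
  \<comment> \<open>By skewness, pairing \<open>[U, y]\<close> with \<open>x\<close> is pairing
    \<open>U\<close> with \<open>[y, x]\<close>, whose \<open>\<mm>\<close> part is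
    \<open>- U\<close>. This makes the quarter positive.\<close>
  also have "(\<Sum>d\<in>Am. brc U y d * x d) = - (\<Sum>d\<in>Am. (U d)\<^sup>2)"
  proof -
    have "(\<Sum>d\<in>Am. brc U y d * x d) = - (\<Sum>d\<in>Am. brc y U d * x d)"
      unfolding sum_negf[symmetric] by (intro sum.cong refl) (simp add: brc_swap[OF Am_A, of _ U y])
    also have "\<dots> = (\<Sum>d\<in>Am. brc y x d * U d)"
      by (subst brc_skew) simp
    also have "\<dots> = - (\<Sum>d\<in>Am. brc x y d * U d)"
      unfolding sum_negf[symmetric] by (intro sum.cong refl) (simp add: brc_swap[OF Am_A, of _ y x])
    finally have "(\<Sum>d\<in>Am. brc U y d * x d) = - (\<Sum>d\<in>Am. brc x y d * U d)" .
    then show ?thesis by (simp add: U_def x_def y_def power2_eq_square)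
  qed
  also have "(\<Sum>d\<in>Am. (\<Sum>k\<in>Ak. U k * (\<Sum>b\<in>Am. y b * sc k b d)) * x d) = - (\<Sum>k\<in>Ak. (U k)\<^sup>2)"
  proof -
    have "(\<Sum>d\<in>Am. (\<Sum>k\<in>Ak. U k * (\<Sum>b\<in>Am. y b * sc k b d)) * x d)
        = (\<Sum>k\<in>Ak. U k * (\<Sum>d\<in>Am. \<Sum>b\<in>Am. x d * y b * sc k b d))"
      by (simp add: sum_distrib_right sum_distrib_left mult_ac) (rule sum.swap)
    also have "\<dots> = (\<Sum>k\<in>Ak. U k * (- U k))"
    proof (intro sum.cong refl arg_cong[where f = "\<lambda>z. _ * z"])
      fix k assume k: "k \<in> Ak"
      \<comment> \<open>Total antisymmetry of the structure constants exchanges the outer indices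
        and brings \<open>k\<close> into the output slot, where \<open>U k\<close> is
        formed.\<close>
      have "sc k b d = - sc d b k" if "b \<in> Am" "d \<in> Am" for b d
      proof -
        have "sc k b d = - sc b k d"
          using k that by (intro sc_swap12 A_tangent) auto
        also have "\<dots> = sc b d k"
          using k that sc_swap23[OF Am_tangent[OF that(1)], of k d] by simp
        also have "\<dots> = - sc d b k"
          using k that by (intro sc_swap) auto
        finally show ?thesis .
      qed
      then show "(\<Sum>d\<in>Am. \<Sum>b\<in>Am. x d * y b * sc k b d) = - U k"
        by (simp add: U_def brc_def x_def y_def sum_negf)
    qed
    finally show ?thesis by (simp add: power2_eq_square sum_negf)
  qed
  finally show ?thesis by simp
qed

end

section \<open>The orbit as the base of a submersion\<close>

lemma smooth_algebra_pullback:
  assumes "smooth_algebra N" and F: "\<And>x. x \<in> pts N \<Longrightarrow> F x \<in> pts N'"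
    and iff: "\<And>f. f \<in> fns N' \<longleftrightarrow> (\<lambda>x. f (F x)) \<in> fns N"
  shows "smooth_algebra N'"
proof -
  interpret smooth_algebra N by fact
  show ?thesis
  proof
    fix f h assume f: "f \<in> fns N'" and eq: "\<And>x. x \<in> pts N' \<Longrightarrow> f x = h x"
    show "h \<in> fns N'"
      unfolding iff by (rule fns_cong[OF f[unfolded iff]]) (simp add: eq F)
  qed (simp_all add: iff fns_add fns_mult)
qed

text \<open>A metric-preserving diffeomorphism of the base changes neither vertical nor horizontal
  spaces. \<open>F\<close> is compared with \<open>c\<close> after \<open>q\<close> on
  \<open>pts N\<close> only, as the action is arbitrary outside the group.\<close>

lemma submersion_isometry:
  assumes "smooth_algebra N" and "smooth_algebra N'" and "smooth_algebra N''"
    and sub: "riemannian_submersion N g N' g' q" and iso: "riemannian_isometry N' g' N'' g'' c"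
    and F: "\<And>x. x \<in> pts N \<Longrightarrow> F x = c (q x)"
  shows "riemannian_submersion N g N'' g'' F"
proof -
  interpret N: smooth_algebra N by fact
  interpret N': smooth_algebra N' by fact
  interpret N'': smooth_algebra N'' by fact
  define i where "i = inv_into (pts N') c"
  have q: "smooth_space_map N N' q" using sub by (simp add: riemannian_submersion_def)
  have c: "smooth_space_map N' N'' c" and i: "smooth_space_map N'' N' i"
    and bij: "bij_betw c (pts N') (pts N'')"
    using iso by (simp_all add: riemannian_isometry_def i_def)
  have q_pts: "q x \<in> pts N'" if "x \<in> pts N" for x using q that by (auto simp: smooth_space_map_def)
  have c_pts: "c y \<in> pts N''" if "y \<in> pts N'" for y using c that by (auto simp: smooth_space_map_def)
  have q_fns: "(\<lambda>x. f (q x)) \<in> fns N" if "f \<in> fns N'" for f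
    using q that by (simp add: smooth_space_map_def o_def)
  have c_fns: "(\<lambda>x. f (c x)) \<in> fns N'" if "f \<in> fns N''" for f
    using c that by (simp add: smooth_space_map_def o_def)
  have i_fns: "(\<lambda>x. f (i x)) \<in> fns N''" if "f \<in> fns N'" for f
    using i that by (simp add: smooth_space_map_def o_def)
  have ic: "i (c y) = y" if "y \<in> pts N'" for y
    using bij that by (simp add: i_def bij_betw_def)
  have F_fns: "(\<lambda>x. f (F x)) \<in> fns N" if "f \<in> fns N''" for f
    by (rule N.fns_cong[OF q_fns[OF c_fns[OF that]]]) (simp add: F)
  have chain: "differential N'' F v = differential N'' c (differential N' q v)"
    if p: "p \<in> pts N" and v: "v \<in> tangent_space N p" for p v
  proof
    fix f
    show "differential N'' F v f = differential N'' c (differential N' q v) f"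
    proof (cases "f \<in> fns N''")
      case True
      have "v (\<lambda>x. f (F x)) = v (\<lambda>x. f (c (q x)))"
        by (rule N.tangent_cong[OF v p F_fns[OF True]]) (simp add: F)
      then show ?thesis using True c_fns[OF True] by (simp add: differential_def o_def)
    qed (simp add: differential_def)
  qed
  have c_onto: "differential N'' c ` tangent_space N' y = tangent_space N'' (c y)" if y: "y \<in> pts N'" for y
  proof
    show "differential N'' c ` tangent_space N' y \<subseteq> tangent_space N'' (c y)"
      using differential_in_tangent_space[OF assms(3) c] by auto
    show "tangent_space N'' (c y) \<subseteq> differential N'' c ` tangent_space N' y"
    proof
      fix w assume w: "w \<in> tangent_space N'' (c y)"
      let ?v = "differential N' i w"
      have v: "?v \<in> tangent_space N' y"
        using differential_in_tangent_space[OF assms(2) i w] ic[OF y] by simp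
      have "differential N'' c ?v = w"
      proof (rule N''.tangent_eqI[OF differential_in_tangent_space[OF assms(3) c v] w])
        fix f assume f: "f \<in> fns N''"
        have "w (\<lambda>x. f (c (i x))) = w f"
          by (rule N''.tangent_cong[OF w c_pts[OF y] f, symmetric])
            (use bij in \<open>simp add: i_def f_inv_into_f bij_betw_def\<close>)
        then show "differential N'' c ?v f = w f"
          using f c_fns[OF f] by (simp add: differential_def o_def)
      qed
      then show "w \<in> differential N'' c ` tangent_space N' y" using v by (rule image_eqI[OF sym])
    qed
  qed
  \<comment> \<open>The inverse \<open>i\<close> is smooth, so each pullback along \<open>q\<close>
    agrees on \<open>pts N\<close> with a pullback along \<open>F\<close>; a vector killing the
    latter kills the former.\<close>
  have kernel: "tangent_kernel N N'' F p = tangent_kernel N N' q p" if p: "p \<in> pts N" for p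
  proof -
    have "differential N'' F v = (\<lambda>f. 0) \<longleftrightarrow> differential N' q v = (\<lambda>f. 0)" if v: "v \<in> tangent_space N p" for v
    proof
      assume 0: "differential N'' F v = (\<lambda>f. 0)"
      have "differential N' q v f = 0" for f
      proof (cases "f \<in> fns N'")
        case True
        have "v (\<lambda>x. f (q x)) = v (\<lambda>x. f (i (F x)))"
          by (rule N.tangent_cong[OF v p q_fns[OF True]]) (simp add: F ic q_pts)
        also have "\<dots> = differential N'' F v (\<lambda>x. f (i x))"
          using i_fns[OF True] by (simp add: differential_def o_def)
        also have "\<dots> = 0" by (simp only: 0)
        finally show ?thesis using True by (simp add: differential_def o_def)
      qed (simp add: differential_def)
      then show "differential N' q v = (\<lambda>f. 0)" by auto
    next
      assume "differential N' q v = (\<lambda>f. 0)"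
      then show "differential N'' F v = (\<lambda>f. 0)"
        unfolding chain[OF p v] by (auto simp: differential_def)
    qed
    then show ?thesis by (auto simp: tangent_kernel_def)
  qed
  have "F \<in> pts N \<rightarrow> pts N''" by (simp add: F c_pts q_pts)
  then have 1: "smooth_space_map N N'' F"
    using F_fns by (simp add: smooth_space_map_def o_def)
  have 2: "differential N'' F ` tangent_space N p = tangent_space N'' (F p)" if p: "p \<in> pts N" for p
  proof -
    have "differential N'' F ` tangent_space N p = differential N'' c ` (differential N' q ` tangent_space N p)"
      unfolding image_image by (rule image_cong) (simp_all add: chain[OF p])
    also have "differential N' q ` tangent_space N p = tangent_space N' (q p)"
      using sub p by (simp add: riemannian_submersion_def)
    finally show ?thesis using c_onto[OF q_pts[OF p]] F[OF p] by simp
  qed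
  have 3: "g'' (F p) (differential N'' F u) (differential N'' F v) = g p u v"
    if p: "p \<in> pts N" and u: "u \<in> orthogonal_complement N g p (tangent_kernel N N'' F p)"
      and v: "v \<in> orthogonal_complement N g p (tangent_kernel N N'' F p)" for p u v
  proof -
    have ut: "u \<in> tangent_space N p" and vt: "v \<in> tangent_space N p"
      using u v by (simp_all add: orthogonal_complement_def)
    have "g'' (F p) (differential N'' F u) (differential N'' F v)
        = g'' (c (q p)) (differential N'' c (differential N' q u)) (differential N'' c (differential N' q v))"
      by (simp add: chain[OF p] ut vt F p)
    also have "\<dots> = g' (q p) (differential N' q u) (differential N' q v)"
      using iso q_pts[OF p] differential_in_tangent_space[OF assms(2) q ut]
        differential_in_tangent_space[OF assms(2) q vt]
      by (simp add: riemannian_isometry_def)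
    also have "\<dots> = g p u v"
      using sub p u v kernel[OF p] by (simp add: riemannian_submersion_def)
    finally show ?thesis .
  qed
  show ?thesis
    unfolding riemannian_submersion_def by (intro conjI ballI 1 2 3)
qed

context smooth_algebra
begin

lemma tangent_kernel_comb:
  assumes u: "u \<in> tangent_kernel N N' F p" and v: "v \<in> tangent_kernel N N' F p"
  shows "(\<lambda>f. a * u f + b * v f) \<in> tangent_kernel N N' F p"
proof -
  have k: "w (f \<circ> F) = 0" if "w \<in> tangent_kernel N N' F p" and "f \<in> fns N'" for w f
  proof -
    have "differential N' F w f = 0" using that(1) by (simp add: tangent_kernel_def)
    then show ?thesis using that(2) by (simp add: differential_def)
  qed
  have "differential N' F (\<lambda>f. a * u f + b * v f) = (\<lambda>f. 0)"
    by (rule ext) (simp add: differential_def k u v)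
  then show ?thesis
    using tangent_comb[of u p v a b] u v by (simp add: tangent_kernel_def)
qed

lemma tangent_kernel_zero: "(\<lambda>f. 0) \<in> tangent_kernel N N' F p"
  by (auto simp: tangent_kernel_def differential_def tangent_zero)

end

lemma component_eqI:
  assumes "w \<in> W" and "(\<lambda>f. u f - w f) \<in> W'"
    and "\<And>v. v \<in> W \<Longrightarrow> (\<lambda>f. u f - v f) \<in> W' \<Longrightarrow> v = w"
  shows "component W W' u = w"
  unfolding component_def by (rule the_equality) (intro conjI assms(1,2), elim conjE, rule assms(3))

context orbit_frame
begin

section \<open>Vertical and horizontal components at the identity\<close>

lemma kk_tangent: "u \<in> \<kk> \<Longrightarrow> u \<in> T"
  by (simp add: tangent_kernel_def)

lemma mm_tangent: "u \<in> \<mm> \<Longrightarrow> u \<in> T"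
  by (simp add: orthogonal_complement_def)

lemmas kk_comb = tangent_kernel_comb[of _ B \<pi> \<one>]
lemmas kk_zero = tangent_kernel_zero[of B \<pi> \<one>]

lemma mm_comb:
  assumes u: "u \<in> \<mm>" and v: "v \<in> \<mm>"
  shows "(\<lambda>f. a * u f + b * v f) \<in> \<mm>"
proof -
  have "g \<one> (\<lambda>f. a * u f + b * v f) w = 0" if w: "w \<in> \<kk>" for w
    using metric_lin[OF metric one_pts mm_tangent[OF u] mm_tangent[OF v] kk_tangent[OF w]]
      km_orthogonal(1)[OF w u] km_orthogonal(1)[OF w v] by simp
  then show ?thesis
    using tangent_comb[OF mm_tangent[OF u] mm_tangent[OF v]] by (simp add: orthogonal_complement_def)
qed

lemma mm_zero: "(\<lambda>f. 0) \<in> \<mm>"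
  by (simp add: orthogonal_complement_def tangent_zero metric_zero[OF metric one_pts kk_tangent])

lemma kk_mm_disjoint:
  assumes "u \<in> \<kk>" and "u \<in> \<mm>"
  shows "u = (\<lambda>f. 0)"
  using metric_pos[OF metric one_pts kk_tangent[OF assms(1)]] km_orthogonal(1)[OF assms] by fastforce

lemma Ak_sum: "(\<lambda>f. \<Sum>k\<in>Ak. c k * k f) \<in> \<kk>"
  by (rule comb_closed_sum[OF kk_comb kk_zero]) (use Ak in auto)

lemma Am_sum: "(\<lambda>f. \<Sum>a\<in>Am. c a * a f) \<in> \<mm>"
  by (rule comb_closed_sum[OF mm_comb mm_zero]) (use Am in auto)

lemma split:
  assumes u: "u \<in> T"
  shows "u = (\<lambda>f. (\<Sum>k\<in>Ak. g \<one> u k * k f) + (\<Sum>a\<in>Am. g \<one> u a * a f))"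
  using A_expand[OF u] by (simp add: sum_A)

lemma kk_eq:
  assumes "v \<in> \<kk>" and "w \<in> \<kk>" and "(\<lambda>f. v f - w f) \<in> \<mm>"
  shows "v = w"
  using kk_mm_disjoint[OF _ assms(3)] kk_comb[OF assms(1,2), of 1 "- 1"] by (simp add: fun_eq_iff)

lemma mm_eq:
  assumes "v \<in> \<mm>" and "w \<in> \<mm>" and "(\<lambda>f. v f - w f) \<in> \<kk>"
  shows "v = w"
  using kk_mm_disjoint[OF assms(3)] mm_comb[OF assms(1,2), of 1 "- 1"] by (simp add: fun_eq_iff)

text \<open>As \<open>component\<close> is a definite description, uniqueness is part of the claim;
  it holds because \<open>\<kk>\<close> and \<open>\<mm>\<close> meet in 0 only, the metric being
  positive definite.\<close>

lemma component_kk: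
  assumes u: "u \<in> T"
  shows "component \<kk> \<mm> u = (\<lambda>f. \<Sum>k\<in>Ak. g \<one> u k * k f)" (is "_ = ?w")
proof (rule component_eqI)
  have e: "u f - ?w f = (\<Sum>a\<in>Am. g \<one> u a * a f)" for f
    using fun_cong[OF split[OF u], of f] by simp
  show "?w \<in> \<kk>" by (rule Ak_sum)
  show m: "(\<lambda>f. u f - ?w f) \<in> \<mm>" unfolding e by (rule Am_sum)
  fix v assume v: "v \<in> \<kk>" "(\<lambda>f. u f - v f) \<in> \<mm>"
  show "v = ?w"
    by (rule kk_eq[OF v(1) Ak_sum]) (use mm_comb[OF m v(2), of 1 "- 1"] in simp)
qed

lemma component_mm:
  assumes u: "u \<in> T"
  shows "component \<mm> \<kk> u = (\<lambda>f. \<Sum>a\<in>Am. g \<one> u a * a f)" (is "_ = ?w")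
proof (rule component_eqI)
  have e: "u f - ?w f = (\<Sum>k\<in>Ak. g \<one> u k * k f)" for f
    using fun_cong[OF split[OF u], of f] by simp
  show "?w \<in> \<mm>" by (rule Am_sum)
  show k: "(\<lambda>f. u f - ?w f) \<in> \<kk>" unfolding e by (rule Ak_sum)
  fix v assume v: "v \<in> \<mm>" "(\<lambda>f. u f - v f) \<in> \<kk>"
  show "v = ?w"
    by (rule mm_eq[OF v(1) Am_sum]) (use kk_comb[OF k v(2), of 1 "- 1"] in simp)
qed

lemma orthonormal_norm:
  assumes C: "C \<subseteq> Ak \<union> Am"
  shows "(tangent_norm g \<one> (\<lambda>f. \<Sum>a\<in>C. c a * a f))\<^sup>2 = (\<Sum>a\<in>C. (c a)\<^sup>2)"
proof -
  let ?w = "\<lambda>f. \<Sum>a\<in>C. c a * a f"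
  have fin: "finite C" by (rule finite_subset[OF C A_finite])
  have t: "a \<in> T" if "a \<in> C" for a using that C A_tangent by auto
  have on: "orthonormal (g \<one>) C"
    unfolding orthonormal_def by (intro ballI A_orthonormal subsetD[OF C])
  have "g \<one> ?w ?w = (\<Sum>a\<in>C. c a * g \<one> ?w a)"
    by (rule metric_sum_right[OF metric one_pts tangent_sumI[OF t] t])
  also have "\<dots> = (\<Sum>a\<in>C. (c a)\<^sup>2)"
    by (intro sum.cong refl)
      (simp add: orthonormal_coefficient[OF metric one_pts fin _ on] t subset_iff power2_eq_square)
  finally have "g \<one> ?w ?w = (\<Sum>a\<in>C. (c a)\<^sup>2)" .
  then show ?thesis
    by (simp add: tangent_norm_def sum_nonneg)
qed

text \<open>Two horizontal vectors with the same projection differ by a vertical one, so they agree;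
  this injectivity is what gives \<open>inv_into\<close> its meaning.\<close>

lemma inv_lift:
  assumes x: "x \<in> \<mm>"
  shows "inv_into \<mm> (differential B \<pi>) (differential B \<pi> x) = x"
proof (rule inv_into_f_f[OF _ x])
  show "inj_on (differential B \<pi>) \<mm>"
  proof (rule inj_onI)
    fix u v assume u: "u \<in> \<mm>" and v: "v \<in> \<mm>" and eq: "differential B \<pi> u = differential B \<pi> v"
    have "differential B \<pi> (\<lambda>f. u f - v f) = (\<lambda>f. 0)"
      using eq by (auto simp: differential_def fun_eq_iff split: if_splits)
    then have "(\<lambda>f. u f - v f) \<in> \<kk>"
      using tangent_minus[OF mm_tangent[OF u] mm_tangent[OF v]] by (simp add: tangent_kernel_def)
    then show "u = v" by (rule mm_eq[OF u v])
  qed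
qed

text \<open>Moving \<open>X (\<pi> Q)\<close> back by \<open>inv Q\<close> turns
  \<open>E a Q\<close> into the projection of \<open>a\<close>. So the vector of
  \<open>\<mm>\<close> in the theorem has the lift of \<open>X\<close> at \<open>Q\<close> as its
  coordinates.\<close>

lemma lift_pull_field:
  assumes X: "X \<in> vector_fields B" and Q: "Q \<in> carrier G" and b0: "b0 = \<pi> \<one>"
  shows "inv_into \<mm> (differential B \<pi>) (pull_field G B act Q X b0) = (\<lambda>f. \<Sum>a\<in>Am. lift X a Q * a f)"
proof -
  let ?x = "\<lambda>f. \<Sum>a\<in>Am. lift X a Q * a f"
  have "pull_field G B act Q X b0 f = differential B \<pi> ?x f" for f
  proof (cases "f \<in> fns B")
    case True
    have iQ: "inv Q \<in> carrier G" using Q by simp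
    note h = act_fns[OF iQ True]
    have "pull_field G B act Q X b0 f = X (\<pi> Q) (\<lambda>b. f (act (inv Q) b))"
      using True \<pi>_act[OF Q one_closed] Q by (simp add: pull_field_def differential_def o_def b0)
    also have "\<dots> = (\<Sum>a\<in>Am. lift X a Q * LI a Q (\<lambda>P. f (act (inv Q) (\<pi> P))))"
      unfolding field_expand[OF X Q h] hor_def ..
    also have "\<dots> = (\<Sum>a\<in>Am. lift X a Q * a (\<lambda>P. f (\<pi> P)))"
    proof (intro sum.cong refl arg_cong[where f = "\<lambda>z. _ * z"])
      fix a assume a: "a \<in> Am"
      have "LI a Q (\<lambda>P. f (act (inv Q) (\<pi> P))) = a (\<lambda>P. f (act (inv Q) (\<pi> (Q \<otimes> P))))"
        by (rule LI_apply[OF pull[OF h]])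
      also have "\<dots> = a (\<lambda>P. f (\<pi> P))"
        by (rule tangent_cong[OF Am_tangent[OF a] one_pts pull[OF True], symmetric])
          (use Q in \<open>simp add: pts \<pi>_act flip: m_assoc\<close>)
      finally show "LI a Q (\<lambda>P. f (act (inv Q) (\<pi> P))) = a (\<lambda>P. f (\<pi> P))" .
    qed
    finally show ?thesis using True by (simp add: differential_def o_def)
  qed (simp add: pull_field_def differential_def)
  then have "pull_field G B act Q X b0 = differential B \<pi> ?x" by auto
  then show ?thesis using inv_lift[OF Am_sum] by simp
qed

text \<open>Bilinearity of \<open>br\<close>, which is defined through vector fields, so that the
  expansion has to be checked on functions.\<close>

lemma br_Am_sum:
  assumes d: "d \<in> Ak \<union> Am"
  shows "g \<one> (br (\<lambda>f. \<Sum>a\<in>Am. x a * a f) (\<lambda>f. \<Sum>a\<in>Am. y a * a f)) d = brc x y d"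
proof -
  let ?x = "\<lambda>f. \<Sum>a\<in>Am. x a * a f" and ?y = "\<lambda>f. \<Sum>a\<in>Am. y a * a f"
  have xt: "?x \<in> T" and yt: "?y \<in> T"
    by (intro mm_tangent Am_sum)+
  have bt: "br a b \<in> T" if "a \<in> Am" "b \<in> Am" for a b
    using that by (intro br_tangent Am_tangent)
  let ?s = "\<lambda>a f. \<Sum>b\<in>Am. y b * br a b f"
  have st: "?s a \<in> T" if "a \<in> Am" for a
    by (rule tangent_sumI) (rule bt[OF that])
  have *: "u (\<lambda>Q. LI (\<lambda>f. \<Sum>a\<in>Am. y a * a f) Q f) = (\<Sum>b\<in>Am. y b * u (\<lambda>Q. LI b Q f))"
    if u: "u \<in> T" and f: "f \<in> fns N" for u y f
  proof -
    have Lb: "(\<lambda>Q. LI b Q f) \<in> fns N" if "b \<in> Am" for b by (rule LI_fns[OF Am_tangent[OF that] f])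
    have "u (\<lambda>Q. LI (\<lambda>f. \<Sum>a\<in>Am. y a * a f) Q f) = u (\<lambda>Q. \<Sum>b\<in>Am. y b * LI b Q f)"
      by (simp only: LI_comb[OF f])
    also have "\<dots> = (\<Sum>b\<in>Am. u (\<lambda>Q. y b * LI b Q f))"
      by (rule tangent_sum[OF u fns_cmult[OF Lb]])
    also have "\<dots> = (\<Sum>b\<in>Am. y b * u (\<lambda>Q. LI b Q f))"
      by (intro sum.cong refl tangent_cmult[OF u] Lb)
    finally show ?thesis .
  qed
  have "br ?x ?y = (\<lambda>f. \<Sum>a\<in>Am. x a * ?s a f)"
  proof (rule tangent_eqI[OF br_tangent[OF xt yt] tangent_sumI[OF st]])
    fix f assume f: "f \<in> fns N"
    have "br ?x ?y f = (\<Sum>b\<in>Am. y b * (\<Sum>a\<in>Am. x a * a (\<lambda>Q. LI b Q f)))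
        - (\<Sum>a\<in>Am. x a * (\<Sum>b\<in>Am. y b * b (\<lambda>Q. LI a Q f)))"
      by (simp only: br_apply[OF xt yt f] *[OF xt f] *[OF yt f])
    also have "(\<Sum>b\<in>Am. y b * (\<Sum>a\<in>Am. x a * a (\<lambda>Q. LI b Q f)))
        = (\<Sum>a\<in>Am. x a * (\<Sum>b\<in>Am. y b * a (\<lambda>Q. LI b Q f)))"
      by (simp only: sum_distrib_left) (subst sum.swap, simp only: mult.left_commute)
    finally have "br ?x ?y f = (\<Sum>a\<in>Am. x a * (\<Sum>b\<in>Am. y b * (a (\<lambda>Q. LI b Q f) - b (\<lambda>Q. LI a Q f))))"
      by (simp add: right_diff_distrib sum_subtractf)
    then show "br ?x ?y f = (\<Sum>a\<in>Am. x a * ?s a f)"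
      by (simp add: br_apply Am_tangent f)
  qed
  then have "g \<one> (br ?x ?y) d = g \<one> (\<lambda>f. \<Sum>a\<in>Am. x a * ?s a f) d"
    by (rule arg_cong[where f = "\<lambda>z. g \<one> z d"])
  also have "\<dots> = (\<Sum>a\<in>Am. x a * g \<one> (?s a) d)"
    by (rule metric_sum_left[OF metric one_pts A_tangent[OF d] st])
  also have "\<dots> = (\<Sum>a\<in>Am. x a * (\<Sum>b\<in>Am. y b * g \<one> (br a b) d))"
    by (intro sum.cong refl arg_cong[where f = "\<lambda>z. _ * z"] metric_sum_left[OF metric one_pts A_tangent[OF d] bt])
  finally show ?thesis by (simp add: brc_def sc_def sum_distrib_left mult.assoc)
qed

end

context orbit_connection
begin

theorem sectional_curvature_bracket:
  assumes X: "X \<in> vector_fields B" and Y: "Y \<in> vector_fields B" and Q: "Q \<in> carrier G" and b0: "b0 = \<pi> \<one>"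
  defines "u \<equiv> inv_into \<mm> (differential B \<pi>) (pull_field G B act Q X b0)"
    and "v \<equiv> inv_into \<mm> (differential B \<pi>) (pull_field G B act Q Y b0)"
  shows "u \<in> \<mm>" and "v \<in> \<mm>"
    and "sectional_curvature B gB D (\<pi> Q) X Y =
      (tangent_norm g \<one> (component \<kk> \<mm> (br u v)))\<^sup>2 + 1 / 4 * (tangent_norm g \<one> (component \<mm> \<kk> (br u v)))\<^sup>2"
proof -
  have u: "u = (\<lambda>f. \<Sum>a\<in>Am. lift X a Q * a f)" and v: "v = (\<lambda>f. \<Sum>a\<in>Am. lift Y a Q * a f)"
    unfolding u_def v_def by (intro lift_pull_field X Y Q b0)+
  show um: "u \<in> \<mm>" and vm: "v \<in> \<mm>" unfolding u v by (rule Am_sum)+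
  have t: "br u v \<in> T" by (intro br_tangent mm_tangent um vm)
  have U: "g \<one> (br u v) d = brc (lifts X Q) (lifts Y Q) d" if "d \<in> Ak \<union> Am" for d
    unfolding u v by (rule br_Am_sum[OF that])
  show "sectional_curvature B gB D (\<pi> Q) X Y =
      (tangent_norm g \<one> (component \<kk> \<mm> (br u v)))\<^sup>2 + 1 / 4 * (tangent_norm g \<one> (component \<mm> \<kk> (br u v)))\<^sup>2"
    unfolding component_kk[OF t] component_mm[OF t]
    by (simp add: orthonormal_norm sectional_curvature_orbit[OF X Y Q] U)
qed

end

section \<open>Bases adapted to the isotropy algebra\<close>

text \<open>Orthonormal bases of \<open>\<kk>\<close> and of its orthogonal complement are joined.
  They expand every \<open>u\<close>, because the residual after projecting \<open>u\<close> to
  \<open>\<kk>\<close> lies in the complement.\<close>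

lemma (in lie_metric) ex_adapted_basis:
  assumes k: "\<kk> \<subseteq> T" "(\<lambda>f. 0) \<in> \<kk>"
      "\<And>u v a b. u \<in> \<kk> \<Longrightarrow> v \<in> \<kk> \<Longrightarrow> (\<lambda>f. a * u f + b * v f) \<in> \<kk>"
  shows "\<exists>Ak Am. Ak \<subseteq> \<kk> \<and> Am \<subseteq> orthogonal_complement N g \<one> \<kk> \<and> lie_basis G N g (Ak \<union> Am)"
proof -
  let ?m = "orthogonal_complement N g \<one> \<kk>"
  note lin = metric_lin[OF metric one_pts] and sym = metric_sym[OF metric one_pts]
  obtain X where X: "finite X" "\<And>v. v \<in> T \<Longrightarrow> (\<forall>f\<in>X. v f = 0) \<Longrightarrow> v = (\<lambda>f. 0)"
    using finite_dimensional by blast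
  have mt: "?m \<subseteq> T" by (auto simp: orthogonal_complement_def)
  have m0: "(\<lambda>f. 0) \<in> ?m"
    using k(1) by (auto simp: orthogonal_complement_def tangent_zero metric_zero[OF metric one_pts])
  have mc: "(\<lambda>f. a * u f + b * v f) \<in> ?m" if "u \<in> ?m" "v \<in> ?m" for u v a b
    using that k(1) by (auto simp: orthogonal_complement_def tangent_comb lin subset_iff)
  have Ak_ex: "\<exists>A. finite A \<and> A \<subseteq> \<kk> \<and> orthonormal (g \<one>) A \<and> (\<forall>w\<in>\<kk>. w = (\<lambda>f. \<Sum>a\<in>A. g \<one> w a * a f))"
    by (rule ex_orthonormal_basis[OF metric one_pts X(1)], erule (1) X(2), rule k(1), rule k(2), erule (1) k(3))
  obtain Ak where Ak: "finite Ak" "Ak \<subseteq> \<kk>" "orthonormal (g \<one>) Ak"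
    and Ak_exp: "\<forall>w\<in>\<kk>. w = (\<lambda>f. \<Sum>a\<in>Ak. g \<one> w a * a f)"
    using Ak_ex by (elim exE conjE)
  have Am_ex: "\<exists>A. finite A \<and> A \<subseteq> ?m \<and> orthonormal (g \<one>) A \<and> (\<forall>w\<in>?m. w = (\<lambda>f. \<Sum>a\<in>A. g \<one> w a * a f))"
    by (rule ex_orthonormal_basis[OF metric one_pts X(1)], erule (1) X(2), rule mt, rule m0, erule (1) mc)
  obtain Am where Am: "finite Am" "Am \<subseteq> ?m" "orthonormal (g \<one>) Am"
    and Am_exp: "\<forall>w\<in>?m. w = (\<lambda>f. \<Sum>a\<in>Am. g \<one> w a * a f)"
    using Am_ex by (elim exE conjE)
  have Akt: "Ak \<subseteq> T" and Amt: "Am \<subseteq> T"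
    using Ak(2) k(1) Am(2) mt by auto
  have mk: "g \<one> a b = 0" if "a \<in> ?m" "b \<in> \<kk>" for a b
    using that by (simp add: orthogonal_complement_def)
  have km: "g \<one> b a = 0" if "a \<in> ?m" "b \<in> \<kk>" for a b
    using mk[OF that] sym[of b a] that k(1) mt by auto
  have disj: "Ak \<inter> Am = {}"
  proof -
    have False if "a \<in> Ak" "a \<in> Am" for a
      using mk[of a a] Ak(2,3) Am(2) that by (auto simp: orthonormal_def)
    then show ?thesis by blast
  qed
  have on: "g \<one> a b = (if a = b then 1 else 0)" if "a \<in> Ak \<union> Am" "b \<in> Ak \<union> Am" for a b
    using that Ak(2,3) Am(2,3) disj mk[of a b] km[of b a] unfolding orthonormal_def by auto
  have exp: "u = (\<lambda>f. \<Sum>a\<in>Ak \<union> Am. g \<one> u a * a f)" if u: "u \<in> T" for u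
  proof -
    define s where "s = (\<lambda>f. \<Sum>a\<in>Ak. g \<one> u a * a f)"
    define r where "r = (\<lambda>f. u f - s f)"
    have sk: "s \<in> \<kk>"
      unfolding s_def by (rule comb_closed_sum[OF k(3,2)]) (use Ak(2) in auto)
    then have st: "s \<in> T" using k(1) by auto
    have rt: "r \<in> T" unfolding r_def by (rule tangent_minus[OF u st])
    have rm: "r \<in> ?m"
    proof -
      have "g \<one> r w = 0" if w: "w \<in> \<kk>" for w
      proof -
        have wt: "w \<in> T" using w k(1) by auto
        have ra: "g \<one> r a = 0" if a: "a \<in> Ak" for a
          using orthonormal_coefficient[OF metric one_pts Ak(1) Akt Ak(3) a, of "g \<one> u"]
            metric_diff[OF metric one_pts u st, of a] Akt a
          by (auto simp: r_def s_def)
        have "g \<one> r w = g \<one> r (\<lambda>f. \<Sum>a\<in>Ak. g \<one> w a * a f)"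
          by (rule arg_cong[OF bspec[OF Ak_exp w]])
        also have "\<dots> = (\<Sum>a\<in>Ak. g \<one> w a * g \<one> r a)"
          by (rule metric_sum_right[OF metric one_pts rt]) (use Akt in auto)
        finally show ?thesis by (simp add: ra)
      qed
      then show ?thesis using rt by (simp add: orthogonal_complement_def)
    qed
    have rc: "g \<one> r a = g \<one> u a" if a: "a \<in> Am" for a
      using metric_diff[OF metric one_pts u st subsetD[OF Amt a]] km[OF subsetD[OF Am(2) a] sk]
      by (simp add: r_def)
    have "u f = (\<Sum>a\<in>Ak \<union> Am. g \<one> u a * a f)" for f
    proof -
      have "r f = (\<Sum>a\<in>Am. g \<one> u a * a f)"
        using fun_cong[OF bspec[OF Am_exp rm], of f] rc by simp
      then show ?thesis
        using sum.union_disjoint[OF Ak(1) Am(1) disj, of "\<lambda>a. g \<one> u a * a f"]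
        by (simp add: r_def s_def)
    qed
    then show ?thesis by (rule ext)
  qed
  have "lie_basis G N g (Ak \<union> Am)"
  proof unfold_locales
    show "finite (Ak \<union> Am)" using Ak(1) Am(1) by simp
    show "a \<in> T" if "a \<in> Ak \<union> Am" for a using that Akt Amt by auto
  qed (fact on exp)+
  then show ?thesis using Ak(2) Am(2) by blast
qed

theorem proposition9:
  fixes G :: "'g monoid"
    and MG :: "('g, 'e::euclidean_space) charted"
    and gG :: "'g metric_tensor"
    and M :: "('m, 'f::euclidean_space) charted"
    and act :: "'g \<Rightarrow> 'm \<Rightarrow> 'm"
    and b0 :: 'm
    and gGK :: "'g set metric_tensor"
    and gB :: "'m metric_tensor"
    and D :: "'m vfield \<Rightarrow> 'm vfield \<Rightarrow> 'm vfield"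
    and Qsel :: "'m \<Rightarrow> 'g"
    and GG :: "'g smooth_space" and BB :: "'m smooth_space" and GK :: "'g set smooth_space"
    and K :: "'g set" and \<pi>0 :: "'g \<Rightarrow> 'm"
    and \<kk> :: "'g tvec set" and \<mm> :: "'g tvec set"
    and lift0 :: "'m vfield \<Rightarrow> 'g tvec"
    and U0 :: "'m vfield \<Rightarrow> 'm vfield \<Rightarrow> 'm \<Rightarrow> 'g tvec"
  assumes "lie_group G MG" and "compact_space (mtop MG)" and "connected_space (mtop MG)"
    and GG: "GG = manifold_space MG"
    and "riemannian_metric GG gG" and "bi_invariant G GG gG"
    and "smooth_manifold M" and "smooth_action G MG M act"
    and "b0 \<in> topspace (mtop M)"
    and BB: "BB = submanifold_space M (orbit G act b0)"
    and K: "K = stabilizer G act b0"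
    and \<pi>0: "\<pi>0 = (\<lambda>Q. act Q b0)"
    and GK: "GK = homogeneous_space G MG K"
    and "riemannian_metric GK gGK"
    and "riemannian_submersion GG gG GK gGK (\<lambda>Q. Q <#\<^bsub>G\<^esub> K)"
    and "riemannian_metric BB gB"
    and "riemannian_isometry GK gGK BB gB (coset_to_orbit act b0)"
    and "levi_civita BB gB D"
    and \<kk>: "\<kk> = tangent_kernel GG BB \<pi>0 \<one>\<^bsub>G\<^esub>"
    and \<mm>: "\<mm> = orthogonal_complement GG gG \<one>\<^bsub>G\<^esub> \<kk>"
    and Qsel: "\<And>\<beta>. \<beta> \<in> pts BB \<Longrightarrow> Qsel \<beta> \<in> carrier G \<and> act (Qsel \<beta>) b0 = \<beta>"
    and lift0: "\<And>Z. lift0 Z = inv_into \<mm> (differential BB \<pi>0) (Z b0)"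
    and U0: "\<And>X Y \<beta>. U0 X Y \<beta> =
               lie_bracket G GG (lift0 (pull_field G BB act (Qsel \<beta>) X))
                                (lift0 (pull_field G BB act (Qsel \<beta>) Y))"
  shows "(\<forall>X\<in>vector_fields BB. \<forall>Y\<in>vector_fields BB. \<forall>\<beta>\<in>pts BB.
            sectional_curvature BB gB D \<beta> X Y =
              (tangent_norm gG \<one>\<^bsub>G\<^esub> (component \<kk> \<mm> (U0 X Y \<beta>)))\<^sup>2 +
              1 / 4 * (tangent_norm gG \<one>\<^bsub>G\<^esub> (component \<mm> \<kk> (U0 X Y \<beta>)))\<^sup>2) \<and>
         ((\<forall>u\<in>\<mm>. \<forall>v\<in>\<mm>. lie_bracket G GG u v \<in> \<kk>) \<longrightarrow>
          (\<forall>X\<in>vector_fields BB. \<forall>Y\<in>vector_fields BB. \<forall>\<beta>\<in>pts BB.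
            U0 X Y \<beta> \<in> \<kk> \<and>
            sectional_curvature BB gB D \<beta> X Y = (tangent_norm gG \<one>\<^bsub>G\<^esub> (U0 X Y \<beta>))\<^sup>2))"
proof -
  interpret lie_space G GG
    unfolding GG by (rule lie_space_lie_group[OF assms(1)])
  interpret lie_metric G GG gG
    by unfold_locales (fact assms(5) assms(6))+
  have action: "group_action G (topspace (mtop M)) act"
    using assms(8) by (simp add: smooth_action_def)
  have act_mult: "act Q (act P b0) = act (Q \<otimes>\<^bsub>G\<^esub> P) b0" if "Q \<in> carrier G" "P \<in> carrier G" for Q P
    using group_action.composition_rule[OF action assms(9) that] by simp
  have act_one: "act \<one>\<^bsub>G\<^esub> b0 = b0"
    using fun_cong[OF group_action.id_eq_one[OF action], of b0] assms(9) by simp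
  have pts_BB: "pts BB = \<pi>0 ` carrier G"
    by (auto simp: BB submanifold_space_def orbit_def \<pi>0)
  \<comment> \<open>\<open>coset_to_orbit\<close> is defined by \<open>the_elem\<close>, so the
    image of the coset must be shown to be a singleton; this is the defining property of the
    stabilizer.\<close>
  have coset: "coset_to_orbit act b0 (Q <#\<^bsub>G\<^esub> K) = \<pi>0 Q" if Q: "Q \<in> carrier G" for Q
  proof -
    have "act (Q \<otimes>\<^bsub>G\<^esub> k) b0 = act Q b0" if "k \<in> K" for k
      using that act_mult[OF Q, of k] by (simp add: K stabilizer_def)
    moreover have "\<one>\<^bsub>G\<^esub> \<in> K" using act_one by (simp add: K stabilizer_def)
    moreover have "(\<lambda>P. act P b0) ` (Q <#\<^bsub>G\<^esub> K) = (\<Union>k\<in>K. {act (Q \<otimes>\<^bsub>G\<^esub> k) b0})"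
      by (simp add: l_coset_def image_UN)
    ultimately have "(\<lambda>P. act P b0) ` (Q <#\<^bsub>G\<^esub> K) = {act Q b0}"
      by auto
    then show ?thesis by (simp add: coset_to_orbit_def \<pi>0)
  qed
  have coset_pts: "Q <#\<^bsub>G\<^esub> K \<in> pts GK" if "Q \<in> carrier G" for Q
    using that by (auto simp: GK homogeneous_space_def LCOSETS_def)
  have fns_GK: "f \<in> fns GK \<longleftrightarrow> (\<lambda>Q. f (Q <#\<^bsub>G\<^esub> K)) \<in> fns GG" for f
    by (simp add: GK GG homogeneous_space_def)
  have alg_GK: "smooth_algebra GK"
    by (rule smooth_algebra_pullback[OF smooth_algebra_axioms _ fns_GK]) (simp add: pts coset_pts)
  \<comment> \<open>Smoothness of the map from cosets to the orbit gives one direction, smoothness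
    of its inverse the other; both are part of the isometry assumption.\<close>
  have fns_BB: "f \<in> fns BB \<longleftrightarrow> (\<lambda>Q. f (\<pi>0 Q)) \<in> fns GG" for f
  proof
    assume "f \<in> fns BB"
    then have "(\<lambda>Q. f (coset_to_orbit act b0 (Q <#\<^bsub>G\<^esub> K))) \<in> fns GG"
      using assms(17) by (simp add: riemannian_isometry_def smooth_space_map_def fns_GK)
    then show "(\<lambda>Q. f (\<pi>0 Q)) \<in> fns GG"
      by (rule fns_cong) (simp add: pts coset)
  next
    let ?i = "inv_into (pts GK) (coset_to_orbit act b0)"
    assume "(\<lambda>Q. f (\<pi>0 Q)) \<in> fns GG"
    then have "(\<lambda>Q. f (coset_to_orbit act b0 (Q <#\<^bsub>G\<^esub> K))) \<in> fns GG"
      by (rule fns_cong) (simp add: pts coset)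
    then have "(\<lambda>c. f (coset_to_orbit act b0 c)) \<in> fns GK"
      by (simp add: fns_GK)
    then have "(\<lambda>b. f (coset_to_orbit act b0 (?i b))) \<in> fns BB"
      using assms(17) by (auto simp: riemannian_isometry_def smooth_space_map_def o_def)
    moreover have "coset_to_orbit act b0 (?i b) = b" if "b \<in> orbit G act b0" for b
      using assms(17) that
      by (simp add: riemannian_isometry_def bij_betw_def f_inv_into_f BB submanifold_space_def)
    \<comment> \<open>Membership in \<open>submanifold_space\<close> depends on values on the orbit
      only, where both functions agree.\<close>
    ultimately show "f \<in> fns BB"
      unfolding BB submanifold_space_def by simp
  qed
  have alg_BB: "smooth_algebra BB"
    by (rule smooth_algebra_pullback[OF smooth_algebra_axioms _ fns_BB]) (simp add: pts pts_BB)
  have submersion: "riemannian_submersion GG gG BB gB \<pi>0"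
    by (rule submersion_isometry[OF smooth_algebra_axioms alg_GK alg_BB assms(15,17)]) (simp add: pts coset)
  obtain Ak Am where Ak: "Ak \<subseteq> \<kk>" and Am: "Am \<subseteq> \<mm>" and basis: "lie_basis G GG gG (Ak \<union> Am)"
    using ex_adapted_basis[of \<kk>] tangent_kernel_comb[of _ BB \<pi>0 "\<one>\<^bsub>G\<^esub>"]
      tangent_kernel_zero[of BB \<pi>0 "\<one>\<^bsub>G\<^esub>"]
    unfolding \<mm> \<kk> by (auto simp: tangent_kernel_def)
  interpret lie_basis G GG gG "Ak \<union> Am" by (rule basis)
  interpret B: smooth_algebra BB by (rule alg_BB)
  interpret orbit_connection G GG gG Ak Am BB gB \<pi>0 act D
    by unfold_locales
      (use Ak Am fns_BB submersion assms(16,18) act_mult in \<open>auto simp: pts_BB \<kk> \<mm> \<pi>0\<close>)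
  have b0: "b0 = \<pi>0 \<one>\<^bsub>G\<^esub>" by (simp add: \<pi>0 act_one)
  have main: "lift0 (pull_field G BB act (Qsel \<beta>) X) \<in> \<mm>"
      "lift0 (pull_field G BB act (Qsel \<beta>) Y) \<in> \<mm>"
      "sectional_curvature BB gB D \<beta> X Y =
        (tangent_norm gG \<one>\<^bsub>G\<^esub> (component \<kk> \<mm> (U0 X Y \<beta>)))\<^sup>2 +
        1 / 4 * (tangent_norm gG \<one>\<^bsub>G\<^esub> (component \<mm> \<kk> (U0 X Y \<beta>)))\<^sup>2"
    if X: "X \<in> vector_fields BB" and Y: "Y \<in> vector_fields BB" and \<beta>: "\<beta> \<in> pts BB" for X Y \<beta>
  proof -
    have Q: "Qsel \<beta> \<in> carrier G" "\<pi>0 (Qsel \<beta>) = \<beta>"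
      using Qsel[OF \<beta>] by (simp_all add: \<pi>0)
    \<comment> \<open>\<open>\<kk>\<close> is folded before \<open>\<mm>\<close>, whose defining
      term contains it.\<close>
    note c = sectional_curvature_bracket[OF X Y Q(1) b0, folded \<kk>, folded \<mm>, folded lift0]
    show "lift0 (pull_field G BB act (Qsel \<beta>) X) \<in> \<mm>" by (rule c(1))
    show "lift0 (pull_field G BB act (Qsel \<beta>) Y) \<in> \<mm>" by (rule c(2))
    show "sectional_curvature BB gB D \<beta> X Y =
        (tangent_norm gG \<one>\<^bsub>G\<^esub> (component \<kk> \<mm> (U0 X Y \<beta>)))\<^sup>2 +
        1 / 4 * (tangent_norm gG \<one>\<^bsub>G\<^esub> (component \<mm> \<kk> (U0 X Y \<beta>)))\<^sup>2"
      using c(3) unfolding U0 Q(2) .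
  qed
  have symmetric: "U0 X Y \<beta> \<in> \<kk> \<and> sectional_curvature BB gB D \<beta> X Y = (tangent_norm gG \<one>\<^bsub>G\<^esub> (U0 X Y \<beta>))\<^sup>2"
    if mm: "\<forall>u\<in>\<mm>. \<forall>v\<in>\<mm>. lie_bracket G GG u v \<in> \<kk>"
      and XY: "X \<in> vector_fields BB" "Y \<in> vector_fields BB" "\<beta> \<in> pts BB" for X Y \<beta>
  proof -
    have U: "U0 X Y \<beta> \<in> \<kk>"
      unfolding U0 using mm main(1,2)[OF XY] by blast
    have "component \<kk> \<mm> (U0 X Y \<beta>) = U0 X Y \<beta>"
      unfolding \<mm> \<kk> using U[unfolded \<kk>] by (intro component_eqI) (auto simp: mm_zero intro: kk_eq[symmetric])
    moreover have "component \<mm> \<kk> (U0 X Y \<beta>) = (\<lambda>f. 0)"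
    proof (rule component_eqI)
      show "(\<lambda>f. 0) \<in> \<mm>" unfolding \<mm> \<kk> by (rule mm_zero)
      show "(\<lambda>f. U0 X Y \<beta> f - 0) \<in> \<kk>" using U by simp
      fix v assume v: "v \<in> \<mm>" "(\<lambda>f. U0 X Y \<beta> f - v f) \<in> \<kk>"
      \<comment> \<open>This combination is \<open>v\<close> itself, a difference of two elements of
        \<open>\<kk>\<close>; so \<open>v\<close> lies in both summands and vanishes.\<close>
      have "(\<lambda>f. 1 * U0 X Y \<beta> f + (- 1) * (U0 X Y \<beta> f - v f)) \<in> \<kk>"
        using U v(2) unfolding \<kk> by (rule kk_comb)
      then have "v \<in> \<kk>" by simp
      then show "v = (\<lambda>f. 0)" using v(1) unfolding \<mm> \<kk> by (rule kk_mm_disjoint)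
    qed
    moreover have "tangent_norm gG \<one>\<^bsub>G\<^esub> (\<lambda>f. 0) = 0"
      using metric_zero[OF metric one_pts tangent_zero] by (simp add: tangent_norm_def)
    ultimately show ?thesis using U main(3)[OF XY] by simp
  qed
  show ?thesis
    by (intro conjI impI ballI main(3)) (simp_all add: symmetric)
qed

end
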